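(* Let $f$ be a pseudo-polynomial. There exist an exponent $\eta>0$ and a constant $C>0$, both depending only on $f$, such that for every real number $\xi$ and every sufficiently large $N\in\mathbb{N}$, \[\min_{\substack{1\le p\le N\\ p\text{ prime}}}\lVert\xi\lfloor f(p)\rfloor\rVert\le C N^{-\eta}.\]
   Context: A pseudo-polynomial is a function $f(x)=\alpha_1x^{\theta_1}+\cdots+\alpha_dx^{\theta_d}$ where $\alpha_1,\dots,\alpha_d,\theta_1,\dots,\theta_d$ are positive reals with $1\le\theta_1<\cdots<\theta_d$ and at least one $\theta_j\notin\mathbb{Z}$. $\lVert x\rVert$ denotes the distance from $x$ to the nearest integer, and $\lfloor\cdot\rfloor$ the floor function. *)

theory Defs
  imports "HOL-Analysis.Analysis" "HOL-Computational_Algebra.Primes"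
begin

definition dist_nint :: "real \<Rightarrow> real" where
  "dist_nint x = \<bar>x - of_int (round x)\<bar>"

definition pseudo_poly :: "nat \<Rightarrow> (nat \<Rightarrow> real) \<Rightarrow> (nat \<Rightarrow> real) \<Rightarrow> bool" where
  "pseudo_poly d \<alpha> \<theta> \<longleftrightarrow>
     (\<forall>j\<in>{1..d}. \<alpha> j > 0 \<and> \<theta> j > 0) \<and>
     (\<forall>j\<in>{1..d}. 1 \<le> \<theta> j) \<and>
     (\<forall>i\<in>{1..d}. \<forall>j\<in>{1..d}. i < j \<longrightarrow> \<theta> i < \<theta> j) \<and>
     (\<exists>j\<in>{1..d}. \<theta> j \<notin> \<int>)"

definition pp_eval :: "nat \<Rightarrow> (nat \<Rightarrow> real) \<Rightarrow> (nat \<Rightarrow> real) \<Rightarrow> real \<Rightarrow> real" where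
  "pp_eval d \<alpha> \<theta> x = (\<Sum>j=1..d. \<alpha> j * x powr \<theta> j)"

end

theory Submission
  imports Defs "HOL-Number_Theory.Number_Theory" "HOL-Real_Asymp.Real_Asymp"
    "HOL-Computational_Algebra.Squarefree"
begin

text \<open>The heart of the matter is a power saving in \<open>\<Sum>\<^bsub>p \<le> N\<^esub> log p e(\<tau> f(p))\<close>, uniform for
  \<open>N\<^bsup>-1/8\<^esup> \<le> |\<tau>| \<le> N\<^bsup>1/8\<^esup>\<close>. Vaughan's identity reduces it to sums over \<open>n\<close> of
  \<open>e(\<tau> (f(xn) - f(yn)))\<close> with \<open>0 \<le> y < x\<close>, the case \<open>y = 0\<close> being the type I sums. Such a phase has
  \<open>K\<close>-th derivative of known size once \<open>K\<close> exceeds all exponents: the integral exponents disappear and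
  the largest non-integral one dominates. On short intervals the phase is a polynomial of degree \<open>K\<close> up
  to a negligible error, with a leading coefficient so small that \<open>K - 1\<close> Weyl differencings end in
  geometric sums without wrap-around modulo 1.

  For the approximation, take \<open>a/q\<close> close to \<open>\<xi>\<close> with \<open>q\<close> at most a small power of \<open>N\<close>. If \<open>q\<close> is not
  too small, then all frequencies \<open>k\<xi> + l\<close> that matter lie in the admissible range, so the points
  \<open>(\<xi> f(p), f(p))\<close> are well distributed modulo 1 and some of them lie just next to \<open>(0, 0)\<close>. If \<open>q\<close> is
  small, then some \<open>\<lfloor>f(p)\<rfloor>\<close> is divisible by \<open>q\<close> already for \<open>p\<close> up to a small power of \<open>N\<close>, where
  the error of the approximation \<open>a/q\<close> is harmless.\<close>

section \<open>Exponentials and geometric sums\<close>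

text \<open>The obstacle is the floor: the distance from \<xi> * \<lfloor>f(p)\<rfloor> to the
  integers depends on the pair (\<xi> f(p), f(p)), not on \<xi> f(p) alone. Hence two-parameter
  frequencies k\<xi> + l occur, and they almost vanish at k = q, l = -a when \<xi> is very close to
  a/q. Exponential sums give nothing there, so small q needs another argument: f(p)/q involves only
  frequencies k/q, which are never below 1/q, and the quality of the approximation does the rest.

  Because an exponent is not an integer, a high derivative of \<tau> f has a size determined by
  |\<tau>| alone. The arithmetic nature of \<tau> does not enter, there are no major arcs, and all
  constants, even the threshold for N, are independent of \<xi>.

  The order K is taken far beyond the largest exponent: the phase can be as large as a fixed power
  of N, and only a high derivative allows polynomial approximation on intervals not much shorter
  than N. The price is a saving exponent of order 1/(K 2^K). The exponents 1/8, 1/4, 3/10, 3/4 are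
  convenient choices with room to spare.\<close>

definition uexp :: "real \<Rightarrow> complex" where
  "uexp x = cis (2 * pi * x)"

lemma norm_uexp [simp]: "norm (uexp x) = 1"
  by (simp add: uexp_def)

lemma uexp_0 [simp]: "uexp 0 = 1"
  by (simp add: uexp_def)

lemma uexp_add: "uexp (x + y) = uexp x * uexp y"
  by (simp add: uexp_def cis_mult algebra_simps)

lemma cnj_uexp: "cnj (uexp x) = uexp (- x)"
  by (simp add: uexp_def cis_cnj)

lemma uexp_mult_cnj: "uexp x * cnj (uexp y) = uexp (x - y)"
  by (simp add: cnj_uexp flip: uexp_add)

lemma uexp_of_int [simp]: "uexp (of_int n) = 1"
  unfolding uexp_def by (metis cis_2pi cis_power_int mult.commute power_int_1_left)

lemma uexp_mult_nat: "uexp (real n * x) = uexp x ^ n"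
  unfolding uexp_def by (metis Complex.DeMoivre mult.left_commute)

lemma norm_uexp_minus_1: "norm (uexp x - 1) = 2 * \<bar>sin (pi * x)\<bar>"
proof -
  have "cos (2 * (pi * x)) = 1 - 2 * (sin (pi * x))\<^sup>2" by (rule cos_double_sin)
  moreover have "(norm (uexp x - 1))\<^sup>2 = (cos (2 * (pi * x)) - 1)\<^sup>2 + (sin (2 * (pi * x)))\<^sup>2"
    by (simp add: uexp_def cmod_power2 mult.assoc)
  moreover have "(c - 1)\<^sup>2 + s\<^sup>2 = 2 - 2 * c" if "s\<^sup>2 + c\<^sup>2 = 1" for c s :: real
    using that by (simp add: power2_eq_square algebra_simps)
  ultimately have "(norm (uexp x - 1))\<^sup>2 = 2 - 2 * (1 - 2 * (sin (pi * x))\<^sup>2)"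
    using sin_cos_squared_add[of "2 * (pi * x)"] by metis
  hence "(norm (uexp x - 1))\<^sup>2 = (2 * \<bar>sin (pi * x)\<bar>)\<^sup>2"
    by (simp add: power_mult_distrib)
  thus ?thesis by (rule power2_eq_imp_eq) auto
qed

lemma norm_uexp_diff_le: "norm (uexp x - uexp y) \<le> 7 * \<bar>x - y\<bar>"
proof -
  have "norm (uexp x - uexp y) = norm (uexp y) * norm (uexp (x - y) - 1)"
    unfolding norm_mult[symmetric] by (simp add: algebra_simps flip: uexp_add)
  also have "\<dots> = 2 * \<bar>sin (pi * (x - y))\<bar>"
    by (simp add: norm_uexp_minus_1)
  also have "\<dots> \<le> 2 * \<bar>pi * (x - y)\<bar>"
    using abs_sin_x_le_abs_x[of "pi * (x - y)"] by simp
  also have "\<dots> \<le> 7 * \<bar>x - y\<bar>"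
    using pi_approx(2) mult_right_mono[of "2 * pi" 7 "\<bar>x - y\<bar>"] by (simp add: abs_mult)
  finally show ?thesis .
qed

lemma norm_uexp_minus_1_ge:
  assumes "\<bar>x\<bar> \<le> 1/2"
  shows "2 * \<bar>x\<bar> \<le> norm (uexp x - 1)"
proof -
  have *: "x \<le> sin (pi * x)" if "0 \<le> x" "x \<le> 1/2" for x
  proof -
    have "\<bar>sin (pi*x) - (\<Sum>m<3. sin_coeff m * (pi*x) ^ m)\<bar> \<le> inverse (fact 3) * \<bar>pi*x\<bar> ^ 3"
      by (rule Maclaurin_sin_bound)
    moreover have "(\<Sum>m<3. sin_coeff m * (pi*x) ^ m) = pi*x"
      by (simp add: eval_nat_numeral sin_coeff_def)
    moreover have "inverse (fact 3) * \<bar>pi*x\<bar> ^ 3 = (pi*x)^3/6"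
      using that by (simp add: eval_nat_numeral)
    ultimately have "sin (pi*x) \<ge> pi*x - (pi*x)^3/6"
      by linarith
    \<comment> \<open>As pi*x <= 2, the cubic Taylor term takes away at most two thirds of pi*x. The
      remaining third is at least x because pi > 3.\<close>
    moreover have "pi*x \<le> 2" using that pi_less_4 mult_mono[of pi 4 x "1/2"] by simp
    hence "(pi*x)^3 \<le> 4 * (pi*x)"
      using that mult_mono[of "pi*x" 2 "pi*x" 2] mult_right_mono[of "(pi*x)^2" 4 "pi*x"]
      by (simp add: power2_eq_square power3_eq_cube)
    moreover have "pi*x \<ge> 3*x" using that pi_gt3 by (simp add: mult_right_mono)
    ultimately show ?thesis by linarith
  qed
  have "norm (uexp x - 1) = 2 * \<bar>sin (pi * x)\<bar>"
    by (simp add: norm_uexp_minus_1)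
  moreover have "\<bar>x\<bar> \<le> \<bar>sin (pi * x)\<bar>"
    using *[of x] *[of "-x"] assms by (cases "x \<ge> 0") auto
  ultimately show ?thesis by simp
qed

lemma norm_sum_uexp_linear_le:
  assumes "c \<noteq> 0" "\<bar>c\<bar> \<le> 1/2"
  shows "norm (\<Sum>j<n. uexp (b + real j * c)) \<le> 1 / \<bar>c\<bar>"
proof -
  have ne: "uexp c \<noteq> 1"
    using norm_uexp_minus_1_ge[OF assms(2)] assms(1) by auto
  have "(\<Sum>j<n. uexp (b + real j * c)) = uexp b * (\<Sum>j<n. uexp c ^ j)"
    by (simp add: uexp_add uexp_mult_nat sum_distrib_left)
  also have "\<dots> = uexp b * ((uexp c ^ n - 1) / (uexp c - 1))"
    using ne by (simp add: geometric_sum)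
  also have "norm \<dots> = norm (uexp c ^ n - 1) / norm (uexp c - 1)"
    by (simp add: norm_mult norm_divide)
  also have "\<dots> \<le> 2 / (2 * \<bar>c\<bar>)"
  proof (rule frac_le)
    show "norm (uexp c ^ n - 1) \<le> 2"
      using norm_triangle_ineq4[of "uexp c ^ n" 1] by (simp add: norm_power)
  qed (use assms norm_uexp_minus_1_ge in auto)
  finally show ?thesis by simp
qed

section \<open>Weyl differencing\<close>

text \<open>\<open>has_diff k c g\<close> says that \<open>g\<close> behaves like a polynomial of degree at most \<open>k\<close> whose
  coefficient at degree \<open>k\<close> is \<open>c / k!\<close>.\<close>

fun has_diff :: "nat \<Rightarrow> real \<Rightarrow> (real \<Rightarrow> real) \<Rightarrow> bool" where
  "has_diff 0 c g \<longleftrightarrow> (\<forall>x. g x = c)"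
| "has_diff (Suc k) c g \<longleftrightarrow> (\<forall>h. has_diff k (c * h) (\<lambda>x. g (x + h) - g x))"

lemma has_diff_add:
  "has_diff k c g \<Longrightarrow> has_diff k c' g' \<Longrightarrow> has_diff k (c + c') (\<lambda>x. g x + g' x)"
proof (induction k arbitrary: c c' g g')
  case (Suc k)
  show ?case
  proof (unfold has_diff.simps, intro allI)
    fix h
    have "has_diff k (c * h + c' * h) (\<lambda>x. (g (x + h) - g x) + (g' (x + h) - g' x))"
      using Suc.prems by (intro Suc.IH) auto
    thus "has_diff k ((c + c') * h) (\<lambda>x. g (x + h) + g' (x + h) - (g x + g' x))"
      by (simp add: algebra_simps)
  qed
qed auto

lemma has_diff_cmult: "has_diff k c g \<Longrightarrow> has_diff k (a * c) (\<lambda>x. a * g x)"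
proof (induction k arbitrary: c g)
  case (Suc k)
  show ?case
  proof (unfold has_diff.simps, intro allI)
    fix h
    have "has_diff k (a * (c * h)) (\<lambda>x. a * (g (x + h) - g x))"
      using Suc.prems by (intro Suc.IH) auto
    thus "has_diff k (a * c * h) (\<lambda>x. a * g (x + h) - a * g x)"
      by (simp add: algebra_simps)
  qed
qed auto

lemma has_diff_zero: "has_diff k 0 (\<lambda>_. 0)"
  by (induction k) auto

lemma has_diff_sum:
  "finite A \<Longrightarrow> (\<And>i. i \<in> A \<Longrightarrow> has_diff k (c i) (g i)) \<Longrightarrow> has_diff k (\<Sum>i\<in>A. c i) (\<lambda>x. \<Sum>i\<in>A. g i x)"
  by (induction A rule: finite_induct) (auto intro: has_diff_zero has_diff_add)

text \<open>By the binomial theorem, one difference of x^j is a combination of the lower powers. All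
  j <= k are needed in the induction, since only the power of degree exactly k contributes to the
  coefficient.\<close>

lemma has_diff_power:
  "j \<le> k \<Longrightarrow> has_diff k (if j = k then fact k else 0) (\<lambda>x. x ^ j)"
proof (induction k arbitrary: j)
  case (Suc k)
  show ?case
  proof (unfold has_diff.simps, intro allI)
    fix h :: real
    have "has_diff k (\<Sum>i<j. real (j choose i) * h ^ (j - i) * (if i = k then fact k else 0))
            (\<lambda>x. \<Sum>i<j. real (j choose i) * h ^ (j - i) * x ^ i)"
      using Suc.prems by (intro has_diff_sum has_diff_cmult Suc.IH) auto
    moreover have "(\<Sum>i<j. real (j choose i) * h ^ (j - i) * x ^ i) = (x + h) ^ j - x ^ j" for x
    proof -
      have "(x + h) ^ j = (\<Sum>i\<le>j. real (j choose i) * x ^ i * h ^ (j - i))"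
        by (rule binomial_ring)
      also have "\<dots> = (\<Sum>i<j. real (j choose i) * x ^ i * h ^ (j - i)) + x ^ j"
        by (simp add: lessThan_Suc_atMost[symmetric])
      finally show ?thesis by (simp add: mult_ac)
    qed
    moreover have "(\<Sum>i<j. real (j choose i) * h ^ (j - i) * (if i = k then fact k else 0))
        = (if j = Suc k then fact (Suc k) else 0) * h"
    proof -
      have "(\<Sum>i<j. real (j choose i) * h ^ (j - i) * (if i = k then fact k else 0))
         = (\<Sum>i<j. if i = k then real (j choose i) * h ^ (j - i) * fact k else 0)"
        by (rule sum.cong) auto
      also have "\<dots> = (if k < j then real (j choose k) * h ^ (j - k) * fact k else 0)"
        by (subst sum.delta) auto
      also have "\<dots> = (if j = Suc k then fact (Suc k) else 0) * h"
      proof (cases "j = Suc k")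
        case True
        thus ?thesis by (simp add: algebra_simps)
      next
        case False
        thus ?thesis using Suc.prems by simp
      qed
      finally show ?thesis .
    qed
    ultimately show "has_diff k ((if j = Suc k then fact (Suc k) else 0) * h) (\<lambda>x. (x + h) ^ j - x ^ j)"
      by simp
  qed
qed auto

text \<open>Pairs j < i are sorted by their difference h = i - j. This turns a double sum into the
  correlations that Weyl differencing produces.\<close>

lemma sum_triangle_shift:
  fixes F :: "nat \<Rightarrow> nat \<Rightarrow> 'a :: comm_monoid_add"
  shows "(\<Sum>i<n. \<Sum>j<i. F i j) = (\<Sum>h\<in>{1..<n}. \<Sum>j<n-h. F (j + h) j)"
proof -
  have "(\<Sum>i<n. \<Sum>j<i. F i j) = (\<Sum>(i,j)\<in>(SIGMA i:{..<n}. {..<i}). F i j)"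
    by (rule sum.Sigma) auto
  also have "\<dots> = (\<Sum>(h,j)\<in>(SIGMA h:{1..<n}. {..<n-h}). F (j + h) j)"
    by (rule sum.reindex_bij_witness[of _ "\<lambda>(h,j). (j+h,j)" "\<lambda>(i,j). (i-j,j)"]) auto
  also have "\<dots> = (\<Sum>h\<in>{1..<n}. \<Sum>j<n-h. F (j + h) j)"
    by (rule sum.Sigma[symmetric]) auto
  finally show ?thesis .
qed

text \<open>Expanding the square, the diagonal contributes n, and the parts above and below the
  diagonal are complex conjugates of each other, whence the factor 2.\<close>

lemma norm_sum_uexp_sq_le:
  "(norm (\<Sum>j<n. uexp (g (real j))))\<^sup>2
     \<le> real n + 2 * (\<Sum>h\<in>{1..<n}. norm (\<Sum>j<n-h. uexp (g (real j + real h) - g (real j))))"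
proof -
  define u where "u = (\<lambda>j::nat. uexp (g (real j)))"
  have split: "(\<Sum>j<n. F j) = (\<Sum>j<i. F j) + F i + (\<Sum>j\<in>{i<..<n}. F j)"
    if "i < n" for i and F :: "nat \<Rightarrow> complex"
  proof -
    have "{..<n} = ({..<i} \<union> {i}) \<union> {i<..<n}" using that by auto
    hence "(\<Sum>j<n. F j) = sum F (({..<i} \<union> {i}) \<union> {i<..<n})" by simp
    also have "\<dots> = sum F ({..<i} \<union> {i}) + sum F {i<..<n}"
      by (rule sum.union_disjoint) auto
    also have "sum F ({..<i} \<union> {i}) = sum F {..<i} + F i"
      by (subst sum.union_disjoint) auto
    finally show ?thesis .
  qed
  define A where "A = (\<Sum>i<n. \<Sum>j<i. u i * cnj (u j))"
  have "of_real ((norm (\<Sum>j<n. u j))\<^sup>2) = (\<Sum>j<n. u j) * cnj (\<Sum>j<n. u j)"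
    by (rule complex_norm_square)
  also have "\<dots> = (\<Sum>i<n. \<Sum>j<n. u i * cnj (u j))"
    by (simp add: sum_product)
  also have "\<dots> = (\<Sum>i<n. (\<Sum>j<i. u i * cnj (u j)) + u i * cnj (u i) + (\<Sum>j\<in>{i<..<n}. u i * cnj (u j)))"
    by (rule sum.cong) (auto simp: split)
  also have "\<dots> = A + of_nat n + (\<Sum>i<n. \<Sum>j\<in>{i<..<n}. u i * cnj (u j))"
    by (simp add: sum.distrib A_def u_def uexp_mult_cnj)
  also have "(\<Sum>i<n. \<Sum>j\<in>{i<..<n}. u i * cnj (u j)) = (\<Sum>j<n. \<Sum>i<j. u i * cnj (u j))"
    by (simp add: sum.Sigma)
       (rule sum.reindex_bij_witness[of _ "\<lambda>(i,j). (j,i)" "\<lambda>(i,j). (j,i)"]; auto)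
  also have "\<dots> = cnj A"
    by (simp add: A_def mult.commute)
  finally have eq: "of_real ((norm (\<Sum>j<n. u j))\<^sup>2) = A + of_nat n + cnj A" .
  have "(norm (\<Sum>j<n. u j))\<^sup>2 = norm (A + of_nat n + cnj A)"
    unfolding eq[symmetric] by (simp only: norm_of_real abs_power2)
  also have "\<dots> \<le> norm A + real n + norm A"
    using norm_triangle_ineq[of "A + of_nat n" "cnj A"] norm_triangle_ineq[of A "of_nat n"]
    by simp
  also have "norm A \<le> (\<Sum>h\<in>{1..<n}. norm (\<Sum>j<n-h. uexp (g (real j + real h) - g (real j))))"
    unfolding A_def sum_triangle_shift by (rule sum_norm_le) (simp add: u_def uexp_mult_cnj)
  finally show ?thesis unfolding u_def by simp
qed

lemma sum_inverse_sqrt_le: "(\<Sum>h\<in>{1..<n}. 1 / sqrt (real h)) \<le> 2 * sqrt (real n)"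
proof (induction n)
  case (Suc n)

  \<comment> \<open>The difference of square roots times their sum is 1, and the sum is at most 2 *
    sqrt h. The comparison makes the series telescope.\<close>
  have step: "1 / sqrt (real h) \<le> 2 * (sqrt (real h) - sqrt (real (h - 1)))" if "h \<ge> 1" for h :: nat
  proof -
    have "sqrt (real (h - 1)) \<le> sqrt (real h)" by simp
    moreover have "(sqrt (real h) - sqrt (real (h - 1))) * (sqrt (real h) + sqrt (real (h - 1))) = 1"
      using that by (simp add: algebra_simps of_nat_diff)
    ultimately have "1 \<le> (sqrt (real h) - sqrt (real (h - 1))) * (2 * sqrt (real h))"
      by (smt (verit) mult_left_mono)
    thus ?thesis using that by (simp add: field_simps)
  qed
  have "(\<Sum>h\<in>{1..<Suc n}. 1 / sqrt (real h)) \<le> (\<Sum>h\<in>{1..<Suc n}. 2 * (sqrt (real h) - sqrt (real (h - 1))))"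
    by (rule sum_mono) (use step in auto)
  also have "\<dots> = 2 * sqrt (real n)"
    by (induction n) (auto simp: sum.atLeast_Suc_lessThan algebra_simps)
  finally show ?case by (smt (verit) real_sqrt_le_iff of_nat_Suc)
qed auto

text \<open>Induction by Weyl differencing. A difference with shift h replaces c by c * h, and h <=
  Y turns the smallness condition for c into the one for c * h at the next lower order. After k
  differences the phase is linear with slope at most 1/2, where the geometric sum bound applies. The
  bound refers to \<open>Y\<close> and not to the length \<open>n\<close>, because the lengths n - h
  vary during the induction. Each step takes a square root and so halves the exponent.\<close>

lemma weyl_bound:
  assumes "has_diff (Suc k) c g" "c \<noteq> 0" "1 \<le> Y" "\<bar>c\<bar> * Y ^ k \<le> 1/2" "real n \<le> Y"
  shows "norm (\<Sum>j<n. uexp (g (real j))) \<le> 5 * Y * (\<bar>c\<bar> * Y ^ Suc k) powr (- (1 / 2 ^ Suc k))"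
  using assms
proof (induction k arbitrary: c g n)
  case 0
  have g: "g x = g 0 + x * c" for x
  proof -
    have "g (0 + x) - g 0 = c * x" using 0(1) unfolding has_diff.simps by blast
    thus ?thesis by (simp add: algebra_simps)
  qed
  have S1: "norm (\<Sum>j<n. uexp (g (real j))) \<le> 1 / \<bar>c\<bar>"
    by (subst g) (use 0 norm_sum_uexp_linear_le in auto)
  have "norm (\<Sum>j<n. uexp (g (real j))) \<le> (\<Sum>j<n. 1)"
    by (rule sum_norm_le) simp
  hence S2: "norm (\<Sum>j<n. uexp (g (real j))) \<le> Y" using 0 by simp
  define w where "w = \<bar>c\<bar> * Y"
  have w: "w > 0" using 0 by (simp add: w_def)
  have "norm (\<Sum>j<n. uexp (g (real j))) \<le> Y * w powr (-1/2)"
  \<comment> \<open>The minimum of the trivial bound Y and the geometric bound Y/w is at most Y *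
    w^(-1/2). The exponent 1/2 rather than 1 matches the later weakening in h.\<close>
  proof (cases "w \<le> 1")
    case True
    hence "w powr (-1/2) \<ge> 1 powr (-1/2)" using w by (intro powr_mono2') auto
    hence "Y * 1 \<le> Y * w powr (-1/2)" using 0 by (intro mult_left_mono) auto
    thus ?thesis using S2 by linarith
  next
    case False
    hence "w powr (-1) \<le> w powr (-1/2)" by (intro powr_mono) auto
    hence "Y * (1/w) \<le> Y * w powr (-1/2)" using 0 w
      by (intro mult_left_mono) (auto simp: powr_minus_divide)
    moreover have "Y * (1/w) = 1/\<bar>c\<bar>" using 0 by (simp add: w_def)
    ultimately show ?thesis using S1 by linarith
  qed
  also have "\<dots> \<le> 5 * Y * w powr (-1/2)" using 0 by simp
  finally show ?case by (simp add: w_def)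
next
  case (Suc k)
  define \<gamma> :: real where "\<gamma> = 1 / 2 ^ Suc k"
  have "(2::real) ^ Suc k \<ge> 2 ^ 1" by (rule power_increasing) auto
  hence \<gamma>: "0 < \<gamma>" "\<gamma> \<le> 1/2" by (auto simp: \<gamma>_def field_simps)
  define w where "w = \<bar>c\<bar> * Y ^ Suc (Suc k)"
  have w: "w > 0" using Suc.prems by (simp add: w_def)
  have Y: "Y \<ge> 1" by fact
  have "w = Y * (\<bar>c\<bar> * Y ^ Suc k)" by (simp add: w_def)
  also have "\<dots> \<le> Y * 1" using Suc.prems Y by (intro mult_left_mono) auto
  finally have wY: "w \<le> Y" by simp
  have inner: "norm (\<Sum>j<n-h. uexp (g (real j + real h) - g (real j)))
      \<le> 5 * Y * w powr (-\<gamma>) * (sqrt Y * (1 / sqrt (real h)))" if h: "h \<in> {1..<n}" for h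
  proof -
    have hY: "1 \<le> real h" "real h \<le> Y" using h Suc.prems by auto
    have "\<bar>c * real h\<bar> * Y ^ k = \<bar>c\<bar> * (real h * Y ^ k)" by (simp add: abs_mult)
    also have "\<dots> \<le> \<bar>c\<bar> * (Y * Y ^ k)" using hY Y by (intro mult_left_mono mult_right_mono) auto
    also have "\<dots> \<le> 1/2" using Suc.prems by simp
    finally have small: "\<bar>c * real h\<bar> * Y ^ k \<le> 1/2" .
    have "norm (\<Sum>j<n-h. uexp (g (real j + real h) - g (real j)))
        \<le> 5 * Y * (\<bar>c * real h\<bar> * Y ^ Suc k) powr (- (1 / 2 ^ Suc k))"
      using Suc.prems hY small by (intro Suc.IH) auto
    also have "\<bar>c * real h\<bar> * Y ^ Suc k = w * (real h / Y)"
      using Y by (simp add: w_def abs_mult field_simps)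
    also have "(w * (real h / Y)) powr (- (1 / 2 ^ Suc k)) = w powr (-\<gamma>) * (real h / Y) powr (-\<gamma>)"
      unfolding \<gamma>_def using w hY Y by (subst powr_mult) auto
    \<comment> \<open>As h/Y <= 1 and \<open>\<gamma>\<close> <= 1/2, the exponent may be replaced
      by -1/2. The sum over h is then bounded by 2 * sqrt n whatever the order is.\<close>
    also have "(real h / Y) powr (-\<gamma>) \<le> (real h / Y) powr (-1/2)"
      using \<gamma> hY Y by (intro powr_mono') (auto simp: field_simps)
    also have "(real h / Y) powr (-1/2) = sqrt Y * (1 / sqrt (real h))"
      using hY Y by (simp add: powr_minus powr_half_sqrt real_sqrt_divide field_simps)
    finally show ?thesis using Y w by (simp add: mult_left_mono mult_ac)
  qed
  have "(norm (\<Sum>j<n. uexp (g (real j))))\<^sup>2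
     \<le> real n + 2 * (\<Sum>h\<in>{1..<n}. norm (\<Sum>j<n-h. uexp (g (real j + real h) - g (real j))))"
    by (rule norm_sum_uexp_sq_le)
  also have "\<dots> \<le> Y + 2 * (\<Sum>h\<in>{1..<n}. 5 * Y * w powr (-\<gamma>) * (sqrt Y * (1 / sqrt (real h))))"
    using Suc.prems inner by (intro add_mono mult_left_mono sum_mono) auto
  also have "(\<Sum>h\<in>{1..<n}. 5 * Y * w powr (-\<gamma>) * (sqrt Y * (1 / sqrt (real h))))
      = 5 * Y * w powr (-\<gamma>) * sqrt Y * (\<Sum>h\<in>{1..<n}. 1 / sqrt (real h))"
    by (simp add: sum_distrib_left mult_ac)
  also have "\<dots> \<le> 5 * Y * w powr (-\<gamma>) * sqrt Y * (2 * sqrt Y)"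
    using Y Suc.prems sum_inverse_sqrt_le[of n]
    by (intro mult_left_mono) (auto intro: order_trans)
  also have "\<dots> = 10 * Y\<^sup>2 * w powr (-\<gamma>)" using Y by (simp add: power2_eq_square)
  finally have sq: "(norm (\<Sum>j<n. uexp (g (real j))))\<^sup>2 \<le> Y + 2 * (10 * Y\<^sup>2 * w powr (-\<gamma>))"
    by simp
  \<comment> \<open>The diagonal term is absorbed because w <= Y. Together with the factor 20 from
    the correlations this gives 25 = 5^2, so the constant 5 reproduces itself.\<close>
  have "Y \<le> 5 * (Y\<^sup>2 * w powr (-\<gamma>))"
  proof -
    have "Y powr (-1) \<le> Y powr (-\<gamma>)" using Y \<gamma> by (intro powr_mono) auto
    also have "\<dots> \<le> w powr (-\<gamma>)" using w wY \<gamma> by (intro powr_mono2') auto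
    finally have "Y\<^sup>2 * Y powr (-1) \<le> Y\<^sup>2 * w powr (-\<gamma>)" by (intro mult_left_mono) auto
    moreover have "Y\<^sup>2 * Y powr (-1) = Y" using Y by (simp add: powr_minus power2_eq_square)
    moreover have "0 \<le> Y\<^sup>2 * w powr (-\<gamma>)" by simp
    ultimately show ?thesis by linarith
  qed
  with sq have "(norm (\<Sum>j<n. uexp (g (real j))))\<^sup>2 \<le> 25 * (Y\<^sup>2 * w powr (-\<gamma>))" by simp
  also have "\<dots> = (5 * Y * w powr (-\<gamma>/2))\<^sup>2"
    using w by (simp add: power2_eq_square flip: powr_add)
  finally have "norm (\<Sum>j<n. uexp (g (real j))) \<le> 5 * Y * w powr (-\<gamma>/2)"
    by (rule power2_le_imp_le) (use Y in simp)
  thus ?case by (simp add: w_def \<gamma>_def)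
qed

section \<open>Exponential sums with a controlled high derivative\<close>

text \<open>Blocks of length \<open>L\<close> are split off one at a time; the additional 1 accounts
  for a last incomplete block.\<close>

lemma norm_sum_pieces_le:
  fixes F :: "nat \<Rightarrow> complex"
  assumes "0 < L" "0 \<le> E"
    and "\<And>l' n'. n' \<le> L \<Longrightarrow> l \<le> l' \<Longrightarrow> l' + n' \<le> l + n \<Longrightarrow> norm (\<Sum>j<n'. F (l' + j)) \<le> E"
  shows "norm (\<Sum>j<n. F (l + j)) \<le> E * (real n / real L + 1)"
  using assms(3)
proof (induction n arbitrary: l rule: less_induct)
  case (less n)
  show ?case
  proof (cases "n \<le> L")
    case True
    hence "norm (\<Sum>j<n. F (l + j)) \<le> E" using less.prems by auto
    also have "\<dots> \<le> E * (real n / real L + 1)" using assms by (simp add: mult_le_cancel_left1)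
    finally show ?thesis .
  next
    case False
    have "(\<Sum>j<n. F (l + j)) = (\<Sum>j<L. F (l + j)) + (\<Sum>j<n-L. F (l + L + j))"
    proof -
      have "(\<Sum>j<L + (n - L). F (l + j)) = (\<Sum>j<L. F (l + j)) + (\<Sum>j\<in>{L..<L+(n-L)}. F (l + j))"
        by (subst sum.union_disjoint[symmetric]) (auto intro: sum.cong)
      also have "(\<Sum>j\<in>{L..<L+(n-L)}. F (l + j)) = (\<Sum>j<n-L. F (l + L + j))"
        by (rule sum.reindex_bij_witness[of _ "\<lambda>j. L + j" "\<lambda>j. j - L"]) auto
      finally show ?thesis using False by simp
    qed
    also have "norm \<dots> \<le> E + E * (real (n - L) / real L + 1)"
      using False less.prems assms(1) by (intro norm_triangle_mono less.IH less.prems) auto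
    also have "\<dots> = E * (real n / real L + 1)"
      using False assms(1) by (simp add: of_nat_diff field_simps)
    finally show ?thesis .
  qed
qed

text \<open>The length \<open>Y = N / v\<^sup>2\<close> is chosen so that the Taylor remainder of order \<open>K + 1\<close> is \<open>O(1/v)\<close>
  while the \<open>K\<close>-th difference times \<open>Y\<^bsup>K\<^esup>\<close> is still of size \<open>v\<close>.\<close>

lemma derivative_exp_sum_short:
  fixes G :: "nat \<Rightarrow> real \<Rightarrow> real" and N v a A :: real and k n l :: nat
  defines "K \<equiv> Suc k"
  defines "Y \<equiv> N / v\<^sup>2"
  assumes deriv: "\<And>m x. m \<le> K \<Longrightarrow> N \<le> x \<Longrightarrow> x \<le> 2 * N \<Longrightarrow> (G m has_real_derivative G (Suc m) x) (at x)"
    and lower: "\<And>x. N \<le> x \<Longrightarrow> x \<le> 2 * N \<Longrightarrow> a * v ^ (2*K+1) \<le> \<bar>G K x\<bar> * N ^ K"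
    and upper: "\<And>x. N \<le> x \<Longrightarrow> x \<le> 2 * N \<Longrightarrow> \<bar>G K x\<bar> * N ^ K \<le> A * v ^ (2*K+1)"
    and upper': "\<And>x. N \<le> x \<Longrightarrow> x \<le> 2 * N \<Longrightarrow> \<bar>G (Suc K) x\<bar> * N ^ Suc K \<le> A * v ^ (2*K+1)"
    and "0 < a" "1 \<le> A" "1 \<le> v" "2 * A * v ^ 3 \<le> N"
    and "N \<le> real l" "real (l + n) \<le> 2 * N + 1" "real n \<le> Y"
  shows "norm (\<Sum>j<n. uexp (G 0 (real (l + j))))
           \<le> (5 * a powr (-(1/2^K)) + 7 * A) * Y * v powr (-(1/2^K))"
proof (cases "n = 0")
  case True
  have "N > 0" using assms by (smt (verit) mult_pos_pos zero_less_power)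
  then show ?thesis using True assms by (auto simp: Y_def)
next
  case n: False
  have v3: "v ^ 3 \<le> N"
  proof -
    have "1 * v ^ 3 \<le> (2 * A) * v ^ 3" using assms by (intro mult_right_mono) auto
    thus ?thesis using \<open>2 * A * v ^ 3 \<le> N\<close> by linarith
  qed
  have v0: "v > 0" using assms by simp
  have N1: "N \<ge> 1" using v3 assms one_le_power[of v 3] by linarith
  have "v\<^sup>2 \<le> v ^ 3" using assms by (intro power_increasing) auto
  hence Y1: "Y \<ge> 1" using v3 v0 by (simp add: Y_def)
  define \<gamma> :: real where "\<gamma> = 1/2^K"
  have \<gamma>: "0 < \<gamma>" "\<gamma> \<le> 1" by (auto simp: \<gamma>_def)
  have l2N: "real l \<le> 2 * N" using n assms by (simp add: of_nat_diff)
  define c where "c = G K (real l)"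
  define P where "P = (\<lambda>y. \<Sum>m<Suc K. G m (real l) / fact m * y ^ m)"
  have YK: "Y ^ m = N ^ m / v ^ (2*m)" for m
    by (simp add: Y_def power_divide power_mult)
  have cYK: "\<bar>c\<bar> * Y ^ K = \<bar>c\<bar> * N ^ K / v ^ (2*K)" by (simp add: YK)
  have low: "a * v \<le> \<bar>c\<bar> * Y ^ K"
  proof -
    have "a * v = a * v ^ (2*K+1) / v ^ (2*K)" using v0 by simp
    also have "\<dots> \<le> \<bar>c\<bar> * N ^ K / v ^ (2*K)"
      using lower[of "real l"] assms(11) l2N v0 by (intro divide_right_mono) (auto simp: c_def)
    finally show ?thesis by (simp add: cYK)
  qed
  have "\<bar>c\<bar> * Y ^ K \<le> A * v ^ (2*K+1) / v ^ (2*K)"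
    using upper[of "real l"] assms(11) l2N v0 unfolding cYK
    by (intro divide_right_mono) (auto simp: c_def)
  also have "\<dots> = A * v" using v0 by simp
  \<comment> \<open>Since Y = N / v^2, the factor in front of Y is A * v^3 / N, at most 1/2 by
    hypothesis. Cancelling one Y gives the smallness condition of \<open>weyl_bound\<close>.\<close>
  also have "A * v = (A * v ^ 3 / N) * Y" using v0 N1 by (simp add: Y_def eval_nat_numeral)
  also have "\<dots> \<le> 1/2 * Y" using assms N1 Y1 by (intro mult_right_mono) (auto simp: field_simps)
  finally have "\<bar>c\<bar> * Y ^ k * Y \<le> 1/2 * Y" by (simp add: K_def mult_ac)
  hence small: "\<bar>c\<bar> * Y ^ k \<le> 1/2" using Y1 by (subst (asm) mult_le_cancel_right) auto
  have c0: "c \<noteq> 0"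
  proof
    assume "c = 0"
    hence "a * v \<le> 0" using low by (simp add: K_def)
    thus False using assms(7) v0 by (simp add: mult_le_0_iff)
  qed
  have hd: "has_diff K c P"
  proof -
    have "has_diff K (\<Sum>m<Suc K. G m (real l) / fact m * (if m = K then fact K else 0)) P"
      unfolding P_def by (intro has_diff_sum has_diff_cmult has_diff_power) auto
    moreover have "(\<Sum>m<Suc K. G m (real l) / fact m * (if m = K then fact K else 0)) = c"
      by (simp add: c_def)
    ultimately show ?thesis by simp
  qed
  have "norm (\<Sum>j<n. uexp (P (real j))) \<le> 5 * Y * (\<bar>c\<bar> * Y ^ K) powr (-(1/2^K))"
    unfolding K_def using hd c0 Y1 small assms by (intro weyl_bound) (auto simp: K_def)
  also have "(\<bar>c\<bar> * Y ^ K) powr (-(1/2^K)) \<le> (a * v) powr (-(1/2^K))"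
    using low v0 assms by (intro powr_mono2') auto
  also have "(a * v) powr (-(1/2^K)) = a powr (-\<gamma>) * v powr (-\<gamma>)"
    using v0 assms by (simp add: powr_mult \<gamma>_def)
  finally have main: "norm (\<Sum>j<n. uexp (P (real j))) \<le> 5 * Y * (a powr (-\<gamma>) * v powr (-\<gamma>))"
    using Y1 by (simp add: mult_left_mono)
  \<comment> \<open>In the Taylor remainder Y^(K+1) = N^(K+1) / v^(2K+2) meets a derivative of size
    at most A * v^(2K+1) / N^(K+1), so A / v is left.\<close>
  have err: "\<bar>G 0 (real (l + j)) - P (real j)\<bar> \<le> A / v" if j: "j < n" for j
  proof (cases "j = 0")
    case True
    have "P 0 = G 0 (real l)" unfolding P_def by (subst sum.lessThan_Suc_shift) auto
    thus ?thesis using True v0 assms by simp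
  next
    case False
    have le: "real (l + j) \<le> 2 * N" using j assms(12) by linarith
    obtain t where t: "real l < t" "t < real (l + j)" and
      eq: "G 0 (real (l + j)) = (\<Sum>m<Suc K. G m (real l) / fact m * (real (l + j) - real l) ^ m)
          + G (Suc K) t / fact (Suc K) * (real (l + j) - real l) ^ Suc K"
      using Taylor_up[of "Suc K" G "G 0" "real l" "real (l + j)" "real l"] False deriv assms(11) le
      by force
    have "G 0 (real (l + j)) - P (real j) = G (Suc K) t / fact (Suc K) * real j ^ Suc K"
      using eq by (simp add: P_def)
    also have "\<bar>\<dots>\<bar> = \<bar>G (Suc K) t\<bar> * real j ^ Suc K / fact (Suc K)"
      by (simp add: abs_mult del: fact_Suc)
    also have "\<dots> \<le> \<bar>G (Suc K) t\<bar> * real j ^ Suc K / 1"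
      by (intro divide_left_mono) (auto simp del: fact_Suc)
    also have "\<dots> \<le> \<bar>G (Suc K) t\<bar> * Y ^ Suc K"
      using j assms(13) by (simp del: power_Suc) (intro mult_left_mono power_mono; simp)
    also have "\<dots> = \<bar>G (Suc K) t\<bar> * N ^ Suc K / v ^ (2 * Suc K)" by (simp add: YK del: power_Suc)
    also have "\<dots> \<le> A * v ^ (2*K+1) / v ^ (2 * Suc K)"
      using upper'[of t] t assms(11) le v0 by (intro divide_right_mono) auto
    also have "\<dots> = A / v" using v0 by simp
    finally show ?thesis .
  qed
  have "norm ((\<Sum>j<n. uexp (G 0 (real (l + j)))) - (\<Sum>j<n. uexp (P (real j)))) \<le> (\<Sum>j<n. 7 * (A / v))"
    unfolding sum_subtractf[symmetric]
  proof (rule sum_norm_le)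
    fix j assume "j \<in> {..<n}"
    thus "norm (uexp (G 0 (real (l + j))) - uexp (P (real j))) \<le> 7 * (A / v)"
      using norm_uexp_diff_le[of "G 0 (real (l + j))" "P (real j)"] err[of j] by simp
  qed
  also have "\<dots> = real n * (7 * A * (1 / v))" by simp
  also have "\<dots> \<le> Y * (7 * A * v powr (-\<gamma>))"
  proof -
    have "1 / v = v powr (-1)" using v0 by (simp add: powr_minus_divide)
    also have "\<dots> \<le> v powr (-\<gamma>)" using \<gamma> assms by (intro powr_mono) auto
    finally show ?thesis using assms(8,13) Y1 v0 by (intro mult_mono) auto
  qed
  finally have "norm (\<Sum>j<n. uexp (G 0 (real (l + j)))) \<le>
      5 * Y * (a powr (-\<gamma>) * v powr (-\<gamma>)) + Y * (7 * A * v powr (-\<gamma>))"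
    using main norm_triangle_sub[of "\<Sum>j<n. uexp (G 0 (real (l + j)))" "\<Sum>j<n. uexp (P (real j))"]
    by linarith
  thus ?thesis by (simp add: algebra_simps \<gamma>_def)
qed

text \<open>The sum is cut into blocks of length \<lfloor>Y\<rfloor>, each of which gains the same
  power of v. The factor 5 comes from n <= N + 1 <= 2N, from Y <= 2 * \<lfloor>Y\<rfloor>, and from
  Y <= N for the incomplete block.\<close>

lemma derivative_exp_sum_bound:
  fixes G :: "nat \<Rightarrow> real \<Rightarrow> real" and N v a A :: real and k n l :: nat
  defines "K \<equiv> Suc k"
  assumes deriv: "\<And>m x. m \<le> K \<Longrightarrow> N \<le> x \<Longrightarrow> x \<le> 2 * N \<Longrightarrow> (G m has_real_derivative G (Suc m) x) (at x)"
    and lower: "\<And>x. N \<le> x \<Longrightarrow> x \<le> 2 * N \<Longrightarrow> a * v ^ (2*K+1) \<le> \<bar>G K x\<bar> * N ^ K"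
    and upper: "\<And>x. N \<le> x \<Longrightarrow> x \<le> 2 * N \<Longrightarrow> \<bar>G K x\<bar> * N ^ K \<le> A * v ^ (2*K+1)"
    and upper': "\<And>x. N \<le> x \<Longrightarrow> x \<le> 2 * N \<Longrightarrow> \<bar>G (Suc K) x\<bar> * N ^ Suc K \<le> A * v ^ (2*K+1)"
    and "0 < a" "1 \<le> A" "1 \<le> v" "2 * A * v ^ 3 \<le> N"
    and "N \<le> real l" "real (l + n) \<le> 2 * N + 1"
  shows "norm (\<Sum>j<n. uexp (G 0 (real (l + j))))
           \<le> 5 * (5 * a powr (-(1/2^K)) + 7 * A) * N * v powr (-(1/2^K))"
proof -
  define Y where "Y = N / v\<^sup>2"
  define C where "C = 5 * a powr (-(1/2^K)) + 7 * A"
  have C: "C \<ge> 0" using assms by (simp add: C_def)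
  have v3: "v ^ 3 \<le> N"
  proof -
    have "1 * v ^ 3 \<le> (2 * A) * v ^ 3" using assms by (intro mult_right_mono) auto
    thus ?thesis using \<open>2 * A * v ^ 3 \<le> N\<close> by linarith
  qed
  have v0: "v > 0" using assms by simp
  have N1: "N \<ge> 1" using v3 assms one_le_power[of v 3] by linarith
  have "v\<^sup>2 \<le> v ^ 3" using assms by (intro power_increasing) auto
  hence Y1: "Y \<ge> 1" using v3 v0 by (simp add: Y_def)
  have YN: "Y \<le> N" using assms N1 by (simp add: Y_def divide_le_eq mult_le_cancel_left1)
  define L where "L = nat \<lfloor>Y\<rfloor>"
  have L: "real L \<le> Y" "1 \<le> L" "Y \<le> 2 * real L"
  proof -
    have "real L = of_int \<lfloor>Y\<rfloor>" using Y1 by (simp add: L_def)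
    moreover have "1 \<le> \<lfloor>Y\<rfloor>" using Y1 by simp
    ultimately show "real L \<le> Y" "1 \<le> L" "Y \<le> 2 * real L" by linarith+
  qed
  have "norm (\<Sum>j<n. uexp (G 0 (real (l + j)))) \<le> (C * Y * v powr (-(1/2^K))) * (real n / real L + 1)"
  proof (rule norm_sum_pieces_le[where F = "\<lambda>j. uexp (G 0 (real j))"])
    show "0 \<le> C * Y * v powr - (1 / 2 ^ K)" using C Y1 by simp
    fix l' n' assume "n' \<le> L" "l \<le> l'" "l' + n' \<le> l + n"
    hence *: "N \<le> real l'" "real (l' + n') \<le> 2 * N + 1" "real n' \<le> Y"
      using assms(10,11) L by linarith+
    show "norm (\<Sum>j<n'. uexp (G 0 (real (l' + j)))) \<le> C * Y * v powr - (1 / 2 ^ K)"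
      unfolding C_def Y_def K_def
      by (rule derivative_exp_sum_short)
         (use assms(2-9) * in \<open>auto simp: K_def Y_def simp del: power_Suc\<close>)
  qed (use L in auto)
  also have "\<dots> = C * v powr (-(1/2^K)) * (Y / real L * real n + Y)"
    using L by (simp add: field_simps)
  also have "\<dots> \<le> C * v powr (-(1/2^K)) * (5 * N)"
  proof (rule mult_left_mono)
    have "real n \<le> N + 1" using assms(10,11) by simp
    moreover have "Y / real L * real n \<le> 2 * real n" using L by (intro mult_right_mono) (auto simp: field_simps)
    ultimately show "Y / real L * real n + Y \<le> 5 * N" using YN N1 by linarith
  qed (use C in auto)
  finally show ?thesis by (simp add: C_def algebra_simps)
qed

section \<open>Pseudo-polynomial phases\<close>

text \<open>The falling factorial: the coefficient created by m-fold differentiation of t^x. Its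
  vanishing is what distinguishes integral from non-integral exponents.\<close>

definition falling :: "real \<Rightarrow> nat \<Rightarrow> real" where
  "falling x m = (\<Prod>i<m. x - real i)"

lemma falling_nonzero: "x \<notin> \<int> \<Longrightarrow> falling x m \<noteq> 0"
  by (auto simp: falling_def)

lemma falling_eq_0: "x \<in> \<int> \<Longrightarrow> 0 \<le> x \<Longrightarrow> x < real m \<Longrightarrow> falling x m = 0"
  unfolding falling_def by (auto elim!: Ints_cases intro!: bexI[of _ "nat \<lfloor>x\<rfloor>"])

text \<open>Write z^p as z * z^(p-1) and replace z^(p-1) by x^(p-1). This bounds the size of a
  difference phase from below in terms of x - y.\<close>

lemma powr_diff_superadditive:
  assumes "0 \<le> y" "y \<le> x" "1 \<le> (p::real)"
  shows "(x - y) powr p \<le> x powr p - y powr p"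
proof -
  have "(x - y) * (x - y) powr (p - 1) + y * y powr (p - 1) \<le> (x - y) * x powr (p - 1) + y * x powr (p - 1)"
    using assms by (intro add_mono mult_left_mono powr_mono2) auto
  also have "\<dots> = x * x powr (p - 1)" by (simp add: algebra_simps)
  finally show ?thesis using assms by (simp add: powr_mult_base)
qed

text \<open>Follows from (y/x)^q <= (y/x)^p. In a phase f(xt) - f(yt) it shows that lower exponents
  stay subordinate uniformly in y, even when y is close to x and all differences are small.\<close>

lemma powr_diff_compare:
  assumes "0 \<le> y" "y < x" "(p::real) \<le> q" "0 < p"
  shows "x powr p - y powr p \<le> x powr (p - q) * (x powr q - y powr q)"
proof -
  have "(y / x) powr q \<le> (y / x) powr p" using assms by (intro powr_mono') auto
  hence "y powr q / x powr q \<le> y powr p / x powr p" using assms by (simp add: powr_divide)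
  hence "x powr (p - q) * y powr q \<le> y powr p"
    using assms by (simp add: powr_diff field_simps)
  moreover have "x powr (p - q) * x powr q = x powr p" using assms by (simp flip: powr_add)
  ultimately show ?thesis by (simp add: algebra_simps)
qed

locale pseudo_polynomial =
  fixes d :: nat and \<alpha> \<theta> :: "nat \<Rightarrow> real"
  assumes pseudo: "pseudo_poly d \<alpha> \<theta>"
begin

abbreviation f :: "real \<Rightarrow> real" where "f \<equiv> pp_eval d \<alpha> \<theta>"

definition top_index :: nat where
  "top_index = Max {j\<in>{1..d}. \<theta> j \<notin> \<int>}"

abbreviation top_exp :: real where "top_exp \<equiv> \<theta> top_index"

lemma top_index: "top_index \<in> {1..d}" "top_exp \<notin> \<int>"
proof -
  have "top_index \<in> {j\<in>{1..d}. \<theta> j \<notin> \<int>}"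
    unfolding top_index_def using pseudo by (intro Max_in) (auto simp: pseudo_poly_def)
  thus "top_index \<in> {1..d}" "top_exp \<notin> \<int>" by auto
qed

lemma \<alpha>_pos: "j \<in> {1..d} \<Longrightarrow> 0 < \<alpha> j"
  and \<theta>_ge_1: "j \<in> {1..d} \<Longrightarrow> 1 \<le> \<theta> j"
  and \<theta>_less: "i \<in> {1..d} \<Longrightarrow> j \<in> {1..d} \<Longrightarrow> i < j \<Longrightarrow> \<theta> i < \<theta> j"
  using pseudo by (auto simp: pseudo_poly_def)

lemma less_top_exp:
  assumes "j \<in> {1..d}" "\<theta> j \<notin> \<int>" "j \<noteq> top_index"
  shows "\<theta> j < top_exp"
proof -
  have "j \<le> top_index" unfolding top_index_def using assms by (intro Max_ge) auto
  thus ?thesis using assms top_index \<theta>_less by simp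
qed

lemma f_0: "f 0 = 0"
  by (simp add: pp_eval_def)

text \<open>Closed form of the m-th derivative in t of \<tau> (f(xt) - f(yt)). The order m is an
  argument so that the family fits the Taylor theorem.\<close>

definition phase :: "real \<Rightarrow> real \<Rightarrow> real \<Rightarrow> nat \<Rightarrow> real \<Rightarrow> real" where
  "phase \<tau> x y m t = (\<Sum>j=1..d. \<tau> * \<alpha> j * (x powr \<theta> j - y powr \<theta> j) * falling (\<theta> j) m * t powr (\<theta> j - real m))"

lemma phase_0:
  assumes "0 \<le> x" "0 \<le> y" "0 \<le> t"
  shows "phase \<tau> x y 0 t = \<tau> * (f (x * t) - f (y * t))"
  using assms
  by (simp add: phase_def falling_def pp_eval_def powr_mult sum_distrib_left algebra_simps flip: sum_subtractf)

lemma has_derivative_phase: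
  assumes "0 < t"
  shows "(phase \<tau> x y m has_real_derivative phase \<tau> x y (Suc m) t) (at t)"
  unfolding phase_def
proof (rule DERIV_sum)
  fix j
  have "((\<lambda>t. t powr (\<theta> j - real m)) has_real_derivative (\<theta> j - real m) * t powr (\<theta> j - real m - 1)) (at t)"
    using assms by (rule has_real_derivative_powr)
  from DERIV_cmult[OF this, of "\<tau> * \<alpha> j * (x powr \<theta> j - y powr \<theta> j) * falling (\<theta> j) m"]
  show "((\<lambda>t. \<tau> * \<alpha> j * (x powr \<theta> j - y powr \<theta> j) * falling (\<theta> j) m * t powr (\<theta> j - real m)) has_real_derivative
      \<tau> * \<alpha> j * (x powr \<theta> j - y powr \<theta> j) * falling (\<theta> j) (Suc m) * t powr (\<theta> j - real (Suc m))) (at t)"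
    by (simp add: falling_def algebra_simps)
qed

text \<open>Only the non-integral exponents survive \<open>K > \<theta>\<^sub>d\<close> differentiations, and the largest of them
  dominates.\<close>

lemma phase_derivative_bounds:
  assumes K: "\<And>j. j \<in> {1..d} \<Longrightarrow> \<theta> j < real K"
  shows "\<exists>a A X0. 0 < a \<and> 1 \<le> A \<and> 1 \<le> X0 \<and> (\<forall>\<tau> x y N t. 0 \<le> y \<longrightarrow> y < x \<longrightarrow> 0 < N \<longrightarrow> X0 \<le> x * N \<longrightarrow> N \<le> t \<longrightarrow> t \<le> 2 * N \<longrightarrow>
     (let T = \<bar>\<tau>\<bar> * (x powr top_exp - y powr top_exp) * N powr top_exp in
        a * T \<le> \<bar>phase \<tau> x y K t\<bar> * N ^ K \<and> \<bar>phase \<tau> x y K t\<bar> * N ^ K \<le> A * T \<and>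
        \<bar>phase \<tau> x y (Suc K) t\<bar> * N ^ Suc K \<le> A * T))"
proof -
  define J where "J = {j\<in>{1..d}. \<theta> j \<notin> \<int>}"
  have J: "finite J" "top_index \<in> J" using top_index by (auto simp: J_def)
  have Jle: "\<theta> j \<le> top_exp" if "j \<in> J" for j
    using less_top_exp[of j] that by (cases "j = top_index") (auto simp: J_def)
  \<comment> \<open>The leading constant of the dominating term. The factor (1/2)^K is lost because
    t may be as large as 2N while its exponent top_exp - K is negative.\<close>
  define b where "b = \<alpha> top_index * \<bar>falling top_exp K\<bar> * (1/2) ^ K"
  have b: "b > 0" using top_index \<alpha>_pos falling_nonzero by (simp add: b_def)
  define A where "A = 1 + (\<Sum>j\<in>J. \<alpha> j * (\<bar>falling (\<theta> j) K\<bar> + \<bar>falling (\<theta> j) (Suc K)\<bar>))"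
  have A1: "(\<Sum>j\<in>J. \<alpha> j * \<bar>falling (\<theta> j) m\<bar>) \<le> A" if "m = K \<or> m = Suc K" for m
  proof -
    have "(\<Sum>j\<in>J. \<alpha> j * \<bar>falling (\<theta> j) m\<bar>) \<le> (\<Sum>j\<in>J. \<alpha> j * (\<bar>falling (\<theta> j) K\<bar> + \<bar>falling (\<theta> j) (Suc K)\<bar>))"
      using that \<alpha>_pos by (intro sum_mono mult_left_mono) (auto simp: J_def less_imp_le)
    thus ?thesis by (simp add: A_def)
  qed
  have "(\<Sum>j\<in>J. \<alpha> j * (\<bar>falling (\<theta> j) K\<bar> + \<bar>falling (\<theta> j) (Suc K)\<bar>)) \<ge> 0"
    using \<alpha>_pos by (intro sum_nonneg mult_nonneg_nonneg) (auto simp: J_def less_imp_le)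
  hence A2: "A \<ge> 1" by (simp add: A_def)
  \<comment> \<open>Relative to the dominating term, the other non-integral exponents carry negative
    powers of X = x * N. For large X they use up at most half of b.\<close>
  have "((\<lambda>X. \<Sum>j\<in>J-{top_index}. \<alpha> j * \<bar>falling (\<theta> j) K\<bar> * X powr (\<theta> j - top_exp)) \<longlongrightarrow>
      (\<Sum>j\<in>J-{top_index}. \<alpha> j * \<bar>falling (\<theta> j) K\<bar> * 0)) at_top"
    by (intro tendsto_sum tendsto_mult tendsto_const tendsto_neg_powr filterlim_ident)
       (use less_top_exp in \<open>auto simp: J_def\<close>)
  hence "\<forall>\<^sub>F X in at_top. (\<Sum>j\<in>J-{top_index}. \<alpha> j * \<bar>falling (\<theta> j) K\<bar> * X powr (\<theta> j - top_exp)) < b / 2"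
    using b by (intro order_tendstoD) auto
  then obtain X1 where X1: "\<And>X. X \<ge> X1 \<Longrightarrow> (\<Sum>j\<in>J-{top_index}. \<alpha> j * \<bar>falling (\<theta> j) K\<bar> * X powr (\<theta> j - top_exp)) < b / 2"
    by (auto simp: eventually_at_top_linorder)
  define X0 where "X0 = max 1 X1"
  show ?thesis
  proof (intro exI conjI allI impI)
    show "0 < b / 2" "1 \<le> A" "1 \<le> X0" using b A2 by (auto simp: X0_def)
    fix \<tau> x y N t :: real
    assume as: "0 \<le> y" "y < x" "0 < N" "X0 \<le> x * N" "N \<le> t" "t \<le> 2 * N"
    define T where "T = \<bar>\<tau>\<bar> * (x powr top_exp - y powr top_exp) * N powr top_exp"
    have top1: "top_exp \<ge> 1" using top_index \<theta>_ge_1 by auto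
    have "y powr top_exp \<le> x powr top_exp" using as top1 by (intro powr_mono2) auto
    hence T0: "T \<ge> 0" by (simp add: T_def)
    define h where "h = (\<lambda>m j. \<tau> * \<alpha> j * (x powr \<theta> j - y powr \<theta> j) * falling (\<theta> j) m * t powr (\<theta> j - real m))"
    have sumJ: "phase \<tau> x y m t = (\<Sum>j\<in>J. h m j)" if "K \<le> m" for m
      unfolding phase_def h_def
    proof (rule sum.mono_neutral_right)
      show "\<forall>j\<in>{1..d} - J. \<tau> * \<alpha> j * (x powr \<theta> j - y powr \<theta> j) * falling (\<theta> j) m * t powr (\<theta> j - real m) = 0"
      proof
        fix j assume j: "j \<in> {1..d} - J"
        have "falling (\<theta> j) m = 0"
          using j K[of j] \<theta>_ge_1[of j] that by (intro falling_eq_0) (auto simp: J_def)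
        thus "\<tau> * \<alpha> j * (x powr \<theta> j - y powr \<theta> j) * falling (\<theta> j) m * t powr (\<theta> j - real m) = 0" by simp
      qed
    qed (auto simp: J_def)
    have up: "\<bar>h m j\<bar> * N ^ m \<le> \<alpha> j * \<bar>falling (\<theta> j) m\<bar> * (x * N) powr (\<theta> j - top_exp) * T"
      if "j \<in> J" "K \<le> m" for j m
    proof -
      have j: "j \<in> {1..d}" using that by (auto simp: J_def)
      have tm: "t powr (\<theta> j - real m) * N ^ m \<le> N powr \<theta> j"
      proof -
        have "t powr (\<theta> j - real m) \<le> N powr (\<theta> j - real m)"
          using as K[OF j] that by (intro powr_mono2') auto
        hence "t powr (\<theta> j - real m) * N ^ m \<le> N powr (\<theta> j - real m) * N ^ m"
          using as by (intro mult_right_mono) auto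
        also have "\<dots> = N powr \<theta> j" using as by (simp add: powr_diff powr_realpow)
        finally show ?thesis .
      qed
      have dj: "0 \<le> x powr \<theta> j - y powr \<theta> j"
        using as \<theta>_ge_1[OF j] by (auto intro!: powr_mono2)
      have "\<bar>h m j\<bar> * N ^ m = \<bar>\<tau>\<bar> * \<alpha> j * (x powr \<theta> j - y powr \<theta> j) * \<bar>falling (\<theta> j) m\<bar> * (t powr (\<theta> j - real m) * N ^ m)"
        using \<alpha>_pos[OF j] dj by (simp add: h_def abs_mult)
      also have "\<dots> \<le> \<bar>\<tau>\<bar> * \<alpha> j * (x powr \<theta> j - y powr \<theta> j) * \<bar>falling (\<theta> j) m\<bar> * N powr \<theta> j"
        using \<alpha>_pos[OF j] dj tm by (intro mult_left_mono) auto
      also have "\<dots> \<le> \<bar>\<tau>\<bar> * \<alpha> j * (x powr (\<theta> j - top_exp) * (x powr top_exp - y powr top_exp)) * \<bar>falling (\<theta> j) m\<bar> * N powr \<theta> j"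
        using \<alpha>_pos[OF j] \<theta>_ge_1[OF j] as Jle[OF that(1)]
        by (intro mult_left_mono mult_right_mono powr_diff_compare) auto
      also have "N powr \<theta> j = N powr (\<theta> j - top_exp) * N powr top_exp" using as by (simp flip: powr_add)
      also have "\<bar>\<tau>\<bar> * \<alpha> j * (x powr (\<theta> j - top_exp) * (x powr top_exp - y powr top_exp)) * \<bar>falling (\<theta> j) m\<bar> * (N powr (\<theta> j - top_exp) * N powr top_exp)
         = \<alpha> j * \<bar>falling (\<theta> j) m\<bar> * (x powr (\<theta> j - top_exp) * N powr (\<theta> j - top_exp)) * T"
        by (simp only: T_def mult_ac)
      also have "x powr (\<theta> j - top_exp) * N powr (\<theta> j - top_exp) = (x * N) powr (\<theta> j - top_exp)"
        using as by (simp add: powr_mult)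
      finally show ?thesis .
    qed
    have le1: "(x * N) powr (\<theta> j - top_exp) \<le> 1" if "j \<in> J" for j
    proof -
      have "(x * N) powr (\<theta> j - top_exp) \<le> (x * N) powr 0"
        using as Jle[OF that] by (intro powr_mono) (auto simp: X0_def)
      thus ?thesis using as by (auto simp: X0_def)
    qed
    have total: "\<bar>phase \<tau> x y m t\<bar> * N ^ m \<le> A * T" if m: "m = K \<or> m = Suc K" for m
    proof -
      have "\<bar>phase \<tau> x y m t\<bar> * N ^ m \<le> (\<Sum>j\<in>J. \<bar>h m j\<bar>) * N ^ m"
        using m as by (subst sumJ) (auto intro!: mult_right_mono sum_abs)
      also have "\<dots> = (\<Sum>j\<in>J. \<bar>h m j\<bar> * N ^ m)" by (rule sum_distrib_right)
      also have "\<dots> \<le> (\<Sum>j\<in>J. \<alpha> j * \<bar>falling (\<theta> j) m\<bar> * 1 * T)"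
      proof (rule sum_mono)
        fix j assume j: "j \<in> J"
        have "\<bar>h m j\<bar> * N ^ m \<le> \<alpha> j * \<bar>falling (\<theta> j) m\<bar> * (x * N) powr (\<theta> j - top_exp) * T"
          using j m by (intro up) auto
        also have "\<dots> \<le> \<alpha> j * \<bar>falling (\<theta> j) m\<bar> * 1 * T"
          using le1[OF j] T0 \<alpha>_pos[of j] j by (intro mult_right_mono mult_left_mono) (auto simp: J_def)
        finally show "\<bar>h m j\<bar> * N ^ m \<le> \<alpha> j * \<bar>falling (\<theta> j) m\<bar> * 1 * T" .
      qed
      also have "\<dots> = (\<Sum>j\<in>J. \<alpha> j * \<bar>falling (\<theta> j) m\<bar>) * T" by (simp add: sum_distrib_right)
      also have "\<dots> \<le> A * T" using A1[OF m] T0 by (intro mult_right_mono) auto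
      finally show ?thesis .
    qed
    have low: "b / 2 * T \<le> \<bar>phase \<tau> x y K t\<bar> * N ^ K"
    proof -
      have "(\<Sum>j\<in>J-{top_index}. \<bar>h K j\<bar>) * N ^ K = (\<Sum>j\<in>J-{top_index}. \<bar>h K j\<bar> * N ^ K)"
        by (rule sum_distrib_right)
      also have "\<dots> \<le> (\<Sum>j\<in>J-{top_index}. \<alpha> j * \<bar>falling (\<theta> j) K\<bar> * (x * N) powr (\<theta> j - top_exp) * T)"
        using up by (intro sum_mono) auto
      also have "\<dots> = (\<Sum>j\<in>J-{top_index}. \<alpha> j * \<bar>falling (\<theta> j) K\<bar> * (x * N) powr (\<theta> j - top_exp)) * T"
        by (simp add: sum_distrib_right)
      also have "\<dots> \<le> b / 2 * T"
      proof (rule mult_right_mono[OF less_imp_le T0])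
        show "(\<Sum>j\<in>J-{top_index}. \<alpha> j * \<bar>falling (\<theta> j) K\<bar> * (x * N) powr (\<theta> j - top_exp)) < b / 2"
          using as by (intro X1) (auto simp: X0_def)
      qed
      finally have rest: "(\<Sum>j\<in>J-{top_index}. \<bar>h K j\<bar>) * N ^ K \<le> b / 2 * T" .
      have "(1/2) ^ K * N powr top_exp \<le> t powr (top_exp - real K) * N ^ K"
      proof -
        have kt: "top_exp < real K" using K top_index by auto
        have "(2 * N) powr (top_exp - real K) \<le> t powr (top_exp - real K)"
          using as kt by (intro powr_mono2') auto
        moreover have "(2 * N) powr (top_exp - real K) = 2 powr top_exp * N powr top_exp / (2 ^ K * N ^ K)"
          using as by (simp add: powr_diff powr_mult powr_realpow)
        hence "2 powr top_exp * N powr top_exp / 2 ^ K = (2 * N) powr (top_exp - real K) * N ^ K"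
          using as by simp
        ultimately have "2 powr top_exp * N powr top_exp / 2 ^ K \<le> t powr (top_exp - real K) * N ^ K"
          using as by (simp add: mult_right_mono)
        moreover have "1 \<le> 2 powr top_exp" using top1 by (intro ge_one_powr_ge_zero) auto
        hence "1 * (N powr top_exp / 2 ^ K) \<le> 2 powr top_exp * (N powr top_exp / 2 ^ K)"
          by (intro mult_right_mono) auto
        ultimately show ?thesis by (simp add: power_divide)
      qed
      hence "\<bar>\<tau>\<bar> * \<alpha> top_index * (x powr top_exp - y powr top_exp) * \<bar>falling top_exp K\<bar> * ((1/2) ^ K * N powr top_exp)
         \<le> \<bar>\<tau>\<bar> * \<alpha> top_index * (x powr top_exp - y powr top_exp) * \<bar>falling top_exp K\<bar> * (t powr (top_exp - real K) * N ^ K)"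
        using \<alpha>_pos[of top_index] top_index \<open>y powr top_exp \<le> x powr top_exp\<close> by (intro mult_left_mono) auto
      also have "\<dots> = \<bar>h K top_index\<bar> * N ^ K"
        using \<alpha>_pos[of top_index] top_index \<open>y powr top_exp \<le> x powr top_exp\<close> by (simp add: h_def abs_mult)
      also have "\<bar>\<tau>\<bar> * \<alpha> top_index * (x powr top_exp - y powr top_exp) * \<bar>falling top_exp K\<bar> * ((1/2) ^ K * N powr top_exp) = b * T"
        by (simp only: b_def T_def mult_ac)
      finally have main: "b * T \<le> \<bar>h K top_index\<bar> * N ^ K" .
      have "\<bar>h K top_index\<bar> \<le> \<bar>phase \<tau> x y K t\<bar> + (\<Sum>j\<in>J-{top_index}. \<bar>h K j\<bar>)"
        using sum_abs[of "h K" "J-{top_index}"] sum.remove[OF J, of "h K"] sumJ[of K] by linarith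
      hence "\<bar>h K top_index\<bar> * N ^ K \<le> (\<bar>phase \<tau> x y K t\<bar> + (\<Sum>j\<in>J-{top_index}. \<bar>h K j\<bar>)) * N ^ K"
        using as by (intro mult_right_mono) auto
      thus ?thesis using main rest by (simp add: algebra_simps)
    qed
    show "let T = \<bar>\<tau>\<bar> * (x powr top_exp - y powr top_exp) * N powr top_exp in
        b / 2 * T \<le> \<bar>phase \<tau> x y K t\<bar> * N ^ K \<and> \<bar>phase \<tau> x y K t\<bar> * N ^ K \<le> A * T \<and>
        \<bar>phase \<tau> x y (Suc K) t\<bar> * N ^ Suc K \<le> A * T"
      using low total[of K] total[of "Suc K"] unfolding Let_def T_def[symmetric] by blast
  qed
qed

text \<open>The parameter of \<open>derivative_exp_sum_bound\<close> is determined by v^(2K+1) = T,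
  where T measures the size of the K-th derivative times N^K. The hypotheses put T between X^(1/2)
  and X^(2 * top_exp + 1). The lower end yields the saving; the upper end together with a large K
  keeps v^3 below X^(1/8), far below N >= X^(3/10).\<close>

lemma phase_exp_sum_bound:
  "\<exists>\<sigma> X0. 0 < \<sigma> \<and> \<sigma> \<le> 1/4 \<and> (\<forall>X\<ge>X0. \<forall>\<tau> (x::nat) (y::nat) N l n.
     X powr (-1/4) \<le> \<bar>\<tau>\<bar> \<longrightarrow> \<bar>\<tau>\<bar> \<le> X powr (1/4) \<longrightarrow> X powr (3/10) \<le> N \<longrightarrow> y \<le> x \<longrightarrow>
     X powr (3/4) \<le> (real x - real y) * N \<longrightarrow> real x * N \<le> 2 * X \<longrightarrow> N \<le> real l \<longrightarrow> real (l + n) \<le> 2 * N + 1 \<longrightarrow>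
     norm (\<Sum>j<n. uexp (\<tau> * (f (real x * real (l + j)) - f (real y * real (l + j))))) \<le> N * X powr (-\<sigma>))"
proof -
  have top1: "top_exp \<ge> 1" using top_index \<theta>_ge_1 by auto
  \<comment> \<open>The first summand makes K exceed every exponent, since each is at most the sum
    of all. The second makes 3 * (2 * top_exp + 1) / (2K + 1) at most 1/8.\<close>
  obtain k :: nat where k: "real k \<ge> (\<Sum>j=1..d. \<theta> j) + 24 * (2 * top_exp + 1)"
    using real_arch_simple by blast
  define K where "K = Suc k"
  have \<theta>K: "\<theta> j < real K" if "j \<in> {1..d}" for j
  proof -
    have "\<theta> j \<le> (\<Sum>j=1..d. \<theta> j)"
      using \<theta>_ge_1 that by (intro member_le_sum) (auto intro: order_trans[of 0 1])
    thus ?thesis using k top1 by (simp add: K_def)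
  qed
  have "(\<Sum>j=1..d. \<theta> j) \<ge> 0" using \<theta>_ge_1 by (intro sum_nonneg) (auto intro: order_trans[of 0 1])
  hence Kbig: "real (2 * K + 1) \<ge> 24 * (2 * top_exp + 1)" using k top1 by (simp add: K_def)
  obtain a A X1 where aA: "0 < a" "1 \<le> A" "1 \<le> X1" and
    bnd: "\<And>\<tau> x y N t. 0 \<le> y \<Longrightarrow> y < x \<Longrightarrow> 0 < N \<Longrightarrow> X1 \<le> x * N \<Longrightarrow> N \<le> t \<Longrightarrow> t \<le> 2 * N \<Longrightarrow>
     (let T = \<bar>\<tau>\<bar> * (x powr top_exp - y powr top_exp) * N powr top_exp in
        a * T \<le> \<bar>phase \<tau> x y K t\<bar> * N ^ K \<and> \<bar>phase \<tau> x y K t\<bar> * N ^ K \<le> A * T \<and>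
        \<bar>phase \<tau> x y (Suc K) t\<bar> * N ^ Suc K \<le> A * T)"
    using phase_derivative_bounds[of K, OF \<theta>K] by blast
  define C where "C = 5 * (5 * a powr (-(1/2^K)) + 7 * A)"
  \<comment> \<open>From T >= X^(1/2) one gets v^(-1/2^K) <= X^(-2\<sigma>). One half of this saving
    pays for the constant \<open>C\<close>.\<close>
  define \<sigma> :: real where "\<sigma> = 1 / (2 * real (2*K+1) * 2^K) / 2"
  have "1 \<le> real (2*K+1) * 2^K" using mult_mono[of 1 "real (2*K+1)" 1 "2^K"] by simp
  hence \<sigma>: "0 < \<sigma>" "\<sigma> \<le> 1/4" by (auto simp: \<sigma>_def field_simps)
  have "\<forall>\<^sub>F X in at_top. C \<le> X powr \<sigma>" using \<sigma> by real_asymp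
  moreover have "\<forall>\<^sub>F X::real in at_top. 2 * A * X powr (1/8) \<le> X powr (3/10)" by real_asymp
  moreover have "\<forall>\<^sub>F X::real in at_top. X1 \<le> X powr (3/4)" by real_asymp
  moreover have "\<forall>\<^sub>F X::real in at_top. 2 \<le> X" by (rule eventually_ge_at_top)
  ultimately have "\<forall>\<^sub>F X in at_top. C \<le> X powr \<sigma> \<and> 2 * A * X powr (1/8) \<le> X powr (3/10) \<and> X1 \<le> X powr (3/4) \<and> 2 \<le> X" (is "eventually ?P _")
    by eventually_elim auto
  then obtain X0 where X0: "\<And>X. X \<ge> X0 \<Longrightarrow> ?P X"
    by (auto simp: eventually_at_top_linorder)
  show ?thesis
  proof (rule exI[of _ \<sigma>], rule exI[of _ X0], intro conjI allI impI \<sigma>)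
    fix X \<tau> N :: real and x y l n :: nat
    assume "X0 \<le> X" and \<tau>: "X powr (-1/4) \<le> \<bar>\<tau>\<bar>" "\<bar>\<tau>\<bar> \<le> X powr (1/4)" and N: "X powr (3/10) \<le> N"
      and yx: "y \<le> x" and big: "X powr (3/4) \<le> (real x - real y) * N" and xN: "real x * N \<le> 2 * X"
      and ln: "N \<le> real l" "real (l + n) \<le> 2 * N + 1"
    note X = X0[OF \<open>X0 \<le> X\<close>]
    have N0: "N > 0" using X N by (intro less_le_trans[OF _ N]) auto
    have "X powr (3/4) > 0" using X by auto
    hence yx': "real y < real x" using big N0 by (smt (verit) mult_nonpos_nonneg)
    have X1: "X1 \<le> real x * N"
    proof -
      have "(real x - real y) * N \<le> real x * N" using N0 by (intro mult_right_mono) auto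
      thus ?thesis using X big by linarith
    qed
    define T where "T = \<bar>\<tau>\<bar> * (real x powr top_exp - real y powr top_exp) * N powr top_exp"
    \<comment> \<open>Here -1/4 comes from the least admissible |\<tau>| and 3/4 from the separation
      of x and y; top_exp >= 1 makes the total at least 1/2.\<close>
    have "X powr (1/2) \<le> X powr (-1/4 + 3/4 * top_exp)" using X top1 by (intro powr_mono) auto
    also have "\<dots> = X powr (-1/4) * (X powr (3/4)) powr top_exp" by (simp only: powr_powr powr_add)
    also have "\<dots> \<le> \<bar>\<tau>\<bar> * ((real x - real y) * N) powr top_exp"
      using \<tau> big top1 by (intro mult_mono powr_mono2) auto
    also have "\<dots> = \<bar>\<tau>\<bar> * ((real x - real y) powr top_exp * N powr top_exp)"
      using yx N0 by (simp add: powr_mult)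
    also have "\<dots> \<le> \<bar>\<tau>\<bar> * ((real x powr top_exp - real y powr top_exp) * N powr top_exp)"
      using yx top1 by (intro mult_left_mono mult_right_mono powr_diff_superadditive) auto
    finally have Tlow: "X powr (1/2) \<le> T" by (simp add: T_def)
    have "T \<le> X powr (1/4) * real x powr top_exp * N powr top_exp"
      unfolding T_def using \<tau> yx top1 by (intro mult_right_mono mult_mono) (auto intro!: powr_mono2)
    also have "\<dots> = X powr (1/4) * (real x * N) powr top_exp" using N0 by (simp add: powr_mult)
    also have "\<dots> \<le> X powr (1/4) * (X\<^sup>2) powr top_exp"
    proof -
      have "2 * X \<le> X\<^sup>2" using X by (simp add: power2_eq_square)
      hence "real x * N \<le> X\<^sup>2" using xN by linarith
      thus ?thesis using top1 N0 by (intro mult_left_mono powr_mono2) auto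
    qed
    also have "\<dots> = X powr (1/4 + 2 * top_exp)" using X by (simp add: powr_add powr_powr flip: powr_numeral)
    also have "\<dots> \<le> X powr (2 * top_exp + 1)" using X by (intro powr_mono) auto
    finally have Tup: "T \<le> X powr (2 * top_exp + 1)" .
    define v where "v = T powr (1 / real (2*K+1))"
    have T1: "T \<ge> 1" using Tlow X by (intro order_trans[OF ge_one_powr_ge_zero Tlow]) auto
    have v1: "v \<ge> 1" unfolding v_def using T1 by (intro ge_one_powr_ge_zero) auto
    have vT: "v ^ (2*K+1) = T"
    proof -
      have "v ^ (2*K+1) = v powr real (2*K+1)" using v1 by (subst powr_realpow) auto
      also have "\<dots> = T" unfolding v_def powr_powr using T1 by simp
      finally show ?thesis .
    qed
    have "v ^ 3 = v powr 3" using v1 by simp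
    also have "\<dots> = T powr (3 / real (2*K+1))" by (simp add: v_def powr_powr)
    also have "\<dots> \<le> (X powr (2 * top_exp + 1)) powr (3 / real (2*K+1))"
      using Tup T1 by (intro powr_mono2) auto
    also have "\<dots> = X powr ((2 * top_exp + 1) * 3 / real (2*K+1))" by (simp add: powr_powr)
    also have "\<dots> \<le> X powr (1/8)"
    proof (intro powr_mono)
      show "(2 * top_exp + 1) * 3 / real (2*K+1) \<le> 1/8" using Kbig by (simp add: divide_simps)
    qed (use X in auto)
    finally have "2 * A * v ^ 3 \<le> 2 * A * X powr (1/8)" using aA by (intro mult_left_mono) auto
    hence v3: "2 * A * v ^ 3 \<le> N" using X N by linarith
    have vlow: "v powr (-(1/2^K)) \<le> X powr (-(2*\<sigma>))"
    proof -
      have "v \<ge> X powr (1/2 * (1 / real (2*K+1)))"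
        unfolding v_def powr_powr[symmetric] using Tlow by (intro powr_mono2) auto
      hence "v powr (-(1/2^K)) \<le> (X powr (1/2 * (1 / real (2*K+1)))) powr (-(1/2^K))"
        using X by (intro powr_mono2') auto
      also have "\<dots> = X powr (-(2*\<sigma>))" by (simp add: powr_powr \<sigma>_def)
      finally show ?thesis .
    qed
    have "norm (\<Sum>j<n. uexp (\<tau> * (f (real x * real (l + j)) - f (real y * real (l + j)))))
        = norm (\<Sum>j<n. uexp (phase \<tau> (real x) (real y) 0 (real (l + j))))"
      by (simp add: phase_0)
    also have "\<dots> \<le> 5 * (5 * a powr (-(1/2^K)) + 7 * A) * N * v powr (-(1/2^K))"
      unfolding K_def
    proof (rule derivative_exp_sum_bound)
      fix m t assume "m \<le> Suc k" "N \<le> t" "t \<le> 2 * N"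
      thus "(phase \<tau> (real x) (real y) m has_real_derivative phase \<tau> (real x) (real y) (Suc m) t) (at t)"
        using N0 by (intro has_derivative_phase) auto
    next
      fix t assume t: "N \<le> t" "t \<le> 2 * N"
      note B = bnd[of "real y" "real x" N t \<tau>, unfolded Let_def, folded T_def, OF _ yx' N0 X1 t, simplified]
      show "a * v ^ (2 * Suc k + 1) \<le> \<bar>phase \<tau> (real x) (real y) (Suc k) t\<bar> * N ^ Suc k"
        "\<bar>phase \<tau> (real x) (real y) (Suc k) t\<bar> * N ^ Suc k \<le> A * v ^ (2 * Suc k + 1)"
        "\<bar>phase \<tau> (real x) (real y) (Suc (Suc k)) t\<bar> * N ^ Suc (Suc k) \<le> A * v ^ (2 * Suc k + 1)"
        using B unfolding vT[unfolded K_def] by (auto simp: K_def)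
    qed (use aA v1 v3 ln in auto)
    also have "\<dots> = C * (N * v powr (-(1/2^K)))" by (simp add: C_def)
    also have "\<dots> \<le> X powr \<sigma> * (N * X powr (-(2*\<sigma>)))"
      using X vlow N0 by (intro mult_mono) auto
    also have "\<dots> = N * X powr (-\<sigma>)" using X by (simp flip: powr_add)
    finally show "norm (\<Sum>j<n. uexp (\<tau> * (f (real x * real (l + j)) - f (real y * real (l + j))))) \<le> N * X powr (-\<sigma>)" .
  qed
qed

end

section \<open>Sums over order-convex sets of naturals\<close>

text \<open>Summation ranges arise as intersections of several inequalities. Convexity is stable
  under intersection, so no endpoints have to be computed until the final estimate.\<close>

definition nat_convex :: "nat set \<Rightarrow> bool" where
  "nat_convex S \<longleftrightarrow> (\<forall>a\<in>S. \<forall>c\<in>S. \<forall>b. a \<le> b \<longrightarrow> b \<le> c \<longrightarrow> b \<in> S)"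

lemma nat_convex_eq_interval:
  assumes "nat_convex S" "finite S" "S \<noteq> {}"
  shows "S = {Min S..<Min S + (Suc (Max S) - Min S)}"
proof -
  have "Min S \<in> S" "Max S \<in> S" using assms by auto
  have "Min S \<le> Max S" using assms by auto
  have "S = {Min S..Max S}"
  proof (intro equalityI subsetI)
    fix b assume "b \<in> S"
    thus "b \<in> {Min S..Max S}" using assms by simp
  next
    fix b assume "b \<in> {Min S..Max S}"
    hence "Min S \<le> b" "b \<le> Max S" by auto
    thus "b \<in> S" using assms(1) \<open>Min S \<in> S\<close> \<open>Max S \<in> S\<close> unfolding nat_convex_def by blast
  qed
  moreover have "{Min S..Max S} = {Min S..<Min S + (Suc (Max S) - Min S)}"
    using \<open>Min S \<le> Max S\<close> by auto
  ultimately show ?thesis by simp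
qed

lemma nat_convex_Int: "nat_convex S \<Longrightarrow> nat_convex T \<Longrightarrow> nat_convex (S \<inter> T)"
  unfolding nat_convex_def by blast

lemma nat_convex_atLeast: "nat_convex {j..}"
  and nat_convex_greaterThan: "nat_convex {j<..}"
  and nat_convex_atMost: "nat_convex {..j}"
  and nat_convex_atLeastLessThan: "nat_convex {j..<i}"
  unfolding nat_convex_def by auto

lemma nat_convex_multiples: "nat_convex {a. X \<le> w * a \<and> w * a \<le> Y}"
  unfolding nat_convex_def by (auto intro: order_trans[OF _ mult_le_mono2] order_trans[OF mult_le_mono2])

lemma nat_convex_multiples': "nat_convex {a. X \<le> a * w \<and> a * w \<le> Y}"
  using nat_convex_multiples[of X w Y] by (simp add: mult.commute)

text \<open>Partial summation: ln a is a sum of nonnegative increments over 2 <= j <= a. Exchanging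
  the sums leaves tails of F, and the increments add up to ln Y.\<close>

lemma norm_sum_ln_weight_le:
  fixes F :: "nat \<Rightarrow> complex"
  assumes "S \<subseteq> {1..Y}" "1 \<le> Y" "\<And>j. norm (\<Sum>a\<in>S \<inter> {j..}. F a) \<le> E"
  shows "norm (\<Sum>a\<in>S. of_real (ln (real a)) * F a) \<le> E * ln (real Y)"
proof -
  define w where "w = (\<lambda>j::nat. ln (real j) - ln (real (j - 1)))"
  have w: "ln (real a) = (\<Sum>j\<in>{2..a}. w j)" if "1 \<le> a" for a
    using that
  proof (induction a rule: dec_induct)
    case (step n)
    thus ?case by (simp add: w_def)
  qed auto
  have w0: "w j \<ge> 0" if "j \<ge> 2" for j using that by (simp add: w_def)
  have fin: "finite S" using assms(1) finite_subset by blast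
  have "(\<Sum>a\<in>S. of_real (ln (real a)) * F a) = (\<Sum>a\<in>S. \<Sum>j\<in>{2..Y}. if j \<le> a then of_real (w j) * F a else 0)"
  proof (rule sum.cong[OF refl])
    fix a assume a: "a \<in> S"
    hence "{2..Y} \<inter> {j. j \<le> a} = {2..a}" using assms(1) by auto
    moreover have "1 \<le> a" using a assms(1) by auto
    ultimately show "of_real (ln (real a)) * F a = (\<Sum>j\<in>{2..Y}. if j \<le> a then of_real (w j) * F a else 0)"
      using sum.inter_restrict[of "{2..Y}" "\<lambda>j. of_real (w j) * F a" "{j. j \<le> a}"]
      by (simp add: w sum_distrib_right)
  qed
  also have "\<dots> = (\<Sum>j\<in>{2..Y}. \<Sum>a\<in>S. if j \<le> a then of_real (w j) * F a else 0)"
    by (rule sum.swap)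
  also have "\<dots> = (\<Sum>j\<in>{2..Y}. of_real (w j) * (\<Sum>a\<in>S \<inter> {j..}. F a))"
    using fin by (simp add: sum_distrib_left sum.inter_restrict atLeast_def if_distrib cong: if_cong)
  also have "norm \<dots> \<le> (\<Sum>j\<in>{2..Y}. w j * E)"
    by (rule sum_norm_le) (use w0 assms(3) in \<open>auto simp: norm_mult intro!: mult_left_mono\<close>)
  also have "\<dots> = E * ln (real Y)" using w[OF assms(2)] by (simp add: sum_distrib_left mult.commute)
  finally show ?thesis .
qed

lemma dyadic_sum_bound:
  fixes F :: "nat \<Rightarrow> complex"
  assumes "\<And>i. i < L \<Longrightarrow> norm (\<Sum>c\<in>S \<inter> {2^i..<2^Suc i}. F c) \<le> E"
  shows "norm (\<Sum>c\<in>S \<inter> {1..<2^L}. F c) \<le> real L * E"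
  using assms
proof (induction L)
  case (Suc L)
  have "S \<inter> {1..<2^Suc L} = (S \<inter> {1..<2^L}) \<union> (S \<inter> {2^L..<2^Suc L})"
    by (auto simp: not_le intro: order_trans[of 1 "2^L"])
  hence "(\<Sum>c\<in>S \<inter> {1..<2^Suc L}. F c) = (\<Sum>c\<in>S \<inter> {1..<2^L}. F c) + (\<Sum>c\<in>S \<inter> {2^L..<2^Suc L}. F c)"
    by (simp only:) (rule sum.union_disjoint; auto)
  also have "norm \<dots> \<le> real L * E + E"
    using Suc by (intro norm_triangle_mono) auto
  finally show ?case by (simp add: algebra_simps)
qed auto

section \<open>Moebius function and Vaughan's identity\<close>

definition moebius :: "nat \<Rightarrow> real" where
  "moebius n = (if squarefree n then (-1) ^ card (prime_factors n) else 0)"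

lemma abs_moebius_le: "\<bar>moebius n\<bar> \<le> 1"
  by (simp add: moebius_def)

lemma moebius_prime_mult:
  assumes "prime p" "\<not> p dvd n" "n > 0"
  shows "moebius (p * n) = - moebius n"
proof -
  have cop: "coprime p n" using assms by (simp add: prime_imp_coprime)
  have "squarefree (p * n) \<longleftrightarrow> squarefree n"
    using cop assms by (metis squarefree_mult_coprime squarefree_multD(2) squarefree_prime)
  moreover have "prime_factors (p * n) = insert p (prime_factors n)"
    using assms by (simp add: prime_factors_product prime_prime_factors prime_gt_0_nat)
  moreover have "p \<notin> prime_factors n" using assms by auto
  ultimately show ?thesis by (simp add: moebius_def)
qed

text \<open>For a prime p dividing n, the divisors b prime to p pair off with p * b, with opposite
  signs. Every other divisor is divisible by p^2 and contributes 0.\<close>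

lemma sum_moebius_divisors:
  assumes "n > 0"
  shows "(\<Sum>b | b dvd n. moebius b) = (if n = 1 then 1 else 0)"
proof (cases "n = 1")
  case True
  thus ?thesis by (simp add: moebius_def)
next
  case False
  then obtain p where p: "prime p" "p dvd n" using prime_factor_nat by blast
  define A where "A = {b. b dvd n \<and> \<not> p dvd b}"
  have fin: "finite {b. b dvd n}" using assms by simp
  have "(\<Sum>b | b dvd n. moebius b) = (\<Sum>b\<in>A \<union> (\<lambda>b. p * b) ` A. moebius b)"
  proof (rule sum.mono_neutral_right[OF fin])
    show "A \<union> (\<lambda>b. p * b) ` A \<subseteq> {b. b dvd n}"
      using p by (auto simp: A_def intro!: divides_mult prime_imp_coprime)
    show "\<forall>b\<in>{b. b dvd n} - (A \<union> (\<lambda>b. p * b) ` A). moebius b = 0"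
    proof
      fix b assume b: "b \<in> {b. b dvd n} - (A \<union> (\<lambda>b. p * b) ` A)"
      hence "p dvd b" by (auto simp: A_def)
      then obtain e where e: "b = p * e" by auto
      hence "p dvd e" using b by (auto simp: A_def dest: dvd_mult_right)
      hence "p ^ 2 dvd b" using e by (auto simp: power2_eq_square)
      hence "\<not> squarefree b" using p(1) unfolding squarefree_def by (metis not_prime_unit)
      thus "moebius b = 0" by (simp add: moebius_def)
    qed
  qed
  also have "\<dots> = (\<Sum>b\<in>A. moebius b) + (\<Sum>b\<in>(\<lambda>b. p * b) ` A. moebius b)"
    using fin by (intro sum.union_disjoint) (auto simp: A_def)
  also have "(\<Sum>b\<in>(\<lambda>b. p * b) ` A. moebius b) = (\<Sum>b\<in>A. moebius (p * b))"
    using p by (subst sum.reindex) (auto simp: inj_on_def)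
  also have "\<dots> = (\<Sum>b\<in>A. - moebius b)"
    using p assms by (intro sum.cong moebius_prime_mult) (auto simp: A_def intro: Nat.gr0I)
  finally show ?thesis using False by (simp add: sum_negf)
qed

text \<open>Truncated divisor sums of \<open>moebius\<close>. The low and high parts cancel for m >
  1, and the high part vanishes for 0 < m <= V, which keeps m away from small values in the type II
  sums.\<close>

definition moebius_low :: "nat \<Rightarrow> nat \<Rightarrow> real" where
  "moebius_low V m = (\<Sum>b | b dvd m \<and> b \<le> V. moebius b)"

definition moebius_high :: "nat \<Rightarrow> nat \<Rightarrow> real" where
  "moebius_high V m = (\<Sum>b | b dvd m \<and> V < b. moebius b)"

lemma moebius_low_high:
  assumes "m > 0"
  shows "moebius_low V m + moebius_high V m = (if m = 1 then 1 else 0)"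
proof -
  have fin: "finite {b. b dvd m \<and> P b}" for P
    using assms by (intro finite_subset[OF _ finite_divisors_nat[of m]]) auto
  have "{b. b dvd m} = {b. b dvd m \<and> b \<le> V} \<union> {b. b dvd m \<and> V < b}" by auto
  hence "(\<Sum>b | b dvd m. moebius b) = (\<Sum>b\<in>{b. b dvd m \<and> b \<le> V} \<union> {b. b dvd m \<and> V < b}. moebius b)"
    by presburger
  also have "\<dots> = moebius_low V m + moebius_high V m"
    unfolding moebius_low_def moebius_high_def by (intro sum.union_disjoint fin) auto
  finally show ?thesis using sum_moebius_divisors[OF assms] by simp
qed

lemma moebius_high_eq_0: "0 < m \<Longrightarrow> m \<le> V \<Longrightarrow> moebius_high V m = 0"
  unfolding moebius_high_def by (rule sum.neutral) (auto dest: dvd_imp_le)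

lemma abs_moebius_high_le:
  assumes "m > 0"
  shows "\<bar>moebius_high V m\<bar> \<le> real (card {b. b dvd m})"
proof -
  have "\<bar>moebius_high V m\<bar> \<le> (\<Sum>b | b dvd m \<and> V < b. \<bar>moebius b\<bar>)"
    unfolding moebius_high_def by (rule sum_abs)
  also have "\<dots> \<le> (\<Sum>b | b dvd m \<and> V < b. 1)" by (intro sum_mono abs_moebius_le)
  also have "\<dots> \<le> real (card {b. b dvd m})"
    using assms by (auto intro!: card_mono)
  finally show ?thesis .
qed

text \<open>The full convolution of \<open>mangoldt\<close> with \<open>moebius_low\<close> gives
  the logarithmic sum, because the divisor sum of \<open>mangoldt\<close> is ln. For c > U the low
  part is traded for the high part; the correction at c = n is exactly \<open>mangoldt n\<close>,
  which lies in this range because U < n.\<close>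

lemma vaughan_identity:
  assumes "U < n"
  shows "mangoldt n = (\<Sum>b | b dvd n \<and> b \<le> V. moebius b * ln (real (n div b)))
     - (\<Sum>c | c dvd n \<and> c \<le> U. mangoldt c * moebius_low V (n div c))
     + (\<Sum>c | c dvd n \<and> U < c. mangoldt c * moebius_high V (n div c))"
proof -
  have n: "n > 0" using assms by simp
  have fin: "finite {c. c dvd n}" using n by simp
  have fin': "finite {c. c dvd n \<and> P c}" for P by (rule finite_subset[OF _ fin]) auto
  have split: "(\<Sum>c | c dvd n. g c) = (\<Sum>c | c dvd n \<and> c \<le> U. g c) + (\<Sum>c | c dvd n \<and> U < c. g c)" for g :: "nat \<Rightarrow> real"
  proof -
    have "{c. c dvd n} = {c. c dvd n \<and> c \<le> U} \<union> {c. c dvd n \<and> U < c}" by auto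
    hence "(\<Sum>c | c dvd n. g c) = (\<Sum>c\<in>{c. c dvd n \<and> c \<le> U} \<union> {c. c dvd n \<and> U < c}. g c)"
      by presburger
    also have "\<dots> = (\<Sum>c | c dvd n \<and> c \<le> U. g c) + (\<Sum>c | c dvd n \<and> U < c. g c)"
      by (intro sum.union_disjoint fin') auto
    finally show ?thesis .
  qed
  have lh: "moebius_low V (n div c) + moebius_high V (n div c) = (if c = n then 1 else 0)" if "c dvd n" for c
  proof -
    have "c > 0" using that n by (cases "c = 0") auto
    moreover have "n div c > 0" using that n \<open>c > 0\<close> by (simp add: div_greater_zero_iff dvd_imp_le)
    moreover have "n div c = 1 \<longleftrightarrow> c = n" using that n \<open>c > 0\<close> by (auto elim!: dvdE)
    ultimately show ?thesis using moebius_low_high[of "n div c" V] by simp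
  qed
  have all: "(\<Sum>c | c dvd n. mangoldt c * moebius_low V (n div c)) = (\<Sum>b | b dvd n \<and> b \<le> V. moebius b * ln (real (n div b)))"
  proof -
    have "(\<Sum>c | c dvd n. mangoldt c * moebius_low V (n div c)) =
        (\<Sum>c | c dvd n. \<Sum>b | b dvd n div c \<and> b \<le> V. mangoldt c * moebius b)"
      by (simp add: moebius_low_def sum_distrib_left)
    also have "\<dots> = (\<Sum>(c,b)\<in>(SIGMA c:{c. c dvd n}. {b. b dvd n div c \<and> b \<le> V}). mangoldt c * moebius b)"
      using n by (intro sum.Sigma) auto
    also have "\<dots> = (\<Sum>(b,c)\<in>(SIGMA b:{b. b dvd n \<and> b \<le> V}. {c. c dvd n div b}). moebius b * mangoldt c)"
    proof (rule sum.reindex_bij_witness[of _ "\<lambda>(b,c). (c,b)" "\<lambda>(c,b). (b,c)"])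
      have *: "b dvd n \<and> c dvd n div b" if "c dvd n" "b dvd n div c" for b c
        using that n by (auto elim!: dvdE simp: mult_ac)
      show "\<And>a. a \<in> (SIGMA c:{c. c dvd n}. {b. b dvd n div c \<and> b \<le> V}) \<Longrightarrow>
         (case a of (c, b) \<Rightarrow> (b, c)) \<in> (SIGMA b:{b. b dvd n \<and> b \<le> V}. {c. c dvd n div b})"
        using * by auto
      show "\<And>b. b \<in> (SIGMA b:{b. b dvd n \<and> b \<le> V}. {c. c dvd n div b}) \<Longrightarrow>
         (case b of (b, c) \<Rightarrow> (c, b)) \<in> (SIGMA c:{c. c dvd n}. {b. b dvd n div c \<and> b \<le> V})"
        using * by auto
    qed auto
    also have "\<dots> = (\<Sum>b | b dvd n \<and> b \<le> V. \<Sum>c | c dvd n div b. moebius b * mangoldt c)"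
      using n by (intro sum.Sigma[symmetric]) (auto simp: fin' intro!: finite_divisors_nat elim!: dvdE)
    also have "\<dots> = (\<Sum>b | b dvd n \<and> b \<le> V. moebius b * ln (real (n div b)))"
    proof (rule sum.cong[OF refl])
      fix b assume "b \<in> {b. b dvd n \<and> b \<le> V}"
      hence "n div b \<noteq> 0" using n by (auto elim!: dvdE)
      thus "(\<Sum>c | c dvd n div b. moebius b * mangoldt c) = moebius b * ln (real (n div b))"
        by (simp add: mangoldt_sum flip: sum_distrib_left)
    qed
    finally show ?thesis .
  qed
  have "(\<Sum>c | c dvd n \<and> U < c. mangoldt c * moebius_high V (n div c))
     = (\<Sum>c | c dvd n \<and> U < c. mangoldt c * (if c = n then 1 else 0) - mangoldt c * moebius_low V (n div c))"
    by (intro sum.cong refl) (use lh in \<open>auto simp: algebra_simps simp flip: distrib_left\<close>)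
  also have "\<dots> = (\<Sum>c | c dvd n \<and> U < c. if c = n then mangoldt c else 0) - (\<Sum>c | c dvd n \<and> U < c. mangoldt c * moebius_low V (n div c))"
    unfolding sum_subtractf[symmetric] by (rule sum.cong) auto
  also have "(\<Sum>c | c dvd n \<and> U < c. if c = n then mangoldt c else 0) = (mangoldt n :: real)"
    using assms by (subst sum.delta) (auto simp: fin')
  finally show ?thesis using split[of "\<lambda>c. mangoldt c * moebius_low V (n div c)"] all by simp
qed

text \<open>The substitution m = b * a. The outer factor \<open>c\<close> lets the same statement
  serve for the inner variable of an already factored n.\<close>

lemma sum_over_divisors_swap:
  fixes F :: "nat \<Rightarrow> nat \<Rightarrow> 'a :: comm_monoid_add"
  assumes "0 < X" "0 < (c::nat)"
  shows "(\<Sum>m | X \<le> c * m \<and> c * m \<le> Y. \<Sum>b | b dvd m \<and> P b. F b (m div b)) =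
         (\<Sum>b | b \<in> {1..Y} \<and> P b. \<Sum>a | X \<le> c * (b * a) \<and> c * (b * a) \<le> Y. F b a)"
proof -
  have fin: "finite {m. X \<le> w * m \<and> w * m \<le> Y}" if "w > 0" for w
  proof (rule finite_subset[of _ "{..Y}"])
    show "{m. X \<le> w * m \<and> w * m \<le> Y} \<subseteq> {..Y}"
    proof
      fix m assume "m \<in> {m. X \<le> w * m \<and> w * m \<le> Y}"
      moreover have "1 * m \<le> w * m" using that by (intro mult_le_mono1) simp
      ultimately have "m \<le> Y" by (metis (mono_tags) mem_Collect_eq mult_1 order_trans)
      thus "m \<in> {..Y}" by simp
    qed
  qed auto
  have fin2: "finite {b. b dvd m \<and> P b}" if "X \<le> c * m" for m
    using that assms by (intro finite_subset[OF _ finite_divisors_nat[of m]]) (auto intro: Nat.gr0I)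
  have "(\<Sum>m | X \<le> c * m \<and> c * m \<le> Y. \<Sum>b | b dvd m \<and> P b. F b (m div b)) =
    (\<Sum>(m,b)\<in>(SIGMA m:{m. X \<le> c * m \<and> c * m \<le> Y}. {b. b dvd m \<and> P b}). F b (m div b))"
    using fin assms fin2 by (intro sum.Sigma) auto
  also have "\<dots> = (\<Sum>(b,a)\<in>(SIGMA b:{b. b \<in> {1..Y} \<and> P b}. {a. X \<le> c * (b * a) \<and> c * (b * a) \<le> Y}). F b a)"
  proof (rule sum.reindex_bij_witness[of _ "\<lambda>(b,a). (b * a, b)" "\<lambda>(m,b). (b, m div b)"])
    fix z assume "z \<in> (SIGMA m:{m. X \<le> c * m \<and> c * m \<le> Y}. {b. b dvd m \<and> P b})"
    then obtain m b where z: "z = (m,b)" "X \<le> c * m" "c * m \<le> Y" "b dvd m" "P b" by auto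
    have "m > 0" using z assms by (auto intro: Nat.gr0I)
    moreover have "m \<le> c * m" using assms by simp
    hence "m \<le> Y" using z by linarith
    ultimately have "b \<in> {1..Y}" using z(4) dvd_imp_le[of b m] by (auto intro: Nat.gr0I simp: Suc_le_eq)
    thus "(case z of (m, b) \<Rightarrow> (b, m div b)) \<in> (SIGMA b:{b. b \<in> {1..Y} \<and> P b}. {a. X \<le> c * (b * a) \<and> c * (b * a) \<le> Y})"
      using z by auto
  qed auto
  also have "\<dots> = (\<Sum>b | b \<in> {1..Y} \<and> P b. \<Sum>a | X \<le> c * (b * a) \<and> c * (b * a) \<le> Y. F b a)"
  proof (rule sum.Sigma[symmetric])
    show "\<forall>b\<in>{b. b \<in> {1..Y} \<and> P b}. finite {a. X \<le> c * (b * a) \<and> c * (b * a) \<le> Y}"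
      using fin[of "c * b" for b] assms by (auto simp: mult.assoc)
  qed auto
  finally show ?thesis .
qed

text \<open>\<open>moebius_low\<close> is opened up so that the innermost variable a carries no
  arithmetic weight (type I), whereas \<open>moebius_high\<close> stays as a coefficient (type
  II).\<close>

lemma vaughan_sum:
  fixes \<phi> :: "nat \<Rightarrow> complex"
  assumes "U < X"
  shows "(\<Sum>n=X..Y. mangoldt n * \<phi> n) =
     (\<Sum>b | b \<in> {1..Y} \<and> b \<le> V. of_real (moebius b) * (\<Sum>a | X \<le> b * a \<and> b * a \<le> Y. of_real (ln (real a)) * \<phi> (b * a)))
   - (\<Sum>c | c \<in> {1..Y} \<and> c \<le> U. mangoldt c * (\<Sum>b | b \<in> {1..Y} \<and> b \<le> V. of_real (moebius b) * (\<Sum>a | X \<le> c * (b * a) \<and> c * (b * a) \<le> Y. \<phi> (c * (b * a)))))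
   + (\<Sum>c | c \<in> {1..Y} \<and> U < c. mangoldt c * (\<Sum>m | X \<le> c * m \<and> c * m \<le> Y. of_real (moebius_high V m) * \<phi> (c * m)))"
proof -
  have X: "X > 0" using assms by simp
  have swap: "(\<Sum>n=X..Y. (\<Sum>c | c dvd n \<and> P c. g c (n div c)) * \<phi> n) =
     (\<Sum>c | c \<in> {1..Y} \<and> P c. \<Sum>m | X \<le> c * m \<and> c * m \<le> Y. g c m * \<phi> (c * m))" for P and g :: "nat \<Rightarrow> nat \<Rightarrow> complex"
  proof -
    have "(\<Sum>n=X..Y. (\<Sum>c | c dvd n \<and> P c. g c (n div c)) * \<phi> n) =
        (\<Sum>n | X \<le> 1 * n \<and> 1 * n \<le> Y. (\<Sum>c | c dvd n \<and> P c. g c (n div c) * \<phi> (c * (n div c))))"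
      by (intro sum.cong) (auto simp: sum_distrib_right)
    also have "\<dots> = (\<Sum>c | c \<in> {1..Y} \<and> P c. \<Sum>m | X \<le> 1 * (c * m) \<and> 1 * (c * m) \<le> Y. g c m * \<phi> (c * m))"
      by (rule sum_over_divisors_swap) (use X in auto)
    finally show ?thesis by simp
  qed
  have "(\<Sum>n=X..Y. mangoldt n * \<phi> n) = (\<Sum>n=X..Y.
     ((\<Sum>b | b dvd n \<and> b \<le> V. of_real (moebius b * ln (real (n div b))))
     - (\<Sum>c | c dvd n \<and> c \<le> U. of_real (mangoldt c * moebius_low V (n div c)))
     + (\<Sum>c | c dvd n \<and> U < c. of_real (mangoldt c * moebius_high V (n div c)))) * \<phi> n)"
  proof (rule sum.cong[OF refl])
    fix n assume "n \<in> {X..Y}"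
    hence "U < n" using assms by simp
    have "mangoldt n = complex_of_real (mangoldt n)" by simp
    also note vaughan_identity[OF \<open>U < n\<close>, of V]
    finally show "mangoldt n * \<phi> n = ((\<Sum>b | b dvd n \<and> b \<le> V. of_real (moebius b * ln (real (n div b))))
     - (\<Sum>c | c dvd n \<and> c \<le> U. of_real (mangoldt c * moebius_low V (n div c)))
     + (\<Sum>c | c dvd n \<and> U < c. of_real (mangoldt c * moebius_high V (n div c)))) * \<phi> n"
      by simp
  qed
  also have "\<dots> = (\<Sum>n=X..Y. (\<Sum>b | b dvd n \<and> b \<le> V. of_real (moebius b * ln (real (n div b)))) * \<phi> n)
     - (\<Sum>n=X..Y. (\<Sum>c | c dvd n \<and> c \<le> U. of_real (mangoldt c * moebius_low V (n div c))) * \<phi> n)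
     + (\<Sum>n=X..Y. (\<Sum>c | c dvd n \<and> U < c. of_real (mangoldt c * moebius_high V (n div c))) * \<phi> n)"
    by (simp only: ring_distribs sum.distrib sum_subtractf)
  also have "(\<Sum>n=X..Y. (\<Sum>b | b dvd n \<and> b \<le> V. of_real (moebius b * ln (real (n div b)))) * \<phi> n) =
    (\<Sum>b | b \<in> {1..Y} \<and> b \<le> V. of_real (moebius b) * (\<Sum>a | X \<le> b * a \<and> b * a \<le> Y. of_real (ln (real a)) * \<phi> (b * a)))"
    by (subst swap[where g = "\<lambda>b a. of_real (moebius b * ln (real a))"]) (simp add: sum_distrib_left mult.assoc)
  also have "(\<Sum>n=X..Y. (\<Sum>c | c dvd n \<and> U < c. of_real (mangoldt c * moebius_high V (n div c))) * \<phi> n)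
     = (\<Sum>c | c \<in> {1..Y} \<and> U < c. mangoldt c * (\<Sum>m | X \<le> c * m \<and> c * m \<le> Y. of_real (moebius_high V m) * \<phi> (c * m)))"
    by (subst swap[where g = "\<lambda>c m. of_real (mangoldt c * moebius_high V m)"]) (simp add: sum_distrib_left mult.assoc)
  also have "(\<Sum>n=X..Y. (\<Sum>c | c dvd n \<and> c \<le> U. of_real (mangoldt c * moebius_low V (n div c))) * \<phi> n)
     = (\<Sum>c | c \<in> {1..Y} \<and> c \<le> U. mangoldt c * (\<Sum>m | X \<le> c * m \<and> c * m \<le> Y. of_real (moebius_low V m) * \<phi> (c * m)))"
    by (subst swap[where g = "\<lambda>c m. of_real (mangoldt c * moebius_low V m)"]) (simp add: sum_distrib_left mult.assoc)
  also have "\<dots> = (\<Sum>c | c \<in> {1..Y} \<and> c \<le> U. mangoldt c * (\<Sum>b | b \<in> {1..Y} \<and> b \<le> V. of_real (moebius b) * (\<Sum>a | X \<le> c * (b * a) \<and> c * (b * a) \<le> Y. \<phi> (c * (b * a)))))"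
  proof (rule sum.cong[OF refl], rule arg_cong[where f = "(*) _"])
    fix c assume c: "c \<in> {c. c \<in> {1..Y} \<and> c \<le> U}"
    have "(\<Sum>m | X \<le> c * m \<and> c * m \<le> Y. of_real (moebius_low V m) * \<phi> (c * m)) =
       (\<Sum>m | X \<le> c * m \<and> c * m \<le> Y. \<Sum>b | b dvd m \<and> b \<le> V. of_real (moebius b) * \<phi> (c * (b * (m div b))))"
      by (intro sum.cong refl) (simp add: moebius_low_def sum_distrib_right)
    also have "\<dots> = (\<Sum>b | b \<in> {1..Y} \<and> b \<le> V. \<Sum>a | X \<le> c * (b * a) \<and> c * (b * a) \<le> Y. of_real (moebius b) * \<phi> (c * (b * a)))"
      by (rule sum_over_divisors_swap) (use X c in auto)
    finally show "(\<Sum>m | X \<le> c * m \<and> c * m \<le> Y. of_real (moebius_low V m) * \<phi> (c * m)) =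
       (\<Sum>b | b \<in> {1..Y} \<and> b \<le> V. of_real (moebius b) * (\<Sum>a | X \<le> c * (b * a) \<and> c * (b * a) \<le> Y. \<phi> (c * (b * a))))"
      by (simp add: sum_distrib_left)
  qed
  finally show ?thesis .
qed

section \<open>Averages of the divisor function\<close>

lemma sum_inverse_le_ln: "1 \<le> M \<Longrightarrow> (\<Sum>g=1..M. 1 / real g) \<le> 1 + ln (real M)"
  using euler_mascheroni_sequence_decreasing[of 1 M] by (simp add: harm_def inverse_eq_divide)

lemma card_multiples_le:
  assumes "0 < L"
  shows "real (card {m\<in>{1..M}. L dvd m}) \<le> real M / real L"
proof -
  have "{m\<in>{1..M}. L dvd m} \<subseteq> (\<lambda>i. L * i) ` {1..M div L}"
    using assms by (auto elim!: dvdE simp: less_eq_div_iff_mult_less_eq mult.commute Suc_le_eq)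
  hence "card {m\<in>{1..M}. L dvd m} \<le> card ((\<lambda>i. L * i) ` {1..M div L})" by (intro card_mono) auto
  also have "\<dots> \<le> M div L" using card_image_le[of "{1..M div L}" "\<lambda>i. L * i"] by simp
  finally have "real (card {m\<in>{1..M}. L dvd m}) \<le> real (M div L)" by simp
  also have "\<dots> \<le> real M / real L" by (rule of_nat_div_le_of_nat)
  finally show ?thesis .
qed

lemma sum_inverse_multiples_le:
  assumes "0 < g"
  shows "(\<Sum>a\<in>{a\<in>{1..M}. g dvd a}. 1 / real a) \<le> (\<Sum>a=1..M. 1 / real a) / real g"
proof -
  have "{a\<in>{1..M}. g dvd a} \<subseteq> (\<lambda>i. g * i) ` {1..M}"
  proof
    fix a assume "a \<in> {a\<in>{1..M}. g dvd a}"
    then obtain i where i: "a = g * i" "1 \<le> a" "a \<le> M" by auto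
    have "1 * i \<le> g * i" using assms by (intro mult_le_mono1) simp
    hence "i \<le> M" using i by linarith
    hence "i \<in> {1..M}" using i by (auto simp: Suc_le_eq intro: Nat.gr0I)
    thus "a \<in> (\<lambda>i. g * i) ` {1..M}" using i by blast
  qed
  hence "(\<Sum>a\<in>{a\<in>{1..M}. g dvd a}. 1 / real a) \<le> (\<Sum>a\<in>(\<lambda>i. g * i) ` {1..M}. 1 / real a)"
    by (intro sum_mono2) auto
  also have "\<dots> = (\<Sum>i=1..M. 1 / real (g * i))" using assms by (subst sum.reindex) (auto simp: inj_on_def)
  also have "\<dots> = (\<Sum>a=1..M. 1 / real a) / real g" by (simp add: sum_divide_distrib mult.commute)
  finally show ?thesis .
qed

text \<open>The square counts pairs a, b of divisors of m. For fixed a, b the number of m is at most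
  M / lcm a b = M * gcd a b / (a * b), and summing over multiples of g yields two factors H / g.
  This leaves M * H^2 times the sum of 1 / g.\<close>

lemma sum_divisor_count_sq_le:
  "(\<Sum>m=1..M. (real (card {b. b dvd m}))\<^sup>2) \<le> real M * (\<Sum>g=1..M. 1 / real g) ^ 3"
proof -
  define H where "H = (\<Sum>g=1..M. 1 / real g)"
  have H: "H \<ge> 0" unfolding H_def by (rule sum_nonneg) auto
  have card: "real (card {b. b dvd m}) = (\<Sum>b=1..M. of_bool (b dvd m))" if "m \<in> {1..M}" for m
  proof -
    have "b \<in> {1..M}" if "b dvd m" for b
      using that \<open>m \<in> {1..M}\<close> dvd_imp_le[of b m] by (cases "b = 0") auto
    hence "{b. b dvd m} = {1..M} \<inter> {b. b dvd m}" by blast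
    thus ?thesis using sum.inter_restrict[of "{1..M}" "\<lambda>_. 1 :: real" "{b. b dvd m}"]
      by (simp add: of_bool_def)
  qed
  have "(\<Sum>m=1..M. (real (card {b. b dvd m}))\<^sup>2) = (\<Sum>m=1..M. \<Sum>a=1..M. \<Sum>b=1..M. of_bool (a dvd m) * of_bool (b dvd m))"
    by (intro sum.cong refl) (subst card, simp, simp only: power2_eq_square sum_product)
  also have "\<dots> = (\<Sum>a=1..M. \<Sum>b=1..M. \<Sum>m=1..M. of_bool (a dvd m) * of_bool (b dvd m))"
    by (subst sum.swap, rule sum.cong[OF refl], rule sum.swap)
  also have "\<dots> \<le> (\<Sum>a=1..M. \<Sum>b=1..M. \<Sum>g=1..M. real M * real g * (of_bool (g dvd a) / real a) * (of_bool (g dvd b) / real b))"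
  proof (rule sum_mono, rule sum_mono)
    fix a b assume ab: "a \<in> {1..M}" "b \<in> {1..M}"
    have "(\<Sum>m=1..M. of_bool (a dvd m) * of_bool (b dvd m) :: real) = real (card {m\<in>{1..M}. lcm a b dvd m})"
    proof -
      have "{m\<in>{1..M}. lcm a b dvd m} = {1..M} \<inter> {m. a dvd m \<and> b dvd m}" by auto
      hence "real (card {m\<in>{1..M}. lcm a b dvd m}) = (\<Sum>m\<in>{1..M} \<inter> {m. a dvd m \<and> b dvd m}. 1)" by simp
      also have "\<dots> = (\<Sum>m=1..M. if m \<in> {m. a dvd m \<and> b dvd m} then 1 else 0)"
        by (rule sum.inter_restrict) simp
      also have "\<dots> = (\<Sum>m=1..M. of_bool (a dvd m) * of_bool (b dvd m))"
        by (rule sum.cong) auto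
      finally show ?thesis by simp
    qed
    also have "\<dots> \<le> real M / real (lcm a b)" using ab by (intro card_multiples_le) (auto simp: lcm_pos_nat)
    also have "\<dots> = real M * real (gcd a b) / (real a * real b)"
    proof -
      have "real (gcd a b) * real (lcm a b) = real a * real b"
        by (metis of_nat_mult prod_gcd_lcm_nat)
      moreover have "real (lcm a b) > 0" using ab by (simp add: lcm_pos_nat)
      ultimately show ?thesis using ab by (simp add: field_simps)
    qed
    \<comment> \<open>Replacing the gcd by the sum of all common divisors g decouples a from
      b.\<close>
    also have "\<dots> \<le> (\<Sum>g=1..M. real M * real g * (of_bool (g dvd a) / real a) * (of_bool (g dvd b) / real b))"
    proof -
      have "gcd a b \<in> {1..M}" using ab by (auto simp: Suc_le_eq intro: order_trans[OF gcd_le1_nat])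
      hence "(\<lambda>g. real M * real g * (of_bool (g dvd a) / real a) * (of_bool (g dvd b) / real b)) (gcd a b) \<le>
        (\<Sum>g=1..M. real M * real g * (of_bool (g dvd a) / real a) * (of_bool (g dvd b) / real b))"
        by (intro member_le_sum) auto
      thus ?thesis by simp
    qed
    finally show "(\<Sum>m=1..M. of_bool (a dvd m) * of_bool (b dvd m)) \<le> (\<Sum>g=1..M. real M * real g * (of_bool (g dvd a) / real a) * (of_bool (g dvd b) / real b))" .
  qed
  also have "\<dots> = (\<Sum>a=1..M. \<Sum>g=1..M. \<Sum>b=1..M. real M * real g * (of_bool (g dvd a) / real a) * (of_bool (g dvd b) / real b))"
    by (rule sum.cong[OF refl], rule sum.swap)
  also have "\<dots> = (\<Sum>g=1..M. \<Sum>a=1..M. \<Sum>b=1..M. real M * real g * (of_bool (g dvd a) / real a) * (of_bool (g dvd b) / real b))"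
    by (rule sum.swap)
  also have "\<dots> = (\<Sum>g=1..M. real M * real g * (\<Sum>a=1..M. of_bool (g dvd a) / real a)\<^sup>2)"
    unfolding power2_eq_square sum_product unfolding sum_distrib_left mult.assoc ..
  also have "\<dots> \<le> (\<Sum>g=1..M. real M * real g * (H / real g)\<^sup>2)"
  proof (intro sum_mono mult_left_mono power_mono)
    fix g assume g: "g \<in> {1..M}"
    have "(\<Sum>a=1..M. of_bool (g dvd a) / real a) = (\<Sum>a\<in>{a\<in>{1..M}. g dvd a}. 1 / real a)"
      by (rule sum.mono_neutral_cong_right) auto
    thus "(\<Sum>a=1..M. of_bool (g dvd a) / real a) \<le> H / real g"
      unfolding H_def using g sum_inverse_multiples_le[of g M] by simp
  qed (auto intro!: sum_nonneg)
  also have "\<dots> = (\<Sum>g=1..M. real M * H\<^sup>2 * (1 / real g))"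
    by (intro sum.cong) (auto simp: power2_eq_square)
  also have "\<dots> = real M * H\<^sup>2 * H" unfolding H_def by (rule sum_distrib_left[symmetric])
  also have "\<dots> = real M * H ^ 3" by (simp add: power2_eq_square power3_eq_cube)
  finally show ?thesis by (simp add: H_def)
qed

section \<open>Type I and type II sums\<close>

text \<open>Only \<open>linear_sum\<close> carries analytic information about the phase; the rest of
  the argument is combinatorial. The small exponent \<open>s\<close> absorbs logarithms and
  numerical constants, and h 0 = 0 lets y = 0 in \<open>linear_sum\<close> produce sums of a single
  phase.\<close>

locale vaughan_block =
  fixes X Y :: nat and h :: "nat \<Rightarrow> real" and \<sigma> s :: real
  assumes X1: "1 \<le> X" and Y: "Y < 2 * X" and h0: "h 0 = 0"
    and \<sigma>: "0 < \<sigma>" "\<sigma> \<le> 1/4" and s: "0 < s"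
    and X10: "10 \<le> X powr s" and Xln: "1 + 2 * ln (2 * real X) \<le> X powr s"
    and X3: "2 * X powr (3/10) \<le> X powr (1/3)"
    and linear_sum: "\<And>x y N S. X powr (3/10) \<le> N \<Longrightarrow> y \<le> x \<Longrightarrow> X powr (3/4) \<le> (real x - real y) * N \<Longrightarrow>
      real x * N \<le> 2 * real X \<Longrightarrow> nat_convex S \<Longrightarrow> finite S \<Longrightarrow> (\<And>j. j \<in> S \<Longrightarrow> N \<le> real j \<and> real j \<le> 2 * N) \<Longrightarrow>
      norm (\<Sum>j\<in>S. uexp (h (x * j) - h (y * j))) \<le> N * X powr (-\<sigma>)"
begin

text \<open>Both cut-offs in Vaughan's identity will be U. Type I moduli are then at most X^(2/3),
  and both variables of the type II sums are at least of order X^(1/3), safely above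
  X^(3/10).\<close>

definition U :: nat where "U = nat \<lfloor>X powr (1/3)\<rfloor>"

lemma X0: "real X > 0" "X > 0" using X1 by auto

lemma U_le: "real U \<le> X powr (1/3)"
  unfolding U_def by simp

lemma U_less: "X powr (1/3) < real (Suc U)"
  unfolding U_def by simp linarith

lemma powr_ge_1: "a \<ge> 0 \<Longrightarrow> 1 \<le> X powr a"
  using X1 by (intro ge_one_powr_ge_zero) auto

lemma powr_le: "a \<le> b \<Longrightarrow> X powr a \<le> X powr b"
  using X1 by (intro powr_mono) auto

lemma ln_le: "0 < m \<Longrightarrow> m \<le> 2 * X \<Longrightarrow> 1 + ln (real m) \<le> X powr s"
proof -
  assume m: "0 < m" "m \<le> 2 * X"
  hence "ln (real m) \<le> ln (2 * real X)" by (subst ln_le_cancel_iff) auto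
  moreover have "0 \<le> ln (real m)" using m by simp
  ultimately show ?thesis using Xln by linarith
qed

lemma U_pos: "1 \<le> U"
proof -
  have "1 \<le> X powr (1/3)" by (rule powr_ge_1) simp
  thus ?thesis unfolding U_def by linarith
qed

lemma U_le_X: "U \<le> X"
proof -
  have "X powr (1/3) \<le> X powr 1" by (rule powr_le) simp
  thus ?thesis using U_le X1 by simp
qed

lemma sum_inverse_le: "1 \<le> M \<Longrightarrow> M \<le> 2 * X \<Longrightarrow> (\<Sum>g=1..M. 1 / real g) \<le> X powr s"
  using sum_inverse_le_ln[of M] ln_le[of M] by simp

lemma finite_multiples: "w > 0 \<Longrightarrow> finite {a. X \<le> w * a \<and> w * a \<le> (Y::nat)}"
proof (rule finite_subset[of _ "{..Y}"])
  assume w: "w > 0"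
  show "{a. X \<le> w * a \<and> w * a \<le> Y} \<subseteq> {..Y}"
  proof
    fix a assume "a \<in> {a. X \<le> w * a \<and> w * a \<le> Y}"
    moreover have "1 * a \<le> w * a" using w by (intro mult_le_mono1) simp
    ultimately have "a \<le> Y" by (metis (mono_tags) mem_Collect_eq mult_1 order_trans)
    thus "a \<in> {..Y}" by simp
  qed
qed auto

text \<open>\<open>linear_sum\<close> with y = 0 and N = X / w, which is at least X^(1/3). Arbitrary
  convex subsets are allowed because partial summation needs tails.\<close>

lemma type_I_single:
  assumes w: "0 < w" "real w \<le> X powr (2/3)" and S: "nat_convex S" "S \<subseteq> {a. X \<le> w * a \<and> w * a \<le> Y}"
  shows "norm (\<Sum>a\<in>S. uexp (h (w * a))) \<le> real X / real w * X powr (-\<sigma>)"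
proof -
  have "norm (\<Sum>a\<in>S. uexp (h (w * a) - h (0 * a))) \<le> real X / real w * X powr (-\<sigma>)"
  proof (rule linear_sum)
    have "X powr (3/10) \<le> X powr (1/3)" using X3 by (smt (verit) powr_ge_zero)
    also have "X powr (1/3) = X powr (1 - 2/3)" by simp
    also have "\<dots> = X powr 1 / X powr (2/3)" by (rule powr_diff)
    also have "\<dots> \<le> X powr 1 / w" using w X0 by (intro divide_left_mono) auto
    finally show "X powr (3/10) \<le> real X / real w" using X0 by simp
    have "X powr (3/4) \<le> X powr 1" by (rule powr_le) simp
    thus "X powr (3/4) \<le> (real w - real 0) * (real X / real w)" using w X0 by simp
    show "real w * (real X / real w) \<le> 2 * real X" using w by simp
    show "finite S" using S finite_multiples[OF w(1)] finite_subset by blast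
    fix j assume "j \<in> S"
    hence "X \<le> w * j" "w * j \<le> 2 * X" using S Y by auto
    hence "real X \<le> real w * real j" "real w * real j \<le> 2 * real X"
      by (metis of_nat_le_iff of_nat_mult, metis of_nat_le_iff of_nat_mult of_nat_numeral)
    thus "real X / real w \<le> real j \<and> real j \<le> 2 * (real X / real w)"
      using w by (auto simp: field_simps)
  qed (use S in auto)
  thus ?thesis by (simp add: h0)
qed

lemma U_sq_le:
  assumes "b \<le> U" "c \<le> U"
  shows "real (b * c) \<le> X powr (2/3)"
proof -
  have "real b * real c \<le> X powr (1/3) * X powr (1/3)"
    using assms U_le by (intro mult_mono) auto
  also have "\<dots> = X powr (2/3)" by (simp flip: powr_add)
  finally show ?thesis by simp
qed

lemma type_I_log:
  "norm (\<Sum>b | b \<in> {1..Y} \<and> b \<le> U. of_real (moebius b) * (\<Sum>a | X \<le> b * a \<and> b * a \<le> Y. of_real (ln (real a)) * uexp (h (b * a))))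
     \<le> X powr (1 - \<sigma> + 2 * s)"
proof -
  define E where "E = X powr (1 - \<sigma>) * X powr s"
  have "norm (\<Sum>b | b \<in> {1..Y} \<and> b \<le> U. of_real (moebius b) * (\<Sum>a | X \<le> b * a \<and> b * a \<le> Y. of_real (ln (real a)) * uexp (h (b * a))))
    \<le> (\<Sum>b | b \<in> {1..Y} \<and> b \<le> U. 1 / real b * E)"
  proof (rule sum_norm_le)
    fix b assume b: "b \<in> {b. b \<in> {1..Y} \<and> b \<le> U}"
    define S where "S = {a. X \<le> b * a \<and> b * a \<le> Y}"
    have "b \<le> Y" using b by simp
    have "norm (\<Sum>a\<in>S. of_real (ln (real a)) * uexp (h (b * a))) \<le> (real X / real b * X powr (-\<sigma>)) * ln (real Y)"
    proof (rule norm_sum_ln_weight_le)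
      show "S \<subseteq> {1..Y}"
      proof
        fix a assume a: "a \<in> S"
        have "1 * a \<le> b * a" using b by (intro mult_le_mono1) simp
        hence "a \<le> Y" using a unfolding S_def by (metis (mono_tags) mem_Collect_eq mult_1 order_trans)
        moreover have "a \<noteq> 0" using a X0 by (cases "a = 0") (auto simp: S_def)
        ultimately show "a \<in> {1..Y}" by simp
      qed
      show "1 \<le> Y" using b by simp
      have bb: "real b \<le> X powr (2/3)" using U_sq_le[of b 1] b U_pos by simp
      fix j
      show "norm (\<Sum>a\<in>S \<inter> {j..}. uexp (h (b * a))) \<le> real X / real b * X powr (-\<sigma>)"
        using b bb by (intro type_I_single nat_convex_Int nat_convex_atLeast) (auto simp: S_def nat_convex_multiples)
    qed
    also have "\<dots> \<le> (real X / real b * X powr (-\<sigma>)) * X powr s"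
      using ln_le[of Y] \<open>b \<le> Y\<close> b Y by (intro mult_left_mono) auto
    also have "\<dots> = 1 / real b * E"
      using X0 by (simp add: E_def powr_diff powr_minus field_simps)
    finally have *: "norm (\<Sum>a\<in>S. of_real (ln (real a)) * uexp (h (b * a))) \<le> 1 / real b * E" .
    have "norm (of_real (moebius b) * (\<Sum>a\<in>S. of_real (ln (real a)) * uexp (h (b * a)))) \<le> 1 * (1 / real b * E)"
      unfolding norm_mult norm_of_real by (intro mult_mono * abs_moebius_le) auto
    thus "norm (of_real (moebius b) * (\<Sum>a | X \<le> b * a \<and> b * a \<le> Y. of_real (ln (real a)) * uexp (h (b * a)))) \<le> 1 / real b * E"
      by (simp add: S_def)
  qed
  also have "\<dots> \<le> (\<Sum>b=1..U. 1 / real b * E)"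
    by (intro sum_mono2) (auto simp: E_def)
  also have "\<dots> = (\<Sum>b=1..U. 1 / real b) * E" by (simp add: sum_distrib_right)
  also have "\<dots> \<le> X powr s * E"
    using U_pos U_le_X by (intro mult_right_mono sum_inverse_le) (auto simp: E_def)
  also have "\<dots> = X powr (1 - \<sigma> + 2 * s)" by (simp add: E_def algebra_simps flip: powr_add)
  finally show ?thesis .
qed

lemma mangoldt_le_powr: "0 < c \<Longrightarrow> c \<le> 2 * X \<Longrightarrow> mangoldt c \<le> X powr s"
  using mangoldt_le[of c] ln_le[of c] by simp

text \<open>The product c * b acts as one modulus, at most X^(2/3). The loss 3s consists of the
  \<open>mangoldt\<close> weight and two harmonic sums.\<close>

lemma type_I_bilinear:
  "norm (\<Sum>c | c \<in> {1..Y} \<and> c \<le> U. mangoldt c * (\<Sum>b | b \<in> {1..Y} \<and> b \<le> U. of_real (moebius b) * (\<Sum>a | X \<le> c * (b * a) \<and> c * (b * a) \<le> Y. uexp (h (c * (b * a))))))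
     \<le> X powr (1 - \<sigma> + 3 * s)"
proof -
  define E where "E = X powr (1 - \<sigma>)"
  have "norm (\<Sum>c | c \<in> {1..Y} \<and> c \<le> U. mangoldt c * (\<Sum>b | b \<in> {1..Y} \<and> b \<le> U. of_real (moebius b) * (\<Sum>a | X \<le> c * (b * a) \<and> c * (b * a) \<le> Y. uexp (h (c * (b * a))))))
     \<le> (\<Sum>c | c \<in> {1..Y} \<and> c \<le> U. X powr s * (\<Sum>b | b \<in> {1..Y} \<and> b \<le> U. 1 / real c * (1 / real b) * E))"
  proof (rule sum_norm_le)
    fix c assume c: "c \<in> {c. c \<in> {1..Y} \<and> c \<le> U}"
    have "norm (\<Sum>b | b \<in> {1..Y} \<and> b \<le> U. of_real (moebius b) * (\<Sum>a | X \<le> c * (b * a) \<and> c * (b * a) \<le> Y. uexp (h (c * (b * a)))))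
      \<le> (\<Sum>b | b \<in> {1..Y} \<and> b \<le> U. 1 / real c * (1 / real b) * E)"
    proof (rule sum_norm_le)
      fix b assume b: "b \<in> {b. b \<in> {1..Y} \<and> b \<le> U}"
      have "norm (\<Sum>a | X \<le> (c * b) * a \<and> (c * b) * a \<le> Y. uexp (h ((c * b) * a))) \<le> real X / real (c * b) * X powr (-\<sigma>)"
        using b c by (intro type_I_single nat_convex_multiples U_sq_le) auto
      also have "\<dots> = 1 / real c * (1 / real b) * E"
        using X0 by (simp add: E_def powr_diff powr_minus field_simps)
      finally have "norm (of_real (moebius b) * (\<Sum>a | X \<le> (c * b) * a \<and> (c * b) * a \<le> Y. uexp (h ((c * b) * a)))) \<le> 1 * (1 / real c * (1 / real b) * E)"
        unfolding norm_mult norm_of_real by (intro mult_mono abs_moebius_le) auto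
      thus "norm (of_real (moebius b) * (\<Sum>a | X \<le> c * (b * a) \<and> c * (b * a) \<le> Y. uexp (h (c * (b * a))))) \<le> 1 / real c * (1 / real b) * E"
        by (simp add: mult.assoc)
    qed
    thus "norm (mangoldt c * (\<Sum>b | b \<in> {1..Y} \<and> b \<le> U. of_real (moebius b) * (\<Sum>a | X \<le> c * (b * a) \<and> c * (b * a) \<le> Y. uexp (h (c * (b * a))))))
      \<le> X powr s * (\<Sum>b | b \<in> {1..Y} \<and> b \<le> U. 1 / real c * (1 / real b) * E)"
      unfolding norm_mult using c Y by (intro mult_mono) (auto intro!: mangoldt_le_powr)
  qed
  also have "\<dots> \<le> (\<Sum>c=1..U. X powr s * (\<Sum>b=1..U. 1 / real c * (1 / real b) * E))"
  proof -
    have "(\<Sum>c | c \<in> {1..Y} \<and> c \<le> U. X powr s * (\<Sum>b | b \<in> {1..Y} \<and> b \<le> U. 1 / real c * (1 / real b) * E))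
       \<le> (\<Sum>c | c \<in> {1..Y} \<and> c \<le> U. X powr s * (\<Sum>b=1..U. 1 / real c * (1 / real b) * E))"
    proof (rule sum_mono)
      fix c
      show "X powr s * (\<Sum>b | b \<in> {1..Y} \<and> b \<le> U. 1 / real c * (1 / real b) * E) \<le> X powr s * (\<Sum>b=1..U. 1 / real c * (1 / real b) * E)"
        by (intro mult_left_mono sum_mono2) (auto simp: E_def)
    qed
    also have "\<dots> \<le> (\<Sum>c=1..U. X powr s * (\<Sum>b=1..U. 1 / real c * (1 / real b) * E))"
      by (rule sum_mono2) (auto simp: E_def intro!: mult_nonneg_nonneg sum_nonneg)
    finally show ?thesis .
  qed
  also have "\<dots> = X powr s * E * ((\<Sum>c=1..U. 1 / real c) * (\<Sum>b=1..U. 1 / real b))"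
    unfolding sum_product unfolding sum_distrib_left by (simp add: mult_ac)
  also have "\<dots> \<le> X powr s * E * (X powr s * X powr s)"
    using U_pos U_le_X by (intro mult_left_mono mult_mono sum_inverse_le sum_nonneg) (auto simp: E_def)
  also have "\<dots> = X powr (1 - \<sigma> + 3 * s)" by (simp add: E_def algebra_simps flip: powr_add)
  finally show ?thesis .
qed

text \<open>Pairs \<open>m1, m2\<close> that are too close for the linear bound are few and are estimated trivially.\<close>

lemma type_II_pair:
  fixes m1 m2 :: nat
  assumes C: "X powr (3/10) \<le> real C" "m1 * C \<le> 2 * X" "m2 * C \<le> 2 * X"
    and S: "nat_convex S" "S \<subseteq> {C..<2*C}"
  shows "norm (\<Sum>c\<in>S. uexp (h (m1 * c) - h (m2 * c)))
    \<le> real C * (of_bool (\<bar>real m1 - real m2\<bar> * real C < X powr (3/4)) + X powr (-\<sigma>))"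
proof -
  have fin: "finite S" using S finite_subset by blast
  have *: "norm (\<Sum>c\<in>S. uexp (h (m * c) - h (m' * c))) \<le> real C * X powr (-\<sigma>)"
    if "m' \<le> m" "X powr (3/4) \<le> (real m - real m') * real C" "m * C \<le> 2 * X" for m m' :: nat
  proof (rule linear_sum)
    have "real (m * C) \<le> real (2 * X)" using that(3) by (rule of_nat_mono)
    thus "real m * real C \<le> 2 * real X" by simp
    fix j assume "j \<in> S"
    hence "C \<le> j" "j \<le> 2 * C" using S by auto
    hence "real C \<le> real j" "real j \<le> real (2 * C)" by (auto intro: of_nat_mono)
    thus "real C \<le> real j \<and> real j \<le> 2 * real C" by simp
  qed (use that C S fin in auto)
  show ?thesis
  proof (cases "\<bar>real m1 - real m2\<bar> * real C < X powr (3/4)")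
    case True
    have "norm (\<Sum>c\<in>S. uexp (h (m1 * c) - h (m2 * c))) \<le> (\<Sum>c\<in>S. 1)"
      by (rule sum_norm_le) simp
    also have "\<dots> \<le> real C" using card_mono[OF _ S(2)] by simp
    also have "\<dots> \<le> real C * (1 + X powr (-\<sigma>))" by (simp add: algebra_simps)
    finally show ?thesis using True by simp
  next
    case False
    show ?thesis
    proof (cases "m2 \<le> m1")
      case True
      thus ?thesis using False *[of m2 m1] C by simp
    next
      case m12: False
      \<comment> \<open>Exchanging m1 and m2 conjugates the sum, so the larger multiplier may come
        first.\<close>
      have "(\<Sum>c\<in>S. uexp (h (m1 * c) - h (m2 * c))) = cnj (\<Sum>c\<in>S. uexp (h (m2 * c) - h (m1 * c)))"
        by (simp add: cnj_uexp)
      hence "norm (\<Sum>c\<in>S. uexp (h (m1 * c) - h (m2 * c))) = norm (\<Sum>c\<in>S. uexp (h (m2 * c) - h (m1 * c)))"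
        by (simp only: complex_mod_cnj)
      also have "\<dots> \<le> real C * X powr (-\<sigma>)" using m12 False C by (intro *) auto
      finally show ?thesis using False by simp
    qed
  qed
qed

lemma card_near_le:
  fixes m :: nat
  assumes "0 < C" "0 \<le> D"
  shows "real (card {m'\<in>{1..M}. \<bar>real m - real m'\<bar> * real C < D}) \<le> 2 * D / real C + 1"
proof -
  define r where "r = nat \<lfloor>D / real C\<rfloor>"
  have "{m'\<in>{1..M}. \<bar>real m - real m'\<bar> * real C < D} \<subseteq> {m - r..m + r}"
  proof
    fix m' assume "m' \<in> {m'\<in>{1..M}. \<bar>real m - real m'\<bar> * real C < D}"
    hence "\<bar>real m - real m'\<bar> < D / real C" using assms by (simp add: field_simps)
    hence "\<bar>int m - int m'\<bar> \<le> \<lfloor>D / real C\<rfloor>" by (simp add: le_floor_iff)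
    hence "\<bar>int m - int m'\<bar> \<le> int r" using assms by (simp add: r_def)
    thus "m' \<in> {m - r..m + r}" by auto
  qed
  hence "card {m'\<in>{1..M}. \<bar>real m - real m'\<bar> * real C < D} \<le> card {m - r..m + r}" by (intro card_mono) auto
  also have "\<dots> \<le> 2 * r + 1" by auto
  finally have "real (card {m'\<in>{1..M}. \<bar>real m - real m'\<bar> * real C < D}) \<le> 2 * real r + 1" by linarith
  moreover have "real r \<le> D / real C" using assms by (simp add: r_def)
  ultimately show ?thesis by simp
qed

text \<open>Opening the square and exchanging sums leaves correlations over c, to which
  \<open>type_II_pair\<close> applies. The products of coefficients are split by 2uv <= u^2 + v^2,
  so by symmetry only the mean square of the divisor function remains. The sets \<open>R m\<close>
  encode the condition X <= c * m <= Y, which depends on both variables.\<close>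

lemma type_II_square:
  fixes C M :: nat
  assumes C: "X powr (3/10) \<le> real C" "M * C \<le> 2 * X" "1 \<le> M" "0 < C"
    and S: "nat_convex S" "S \<subseteq> {C..<2*C}"
    and R: "\<And>m. nat_convex (R m)"
    and B: "\<And>m. m \<in> {1..M} \<Longrightarrow> \<bar>B m\<bar> \<le> real (card {b. b dvd m})"
  shows "(\<Sum>c\<in>S. (norm (\<Sum>m=1..M. of_bool (c \<in> R m) * of_real (B m) * uexp (h (m * c))))\<^sup>2)
      \<le> real C * (real M * X powr (3 * s)) * (2 * X powr (3/4) / real C + 1 + real M * X powr (-\<sigma>))"
proof -
  have fin: "finite S" using S finite_subset by blast
  define dd where "dd = (\<lambda>m::nat. real (card {b. b dvd m}))"
  define near where "near = (\<lambda>m1 m2 :: nat. (of_bool (\<bar>real m1 - real m2\<bar> * real C < X powr (3/4)) :: real))"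
  define g where "g = (\<lambda>c. \<Sum>m=1..M. of_bool (c \<in> R m) * complex_of_real (B m) * uexp (h (m * c)))"
  have "complex_of_real (\<Sum>c\<in>S. (norm (g c))\<^sup>2) = (\<Sum>c\<in>S. g c * cnj (g c))"
    by (simp only: of_real_sum complex_norm_square)
  also have "\<dots> = (\<Sum>c\<in>S. \<Sum>m1=1..M. \<Sum>m2=1..M. of_real (B m1 * B m2) * (if c \<in> R m1 \<inter> R m2 then uexp (h (m1 * c) - h (m2 * c)) else 0))"
    unfolding g_def cnj_sum sum_product
    by (intro sum.cong refl) (auto simp: uexp_mult_cnj[symmetric])
  also have "\<dots> = (\<Sum>m1=1..M. \<Sum>m2=1..M. \<Sum>c\<in>S. of_real (B m1 * B m2) * (if c \<in> R m1 \<inter> R m2 then uexp (h (m1 * c) - h (m2 * c)) else 0))"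
    by (subst sum.swap, rule sum.cong[OF refl], rule sum.swap)
  also have "\<dots> = (\<Sum>m1=1..M. \<Sum>m2=1..M. of_real (B m1 * B m2) * (\<Sum>c\<in>S \<inter> (R m1 \<inter> R m2). uexp (h (m1 * c) - h (m2 * c))))"
    unfolding sum.inter_restrict[OF fin] sum_distrib_left ..
  finally have eq: "complex_of_real (\<Sum>c\<in>S. (norm (g c))\<^sup>2) = (\<Sum>m1=1..M. \<Sum>m2=1..M. of_real (B m1 * B m2) * (\<Sum>c\<in>S \<inter> (R m1 \<inter> R m2). uexp (h (m1 * c) - h (m2 * c))))" .
  have "(\<Sum>c\<in>S. (norm (g c))\<^sup>2) = norm (complex_of_real (\<Sum>c\<in>S. (norm (g c))\<^sup>2))"
    by (simp only: norm_of_real) (simp add: sum_nonneg)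
  also have "\<dots> \<le> (\<Sum>m1=1..M. \<Sum>m2=1..M. (dd m1)\<^sup>2/2 * (real C * (near m1 m2 + X powr (-\<sigma>))) + (dd m2)\<^sup>2/2 * (real C * (near m2 m1 + X powr (-\<sigma>))))"
    unfolding eq
  proof (rule sum_norm_le, rule sum_norm_le)
    fix m1 m2 assume m: "m1 \<in> {1..M}" "m2 \<in> {1..M}"
    have mC: "m1 * C \<le> 2 * X" "m2 * C \<le> 2 * X"
      using m by (auto intro: order_trans[OF mult_le_mono1 C(2)])
    have conv: "nat_convex (S \<inter> (R m1 \<inter> R m2))" using S R by (intro nat_convex_Int)
    have "norm (\<Sum>c\<in>S \<inter> (R m1 \<inter> R m2). uexp (h (m1 * c) - h (m2 * c))) \<le> real C * (near m1 m2 + X powr (-\<sigma>))"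
      unfolding near_def using C(1) mC conv S by (intro type_II_pair) auto
    hence "norm (of_real (B m1 * B m2) * (\<Sum>c\<in>S \<inter> (R m1 \<inter> R m2). uexp (h (m1 * c) - h (m2 * c))))
       \<le> (dd m1 * dd m2) * (real C * (near m1 m2 + X powr (-\<sigma>)))"
      unfolding norm_mult norm_of_real abs_mult using B[OF m(1)] B[OF m(2)] unfolding dd_def
      by (intro mult_mono) auto
    also have "\<dots> \<le> ((dd m1)\<^sup>2/2 + (dd m2)\<^sup>2/2) * (real C * (near m1 m2 + X powr (-\<sigma>)))"
    proof (rule mult_right_mono)
      have "0 \<le> (dd m1 - dd m2)\<^sup>2" by simp
      thus "dd m1 * dd m2 \<le> (dd m1)\<^sup>2/2 + (dd m2)\<^sup>2/2" by (simp add: power2_eq_square algebra_simps)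
      show "0 \<le> real C * (near m1 m2 + X powr (-\<sigma>))" by (simp add: near_def)
    qed
    also have "near m1 m2 = near m2 m1" by (simp add: near_def abs_minus_commute)
    finally show "norm (of_real (B m1 * B m2) * (\<Sum>c\<in>S \<inter> (R m1 \<inter> R m2). uexp (h (m1 * c) - h (m2 * c))))
      \<le> (dd m1)\<^sup>2/2 * (real C * (near m1 m2 + X powr (-\<sigma>))) + (dd m2)\<^sup>2/2 * (real C * (near m2 m1 + X powr (-\<sigma>)))"
      by (simp add: near_def abs_minus_commute distrib_right)
  qed
  also have "\<dots> = (\<Sum>m1=1..M. \<Sum>m2=1..M. (dd m1)\<^sup>2/2 * (real C * (near m1 m2 + X powr (-\<sigma>))))
      + (\<Sum>m1=1..M. \<Sum>m2=1..M. (dd m2)\<^sup>2/2 * (real C * (near m2 m1 + X powr (-\<sigma>))))"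
    by (simp only: sum.distrib)
  also have "(\<Sum>m1=1..M. \<Sum>m2=1..M. (dd m2)\<^sup>2/2 * (real C * (near m2 m1 + X powr (-\<sigma>))))
     = (\<Sum>m1=1..M. \<Sum>m2=1..M. (dd m1)\<^sup>2/2 * (real C * (near m1 m2 + X powr (-\<sigma>))))"
    by (rule sum.swap)
  also have "(\<Sum>m1=1..M. \<Sum>m2=1..M. (dd m1)\<^sup>2/2 * (real C * (near m1 m2 + X powr (-\<sigma>))))
     \<le> (\<Sum>m1=1..M. (dd m1)\<^sup>2/2 * (real C * (2 * X powr (3/4) / real C + 1 + real M * X powr (-\<sigma>))))"
  proof (rule sum_mono)
    fix m1 assume "m1 \<in> {1..M}"
    have "(\<Sum>m2=1..M. near m1 m2) = real (card {m'\<in>{1..M}. \<bar>real m1 - real m'\<bar> * real C < X powr (3/4)})"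
    proof -
      have "(\<Sum>m2=1..M. near m1 m2) = (\<Sum>m2\<in>{m'\<in>{1..M}. \<bar>real m1 - real m'\<bar> * real C < X powr (3/4)}. 1)"
        by (rule sum.mono_neutral_cong_right) (auto simp: near_def)
      thus ?thesis by simp
    qed
    also have "\<dots> \<le> 2 * X powr (3/4) / real C + 1" using C by (intro card_near_le) auto
    finally have nn: "(\<Sum>m2=1..M. near m1 m2) \<le> 2 * X powr (3/4) / real C + 1" .
    have "(\<Sum>m2=1..M. (dd m1)\<^sup>2/2 * (real C * (near m1 m2 + X powr (-\<sigma>)))) =
       (dd m1)\<^sup>2/2 * (real C * ((\<Sum>m2=1..M. near m1 m2) + real M * X powr (-\<sigma>)))"
      by (simp only: sum_distrib_left[symmetric] sum.distrib sum_constant) simp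
    also have "\<dots> \<le> (dd m1)\<^sup>2/2 * (real C * (2 * X powr (3/4) / real C + 1 + real M * X powr (-\<sigma>)))"
      using nn by (intro mult_left_mono add_right_mono) auto
    finally show "(\<Sum>m2=1..M. (dd m1)\<^sup>2/2 * (real C * (near m1 m2 + X powr (-\<sigma>)))) \<le> \<dots>" .
  qed
  also have "(\<Sum>m1=1..M. (dd m1)\<^sup>2/2 * (real C * (2 * X powr (3/4) / real C + 1 + real M * X powr (-\<sigma>)))) =
     (\<Sum>m1=1..M. (dd m1)\<^sup>2) / 2 * (real C * (2 * X powr (3/4) / real C + 1 + real M * X powr (-\<sigma>)))"
    by (simp only: sum_divide_distrib sum_distrib_right)
  finally have "(\<Sum>c\<in>S. (norm (g c))\<^sup>2) \<le> (\<Sum>m1=1..M. (dd m1)\<^sup>2) * (real C * (2 * X powr (3/4) / real C + 1 + real M * X powr (-\<sigma>)))"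
    by (simp add: mult_ac)
  also have "\<dots> \<le> (real M * X powr (3 * s)) * (real C * (2 * X powr (3/4) / real C + 1 + real M * X powr (-\<sigma>)))"
  proof (rule mult_right_mono)
    have "M * 1 \<le> M * C" using C by (intro mult_le_mono2) simp
    hence "M \<le> 2 * X" using C by linarith
    have "(\<Sum>m1=1..M. (dd m1)\<^sup>2) \<le> real M * (\<Sum>g=1..M. 1 / real g) ^ 3"
      unfolding dd_def by (rule sum_divisor_count_sq_le)
    also have "\<dots> \<le> real M * (X powr s) ^ 3"
      using C \<open>M \<le> 2 * X\<close> by (intro mult_left_mono power_mono sum_inverse_le sum_nonneg) auto
    also have "(X powr s) ^ 3 = X powr (3 * s)" using X0 by (simp add: powr_power mult.commute)
    finally show "(\<Sum>m1=1..M. (dd m1)\<^sup>2) \<le> real M * X powr (3 * s)" .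
  qed auto
  finally show ?thesis by (simp add: g_def mult_ac)
qed

text \<open>Cauchy-Schwarz discards the weights \<open>mangoldt c\<close> and reduces to
  \<open>type_II_square\<close>. The result does not depend on the dyadic scale, since M * C <=
  2X.\<close>

lemma type_II_dyadic:
  "norm (\<Sum>c\<in>{c. c \<in> {1..Y} \<and> U < c} \<inter> {2^i..<2^Suc i}. mangoldt c * (\<Sum>m | X \<le> c * m \<and> c * m \<le> Y. of_real (moebius_high U m) * uexp (h (c * m))))
    \<le> 4 * X powr (1 - \<sigma> / 2 + 5/2 * s)"
proof -
  define C :: nat where "C = 2^i"
  define S where "S = {c. c \<in> {1..Y} \<and> U < c} \<inter> {2^i..<2^Suc i}"
  define M where "M = (2 * X) div C"
  define g where "g = (\<lambda>c. \<Sum>m=1..M. of_bool (c \<in> {c. X \<le> c * m \<and> c * m \<le> Y}) * complex_of_real (moebius_high U m) * uexp (h (m * c)))"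
  have C0: "C > 0" by (simp add: C_def)
  have MC: "M * C \<le> 2 * X" by (simp add: M_def)
  have SC: "S \<subseteq> {C..<2*C}" by (auto simp: S_def C_def)
  have fin: "finite S" using SC finite_subset by blast
  have inner: "(\<Sum>m | X \<le> c * m \<and> c * m \<le> Y. of_real (moebius_high U m) * uexp (h (c * m))) = g c" if "c \<in> S" for c
  proof -
    have c: "C \<le> c" "c > 0" using that SC C0 by auto
    have "{m. X \<le> c * m \<and> c * m \<le> Y} \<subseteq> {1..M}"
    proof
      fix m assume m: "m \<in> {m. X \<le> c * m \<and> c * m \<le> Y}"
      have "m * C \<le> c * m" using c by simp
      moreover from m have "c * m \<le> Y" by simp
      ultimately have "m * C \<le> 2 * X" using Y by linarith
      hence "m \<le> M" unfolding M_def using C0 by (simp add: less_eq_div_iff_mult_less_eq)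
      moreover have "m \<noteq> 0" using m X0 by (cases "m = 0") auto
      ultimately show "m \<in> {1..M}" by simp
    qed
    hence "{m. X \<le> c * m \<and> c * m \<le> Y} = {1..M} \<inter> {m. X \<le> c * m \<and> c * m \<le> Y}" by auto
    hence "(\<Sum>m | X \<le> c * m \<and> c * m \<le> Y. of_real (moebius_high U m) * uexp (h (c * m))) =
       (\<Sum>m\<in>{1..M} \<inter> {m. X \<le> c * m \<and> c * m \<le> Y}. of_real (moebius_high U m) * uexp (h (c * m)))" by presburger
    also have "\<dots> = (\<Sum>m=1..M. if m \<in> {m. X \<le> c * m \<and> c * m \<le> Y} then of_real (moebius_high U m) * uexp (h (c * m)) else 0)"
      by (rule sum.inter_restrict) simp
    also have "\<dots> = g c" unfolding g_def by (rule sum.cong) (auto simp: mult.commute)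
    finally show ?thesis .
  qed
  have nonneg: "0 \<le> 4 * X powr (1 - \<sigma> / 2 + 5/2 * s)" by simp
  have "norm (\<Sum>c\<in>S. mangoldt c * g c) \<le> 4 * X powr (1 - \<sigma> / 2 + 5/2 * s)"
  proof (cases "S = {} \<or> M \<le> U")
    \<comment> \<open>If M <= U, every coefficient \<open>moebius_high U m\<close> vanishes.
      Otherwise M > X^(1/3), which bounds C above by 2 * X^(2/3).\<close>
    case True
    have "(\<Sum>c\<in>S. mangoldt c * g c) = 0"
    proof (cases "S = {}")
      case False
      hence "M \<le> U" using True by simp
      hence "g c = 0" for c unfolding g_def by (intro sum.neutral) (auto simp: moebius_high_eq_0)
      thus ?thesis by simp
    qed auto
    thus ?thesis using nonneg by simp
  next
    case False
    then obtain c where c: "c \<in> S" by auto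
    hence "U < 2 * C" using SC by (force simp: S_def)
    hence "real (Suc U) \<le> real (2 * C)" by (intro of_nat_mono) simp
    hence "X powr (1/3) \<le> 2 * real C" using U_less by simp
    hence Clow: "X powr (3/10) \<le> real C" using X3 by linarith
    have "real (Suc U) \<le> real M" using False by (intro of_nat_mono) simp
    hence Mlow: "X powr (1/3) \<le> real M" using U_less by simp
    have M1: "1 \<le> M" using False U_pos by linarith
    have MC': "real M * real C \<le> 2 * real X" using MC by (metis of_nat_le_iff of_nat_mult of_nat_numeral)
    have Cup: "real C \<le> 2 * X powr (2/3)"
    proof -
      have "X powr (1/3) * real C \<le> real M * real C" using Mlow by (intro mult_right_mono) auto
      also have "\<dots> \<le> 2 * X powr 1" using MC' X0 by simp
      also have "X powr 1 = X powr (1/3) * X powr (2/3)" by (simp flip: powr_add)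
      finally have "X powr (1/3) * real C \<le> X powr (1/3) * (2 * X powr (2/3))" by (simp add: mult_ac)
      thus ?thesis using X0 by (subst (asm) mult_le_cancel_left_pos) auto
    qed
    have sq: "(\<Sum>c\<in>S. (norm (g c))\<^sup>2) \<le> real C * (real M * X powr (3 * s)) * (2 * X powr (3/4) / real C + 1 + real M * X powr (-\<sigma>))"
      unfolding g_def
    proof (rule type_II_square[OF Clow MC M1 C0 _ SC])
      have "S = {..Y} \<inter> {U<..} \<inter> {2^i..<2^Suc i}" using U_pos by (auto simp: S_def)
      thus "nat_convex S" by (simp only: nat_convex_Int nat_convex_atMost nat_convex_greaterThan nat_convex_atLeastLessThan)
      show "\<And>m. nat_convex {c. X \<le> c * m \<and> c * m \<le> Y}" by (rule nat_convex_multiples')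
    qed (auto intro: abs_moebius_high_le)
    have "norm (\<Sum>c\<in>S. mangoldt c * g c) \<le> (\<Sum>c\<in>S. mangoldt c * norm (g c))"
      by (rule sum_norm_le) (simp add: norm_mult)
    hence "(norm (\<Sum>c\<in>S. mangoldt c * g c))\<^sup>2 \<le> (\<Sum>c\<in>S. mangoldt c * norm (g c))\<^sup>2"
      by (intro power_mono) auto
    also have "\<dots> \<le> (\<Sum>c\<in>S. (mangoldt c)\<^sup>2) * (\<Sum>c\<in>S. (norm (g c))\<^sup>2)"
      by (rule Cauchy_Schwarz_ineq_sum)
    also have "\<dots> \<le> (real C * X powr (2 * s)) * (real C * (real M * X powr (3 * s)) * (2 * X powr (3/4) / real C + 1 + real M * X powr (-\<sigma>)))"
    proof (intro mult_mono sq)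
      have "(\<Sum>c\<in>S. (mangoldt c)\<^sup>2) \<le> (\<Sum>c\<in>S. (X powr s)\<^sup>2)"
        using Y by (intro sum_mono power_mono mangoldt_le_powr mangoldt_nonneg) (auto simp: S_def)
      also have "\<dots> = real (card S) * X powr (2 * s)" using X0 by (simp add: powr_power mult.commute)
      also have "\<dots> \<le> real C * X powr (2 * s)"
        using card_mono[OF _ SC] by (intro mult_right_mono) auto
      finally show "(\<Sum>c\<in>S. (mangoldt c)\<^sup>2) \<le> real C * X powr (2 * s)" .
    qed (auto intro: sum_nonneg)
    also have "\<dots> = X powr (2 * s) * X powr (3 * s) * (real M * real C) * (2 * X powr (3/4) + real C + real M * real C * X powr (-\<sigma>))"
      using C0 by (simp add: field_simps)
    \<comment> \<open>The three terms come from near pairs, from the additional 1 in counting them,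
      and from the saving for separated pairs. Each is at most 2 * X^(1-\<sigma>) because \<sigma>
      <= 1/4.\<close>
    also have "\<dots> \<le> X powr (2 * s) * X powr (3 * s) * (2 * real X) * (2 * X powr (1-\<sigma>) + 2 * X powr (1-\<sigma>) + 2 * X powr (1-\<sigma>))"
    proof (rule mult_mono)
      show "X powr (2 * s) * X powr (3 * s) * (real M * real C) \<le> X powr (2 * s) * X powr (3 * s) * (2 * real X)"
        using MC' by (intro mult_left_mono) auto
      have c1: "X powr (3/4) \<le> X powr (1-\<sigma>)" using \<sigma> by (intro powr_le) simp
      have "X powr (2/3) \<le> X powr (1-\<sigma>)" using \<sigma> by (intro powr_le) simp
      hence c2: "real C \<le> 2 * X powr (1-\<sigma>)" using Cup by linarith
      have "real M * real C * X powr (-\<sigma>) \<le> 2 * real X * X powr (-\<sigma>)" using MC' by (intro mult_right_mono) auto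
      also have "\<dots> = 2 * X powr (1-\<sigma>)" using X0 by (simp add: powr_diff powr_minus divide_inverse)
      finally have "real M * real C * X powr (-\<sigma>) \<le> 2 * X powr (1-\<sigma>)" .
      with c1 c2 show "2 * X powr (3/4) + real C + real M * real C * X powr (-\<sigma>)
          \<le> 2 * X powr (1-\<sigma>) + 2 * X powr (1-\<sigma>) + 2 * X powr (1-\<sigma>)" by linarith
    qed auto
    also have "\<dots> = 12 * (X powr (2 * s) * X powr (3 * s) * X powr 1 * X powr (1-\<sigma>))"
      using X0 by simp
    also have "\<dots> = 12 * X powr (2 * s + 3 * s + 1 + (1 - \<sigma>))" by (simp only: powr_add)
    also have "\<dots> = 12 * X powr (2 - \<sigma> + 5 * s)" by (simp add: algebra_simps)
    also have "\<dots> \<le> 16 * X powr (2 - \<sigma> + 5 * s)" by simp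
    also have "\<dots> = (4 * X powr (1 - \<sigma> / 2 + 5/2 * s))\<^sup>2"
      by (simp add: power_mult_distrib power2_eq_square algebra_simps flip: powr_add)
    finally show ?thesis by (rule power2_le_imp_le) simp
  qed
  moreover have "(\<Sum>c\<in>S. mangoldt c * (\<Sum>m | X \<le> c * m \<and> c * m \<le> Y. of_real (moebius_high U m) * uexp (h (c * m)))) = (\<Sum>c\<in>S. mangoldt c * g c)"
    using inner by (intro sum.cong) auto
  ultimately show ?thesis by (simp add: S_def)
qed

lemma type_II:
  "norm (\<Sum>c | c \<in> {1..Y} \<and> U < c. mangoldt c * (\<Sum>m | X \<le> c * m \<and> c * m \<le> Y. of_real (moebius_high U m) * uexp (h (c * m))))
    \<le> 8 * X powr (1 - \<sigma> / 2 + 7/2 * s)"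
proof -
  define L where "L = nat \<lceil>log 2 (2 * real X)\<rceil>"
  have ln2: "ln 2 \<ge> (1/2 :: real)" by (rule order_trans[OF _ ln2_ge_two_thirds]) simp
  have log0: "log 2 (2 * real X) \<ge> 0" using X1 by (subst zero_le_log_cancel_iff) auto
  have "real L \<le> log 2 (2 * real X) + 1" using log0 by (simp add: L_def)
  also have "log 2 (2 * real X) \<le> 2 * ln (2 * real X)"
  proof -
    have "ln (2 * real X) \<ge> 0" using X1 by simp
    hence "ln (2 * real X) * 1 \<le> ln (2 * real X) * (2 * ln 2)" using ln2 by (intro mult_left_mono) auto
    thus ?thesis using ln2 by (simp add: log_def divide_simps mult_ac)
  qed
  finally have L: "real L \<le> 2 * X powr s" using Xln powr_ge_zero[of X s] by linarith
  have "2 * real X = 2 powr (log 2 (2 * real X))" using X0 by simp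
  also have "\<dots> \<le> 2 powr real L" using log0 by (intro powr_mono) (auto simp: L_def)
  finally have "2 * real X \<le> real (2 ^ L)" by (simp add: powr_realpow)
  hence "2 * X \<le> 2 ^ L" by (metis of_nat_le_iff of_nat_mult of_nat_numeral)
  hence eq: "{c. c \<in> {1..Y} \<and> U < c} = {c. c \<in> {1..Y} \<and> U < c} \<inter> {1..<2^L}" using Y by auto
  have "norm (\<Sum>c | c \<in> {1..Y} \<and> U < c. mangoldt c * (\<Sum>m | X \<le> c * m \<and> c * m \<le> Y. of_real (moebius_high U m) * uexp (h (c * m))))
     \<le> real L * (4 * X powr (1 - \<sigma> / 2 + 5/2 * s))"
    by (subst eq, rule dyadic_sum_bound, rule type_II_dyadic)
  also have "\<dots> \<le> (2 * X powr s) * (4 * X powr (1 - \<sigma> / 2 + 5/2 * s))"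
    using L by (intro mult_right_mono) auto
  also have "\<dots> = 8 * X powr (1 - \<sigma> / 2 + 7/2 * s)"
    by (simp add: algebra_simps flip: powr_add)
  finally show ?thesis .
qed

lemma mangoldt_sum_bound:
  "norm (\<Sum>n=X..Y. mangoldt n * uexp (h n)) \<le> X powr (1 - \<sigma> / 2 + 5 * s)"
proof (cases "U < X")
  case True
  have "norm (\<Sum>n=X..Y. mangoldt n * uexp (h n)) \<le>
     X powr (1 - \<sigma> + 2 * s) + X powr (1 - \<sigma> + 3 * s) + 8 * X powr (1 - \<sigma> / 2 + 7/2 * s)"
    unfolding vaughan_sum[OF True, where V = U and \<phi> = "\<lambda>n. uexp (h n)"]
    by (intro norm_triangle_mono norm_triangle_le_diff add_mono type_I_log type_I_bilinear type_II)
  also have "\<dots> \<le> X powr (1 - \<sigma> / 2 + 4 * s) + X powr (1 - \<sigma> / 2 + 4 * s) + 8 * X powr (1 - \<sigma> / 2 + 4 * s)"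
    using s \<sigma> by (intro add_mono mult_left_mono powr_le) auto
  also have "\<dots> = 10 * X powr (1 - \<sigma> / 2 + 4 * s)" by simp
  also have "\<dots> \<le> X powr s * X powr (1 - \<sigma> / 2 + 4 * s)" using X10 by (intro mult_right_mono) auto
  also have "\<dots> = X powr (1 - \<sigma> / 2 + 5 * s)" by (simp add: algebra_simps flip: powr_add)
  finally show ?thesis .
next
  case False
  \<comment> \<open>U >= X would force X = 1, contradicting 10 <= X^s.\<close>
  have "X powr 1 \<le> real U" using False X0 by simp
  also have "\<dots> \<le> X powr (1/3)" by (rule U_le)
  finally have "X powr 1 * X powr (-1/3) \<le> X powr (1/3) * X powr (-1/3)" by (intro mult_right_mono) auto
  hence "X powr (1 + -1/3) \<le> X powr (1/3 + -1/3)" by (simp only: powr_add)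
  hence "X powr (2/3) \<le> 1" using X0 by simp
  hence "X \<le> 1" using X1 by (smt (verit) gr_one_powr of_nat_le_1_iff zero_less_divide_iff)
  hence "X = 1" using X1 by simp
  hence "X powr s = 1" by simp
  thus ?thesis using X10 by simp
qed

end

section \<open>Exponential sums over primes\<close>

context pseudo_polynomial
begin

lemma mangoldt_block_bound:
  "\<exists>\<sigma> X0. 0 < \<sigma> \<and> \<sigma> \<le> 1/16 \<and> (\<forall>(X::nat) (Y::nat) \<tau>. X0 \<le> real X \<longrightarrow> Y < 2 * X \<longrightarrow>
     X powr (-1/4) \<le> \<bar>\<tau>\<bar> \<longrightarrow> \<bar>\<tau>\<bar> \<le> X powr (1/4) \<longrightarrow>
     norm (\<Sum>n=X..Y. mangoldt n * uexp (\<tau> * f (real n))) \<le> X powr (1 - \<sigma>))"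
proof -
  obtain \<sigma> X0 where \<sigma>: "0 < \<sigma>" "\<sigma> \<le> 1/4" and
    bnd: "\<And>X \<tau> (x::nat) (y::nat) N l n. X0 \<le> X \<Longrightarrow>
     X powr (-1/4) \<le> \<bar>\<tau>\<bar> \<Longrightarrow> \<bar>\<tau>\<bar> \<le> X powr (1/4) \<Longrightarrow> X powr (3/10) \<le> N \<Longrightarrow> y \<le> x \<Longrightarrow>
     X powr (3/4) \<le> (real x - real y) * N \<Longrightarrow> real x * N \<le> 2 * X \<Longrightarrow> N \<le> real l \<Longrightarrow> real (l + n) \<le> 2 * N + 1 \<Longrightarrow>
     norm (\<Sum>j<n. uexp (\<tau> * (f (real x * real (l + j)) - f (real y * real (l + j))))) \<le> N * X powr (-\<sigma>)"
    using phase_exp_sum_bound by blast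
  \<comment> \<open>With this choice the exponent 1 - \<sigma>/2 + 5s of
    \<open>mangoldt_sum_bound\<close> becomes 1 - \<sigma>/4.\<close>
  define s where "s = \<sigma> / 20"
  have s: "s > 0" using \<sigma> by (simp add: s_def)
  have "\<forall>\<^sub>F x::real in at_top. 10 \<le> x powr s" using s by real_asymp
  moreover have "\<forall>\<^sub>F x::real in at_top. 1 + 2 * ln (2 * x) \<le> x powr s" using s by real_asymp
  moreover have "\<forall>\<^sub>F x::real in at_top. 2 * x powr (3/10) \<le> x powr (1/3)" by real_asymp
  moreover have "\<forall>\<^sub>F x::real in at_top. 1 \<le> x" by (rule eventually_ge_at_top)
  moreover have "\<forall>\<^sub>F x::real in at_top. X0 \<le> x" by (rule eventually_ge_at_top)
  ultimately have "\<forall>\<^sub>F x::real in at_top. 10 \<le> x powr s \<and> 1 + 2 * ln (2 * x) \<le> x powr s \<and> 2 * x powr (3/10) \<le> x powr (1/3) \<and> 1 \<le> x \<and> X0 \<le> x" (is "eventually ?P _")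
    by eventually_elim auto
  then obtain X1 where X1: "\<And>x::real. X1 \<le> x \<Longrightarrow> ?P x"
    by (auto simp: eventually_at_top_linorder)
  show ?thesis
  proof (rule exI[of _ "\<sigma>/4"], rule exI[of _ X1], intro conjI allI impI)
    show "0 < \<sigma>/4" "\<sigma>/4 \<le> 1/16" using \<sigma> by auto
    fix X Y :: nat and \<tau> :: real
    assume as: "X1 \<le> real X" "Y < 2 * X" "X powr (-1/4) \<le> \<bar>\<tau>\<bar>" "\<bar>\<tau>\<bar> \<le> X powr (1/4)"
    note X = X1[OF as(1)]
    interpret vaughan_block X Y "\<lambda>n. \<tau> * f (real n)" \<sigma> s
    proof
      fix x y :: nat and N :: real and S :: "nat set"
      assume H: "X powr (3/10) \<le> N" "y \<le> x" "X powr (3/4) \<le> (real x - real y) * N" "real x * N \<le> 2 * real X"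
         "nat_convex S" "finite S" "\<And>j. j \<in> S \<Longrightarrow> N \<le> real j \<and> real j \<le> 2 * N"
      show "norm (\<Sum>j\<in>S. uexp (\<tau> * f (real (x * j)) - \<tau> * f (real (y * j)))) \<le> N * X powr (-\<sigma>)"
      proof (cases "S = {}")
        case True
        have "0 \<le> N" using H(1) powr_ge_zero[of X "3/10"] by linarith
        thus ?thesis using True by simp
      next
        case False
        define l n where "l = Min S" and "n = Suc (Max S) - Min S"
        have S: "S = {l..<l+n}" unfolding l_def n_def by (rule nat_convex_eq_interval[OF H(5,6) False])
        have "n \<noteq> 0" using S False by auto
        \<comment> \<open>The last point l + n - 1 is at most 2N, so l + n <= 2N + 1. This is the
          origin of the + 1 in the earlier range conditions.\<close>
        hence mem: "l \<in> S" "l + n - 1 \<in> S" unfolding S by auto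
        have "(\<Sum>j\<in>S. uexp (\<tau> * f (real (x * j)) - \<tau> * f (real (y * j)))) =
           (\<Sum>j<n. uexp (\<tau> * (f (real x * real (l + j)) - f (real y * real (l + j)))))"
          unfolding S by (rule sum.reindex_bij_witness[of _ "\<lambda>j. l + j" "\<lambda>j. j - l"]) (auto simp: algebra_simps)
        also have "norm \<dots> \<le> N * X powr (-\<sigma>)"
          using as X H(1-4) H(7)[OF mem(1)] H(7)[OF mem(2)] \<open>n \<noteq> 0\<close> by (intro bnd) (auto simp: of_nat_diff)
        finally show ?thesis .
      qed
    qed (use X as \<sigma> s in \<open>auto simp: f_0\<close>)
    have "1 - \<sigma> / 2 + 5 * s = 1 - \<sigma> / 4" by (simp add: s_def)
    thus "norm (\<Sum>n=X..Y. mangoldt n * uexp (\<tau> * f (real n))) \<le> X powr (1 - \<sigma> / 4)"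
      using mangoldt_sum_bound by metis
  qed
qed

text \<open>Dyadic blocks starting at X >= N^(1/2) admit |\<tau>| between X^(-1/4) and X^(1/4),
  hence the whole window given by N^(-1/8) and N^(1/8). Blocks starting lower are short enough for
  the trivial bound.\<close>

lemma mangoldt_exp_sum_bound:
  "\<exists>\<sigma> X0. 0 < \<sigma> \<and> \<sigma> \<le> 1/16 \<and> (\<forall>(N::nat) \<tau>. X0 \<le> real N \<longrightarrow>
     N powr (-1/8) \<le> \<bar>\<tau>\<bar> \<longrightarrow> \<bar>\<tau>\<bar> \<le> N powr (1/8) \<longrightarrow>
     norm (\<Sum>n=1..N. mangoldt n * uexp (\<tau> * f (real n))) \<le> N powr (1 - \<sigma>))"
proof -
  obtain \<sigma> X0 where \<sigma>: "0 < \<sigma>" "\<sigma> \<le> 1/16" and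
    bnd: "\<And>(X::nat) (Y::nat) \<tau>. X0 \<le> real X \<Longrightarrow> Y < 2 * X \<Longrightarrow>
     X powr (-1/4) \<le> \<bar>\<tau>\<bar> \<Longrightarrow> \<bar>\<tau>\<bar> \<le> X powr (1/4) \<Longrightarrow>
     norm (\<Sum>n=X..Y. mangoldt n * uexp (\<tau> * f (real n))) \<le> X powr (1 - \<sigma>)"
    using mangoldt_block_bound by blast
  have "\<forall>\<^sub>F x::real in at_top. log 2 (2 * x) + 1 \<le> x powr (\<sigma>/2)" using \<sigma> by real_asymp
  moreover have "\<forall>\<^sub>F x::real in at_top. x powr (1/2) * ln x \<le> x powr (15/16)" by real_asymp
  moreover have "\<forall>\<^sub>F x::real in at_top. X0 \<le> x powr (1/2)" by real_asymp
  moreover have "\<forall>\<^sub>F x::real in at_top. 1 \<le> x" by (rule eventually_ge_at_top)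
  ultimately have "\<forall>\<^sub>F x::real in at_top. log 2 (2 * x) + 1 \<le> x powr (\<sigma>/2) \<and> x powr (1/2) * ln x \<le> x powr (15/16) \<and> X0 \<le> x powr (1/2) \<and> 1 \<le> x" (is "eventually ?P _")
    by eventually_elim auto
  then obtain X1 where X1: "\<And>x::real. X1 \<le> x \<Longrightarrow> ?P x"
    by (auto simp: eventually_at_top_linorder)
  show ?thesis
  proof (rule exI[of _ "\<sigma>/2"], rule exI[of _ X1], intro conjI allI impI)
    show "0 < \<sigma>/2" "\<sigma>/2 \<le> 1/16" using \<sigma> by auto
    fix N :: nat and \<tau> :: real
    assume as: "X1 \<le> real N" "N powr (-1/8) \<le> \<bar>\<tau>\<bar>" "\<bar>\<tau>\<bar> \<le> N powr (1/8)"
    note N = X1[OF as(1)]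
    define L where "L = nat \<lceil>log 2 (2 * real N)\<rceil>"
    have log0: "log 2 (2 * real N) \<ge> 0" using N by (subst zero_le_log_cancel_iff) auto
    have "real L \<le> log 2 (2 * real N) + 1" using log0 by (simp add: L_def)
    hence L: "real L \<le> N powr (\<sigma>/2)" using N by linarith
    have "2 * real N = 2 powr (log 2 (2 * real N))" using N by simp
    also have "\<dots> \<le> 2 powr real L" using log0 by (intro powr_mono) (auto simp: L_def)
    finally have "2 * real N \<le> real (2 ^ L)" by (simp add: powr_realpow)
    hence "2 * N \<le> 2 ^ L" by (metis of_nat_le_iff of_nat_mult of_nat_numeral)
    hence eq: "{1..N} = {1..N} \<inter> {1..<2^L}" using N by auto
    have block: "norm (\<Sum>n\<in>{1..N} \<inter> {2^i..<2^Suc i}. mangoldt n * uexp (\<tau> * f (real n))) \<le> N powr (1 - \<sigma>)" for i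
    proof (cases "real (2^i) \<ge> N powr (1/2)")
      case big: True
      show ?thesis
      proof (cases "2^i \<le> N")
        case True
        define X where "X = (2::nat)^i"
        define Y where "Y = min N (2 * X - 1)"
        have XN: "1 \<le> real X" "real X \<le> real N" "N powr (1/2) \<le> real X" using True big by (auto simp: X_def)
        have "1 \<le> X" using XN by simp
        hence "{1..N} \<inter> {X..<2*X} = {X..Y}" by (auto simp: Y_def)
        hence "{1..N} \<inter> {2^i..<2^Suc i} = {X..Y}" by (simp add: X_def)
        moreover have "norm (\<Sum>n=X..Y. mangoldt n * uexp (\<tau> * f (real n))) \<le> X powr (1 - \<sigma>)"
        proof (rule bnd)
          show "X0 \<le> real X" using XN N by linarith
          have "X \<ge> 1" using XN by simp
          thus "Y < 2 * X" by (simp add: Y_def)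
          have "X powr (-1/4) \<le> (N powr (1/2)) powr (-1/4)" using XN N by (intro powr_mono2') auto
          also have "\<dots> = N powr (-1/8)" by (simp add: powr_powr)
          finally show "X powr (-1/4) \<le> \<bar>\<tau>\<bar>" using as by linarith
          have "N powr (1/8) = (N powr (1/2)) powr (1/4)" by (simp add: powr_powr)
          also have "\<dots> \<le> X powr (1/4)" using XN N by (intro powr_mono2) auto
          finally show "\<bar>\<tau>\<bar> \<le> X powr (1/4)" using as by linarith
        qed
        moreover have "X powr (1 - \<sigma>) \<le> N powr (1 - \<sigma>)" using XN \<sigma> by (intro powr_mono2) auto
        ultimately show ?thesis by simp
      next
        case False
        hence "{1..N} \<inter> {2^i..<2^Suc i} = {}" by auto
        thus ?thesis by (simp only: sum.empty norm_zero powr_ge_zero)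
      qed
    next
      case False
      have "norm (\<Sum>n\<in>{1..N} \<inter> {2^i..<2^Suc i}. mangoldt n * uexp (\<tau> * f (real n))) \<le> (\<Sum>n\<in>{1..N} \<inter> {2^i..<2^Suc i}. ln (real N))"
      proof (rule sum_norm_le)
        fix n assume n: "n \<in> {1..N} \<inter> {2^i..<2^Suc i}"
        hence "mangoldt n \<le> ln (real n)" by (intro mangoldt_le) auto
        also have "\<dots> \<le> ln (real N)" using n by simp
        finally show "norm (mangoldt n * uexp (\<tau> * f (real n))) \<le> ln (real N)" by (simp add: norm_mult)
      qed
      also have "\<dots> = real (card ({1..N} \<inter> {2^i..<2^Suc i})) * ln (real N)" by simp
      also have "\<dots> \<le> real (2^i) * ln (real N)"
      proof (rule mult_right_mono)
        have "card ({1..N} \<inter> {2^i..<2^Suc i}) \<le> card {(2::nat)^i..<2^Suc i}" by (rule card_mono) auto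
        thus "real (card ({1..N} \<inter> {2^i..<2^Suc i})) \<le> real (2^i)" by (simp only: of_nat_le_iff) simp
      qed (use N in auto)
      also have "\<dots> \<le> N powr (1/2) * ln (real N)" using False N by (intro mult_right_mono) auto
      also have "\<dots> \<le> N powr (15/16)" using N by simp
      also have "\<dots> \<le> N powr (1 - \<sigma>)" using N \<sigma> by (intro powr_mono) auto
      finally show ?thesis .
    qed
    have "norm (\<Sum>n=1..N. mangoldt n * uexp (\<tau> * f (real n))) \<le> real L * N powr (1 - \<sigma>)"
      by (subst eq, rule dyadic_sum_bound, rule block)
    also have "\<dots> \<le> N powr (\<sigma>/2) * N powr (1 - \<sigma>)" using L by (intro mult_right_mono) auto
    also have "\<dots> = N powr (1 - \<sigma>/2)" by (simp add: algebra_simps flip: powr_add)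
    finally show "norm (\<Sum>n=1..N. mangoldt n * uexp (\<tau> * f (real n))) \<le> N powr (1 - \<sigma>/2)" .
  qed
qed

end

section \<open>Chebyshev's lower bound and the removal of prime powers\<close>

lemma ln_fact_eq: "ln (fact n) = (\<Sum>b=1..n. mangoldt b * real (n div b))"
proof -
  have "ln (fact n :: real) = (\<Sum>m=1..n. ln (real m))"
    unfolding fact_prod of_nat_prod by (rule ln_prod) auto
  also have "\<dots> = (\<Sum>m | 1 \<le> 1 * m \<and> 1 * m \<le> n. \<Sum>b | b dvd m \<and> True. mangoldt b)"
    by (intro sum.cong) (auto simp: mangoldt_sum)
  also have "\<dots> = (\<Sum>b | b \<in> {1..n} \<and> True. \<Sum>a | 1 \<le> 1 * (b * a) \<and> 1 * (b * a) \<le> n. mangoldt b)"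
    by (rule sum_over_divisors_swap[where F = "\<lambda>b _. mangoldt b"]) auto
  also have "\<dots> = (\<Sum>b=1..n. mangoldt b * real (n div b))"
  proof (rule sum.cong)
    fix b assume b: "b \<in> {1..n}"
    have "{a. 1 \<le> 1 * (b * a) \<and> 1 * (b * a) \<le> n} = {1..n div b}"
      using b by (auto simp: less_eq_div_iff_mult_less_eq mult.commute Suc_le_eq)
    thus "(\<Sum>a | 1 \<le> 1 * (b * a) \<and> 1 * (b * a) \<le> n. mangoldt b :: real) = mangoldt b * real (n div b)" by simp
  qed auto
  finally show ?thesis .
qed

text \<open>Chebyshev's argument: the logarithm of the central binomial coefficient weights
  \<open>mangoldt b\<close> by \<lfloor>2n/b\<rfloor> - 2\<lfloor>n/b\<rfloor>, which is at most
  1.\<close>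

lemma mangoldt_sum_lower:
  assumes "0 < n"
  shows "real n * ln 4 - ln (2 * real n) \<le> (\<Sum>b=1..2*n. mangoldt b)"
proof -
  have ext: "(\<Sum>b=1..n. mangoldt b * real (n div b)) = (\<Sum>b=1..2*n. mangoldt b * real (n div b))"
    by (rule sum.mono_neutral_left) auto
  have "4 ^ n / (2 * real n) \<le> real ((2*n) choose n)" using assms by (intro central_binomial_lower_bound) auto
  hence "ln (4 ^ n / (2 * real n)) \<le> ln (real ((2*n) choose n))"
    using assms by (subst ln_le_cancel_iff) auto
  also have "ln (4 ^ n / (2 * real n)) = real n * ln 4 - ln (2 * real n)"
    using assms by (simp add: ln_div ln_realpow)
  also have "real ((2*n) choose n) = fact (2*n) / (fact n * fact n)"
    by (simp add: binomial_fact)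
  also have "ln \<dots> = ln (fact (2*n)) - 2 * ln (fact n)"
    by (simp add: ln_div ln_mult)
  also have "\<dots> = (\<Sum>b=1..2*n. mangoldt b * (real ((2*n) div b) - 2 * real (n div b)))"
    unfolding ln_fact_eq ext by (simp add: algebra_simps sum_subtractf sum_distrib_left)
  also have "\<dots> \<le> (\<Sum>b=1..2*n. mangoldt b * 1)"
  proof (intro sum_mono mult_left_mono mangoldt_nonneg)
    fix b assume b: "b \<in> {1..2*n}"
    have "n mod b < b" using b by simp
    hence "n < b * (n div b) + b" using mult_div_mod_eq[of b n] by linarith
    hence "2 * n < b * (2 * (n div b) + 2)" by (simp add: algebra_simps)
    hence "2 * n div b < 2 * (n div b) + 2" using b by (simp add: div_less_iff_less_mult mult.commute)
    hence "2 * n div b \<le> 2 * (n div b) + 1" by simp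
    hence "real (2 * n div b) \<le> real (2 * (n div b) + 1)" by (rule of_nat_mono)
    thus "real ((2*n) div b) - 2 * real (n div b) \<le> 1" by simp
  qed
  finally show ?thesis by simp
qed

text \<open>A contributing n is p^k with k >= 2, so p <= sqrt N and k <= log 2 N. Counting the pairs
  (p, k) suffices.\<close>

lemma mangoldt_nonprime_sum_le:
  fixes N :: nat
  assumes "1 \<le> N"
  shows "(\<Sum>n\<in>{n\<in>{1..N}. \<not> prime n}. mangoldt n) \<le> sqrt N * (log 2 N + 1) * ln N"
proof -
  define Q where "Q = {n\<in>{1..N}. primepow n \<and> \<not> prime n}"
  define r L where "r = nat \<lfloor>sqrt N\<rfloor>" and "L = nat \<lfloor>log 2 N\<rfloor>"
  have "Q \<subseteq> (\<lambda>(p,k). p ^ k) ` ({1..r} \<times> {0..L})"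
  proof
    fix n assume n: "n \<in> Q"
    then obtain p k where pk: "prime p" "0 < k" "n = p ^ k" by (auto simp: Q_def primepow_def)
    have "k \<noteq> 1" using n pk by (auto simp: Q_def)
    hence k2: "2 \<le> k" using pk by simp
    have p2: "2 \<le> p" by (rule prime_ge_2_nat[OF pk(1)])
    have nN: "p ^ k \<le> N" using n pk by (simp add: Q_def)
    have "p ^ 2 \<le> p ^ k" using k2 p2 by (intro power_increasing) auto
    hence "real (p ^ 2) \<le> real N" using nN by (intro of_nat_mono) simp
    hence "real p \<le> sqrt N" by (intro real_le_rsqrt) simp
    hence "p \<le> r" by (simp add: r_def le_nat_floor)
    moreover have "(2::nat) ^ k \<le> p ^ k" using p2 by (intro power_mono) auto
    hence "real (2 ^ k) \<le> real N" using nN by (intro of_nat_mono) simp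
    hence "2 powr real k \<le> real N" by (simp add: powr_realpow)
    hence "real k \<le> log 2 N" using assms by (subst le_log_iff) auto
    hence "k \<le> L" by (simp add: L_def le_nat_floor)
    ultimately show "n \<in> (\<lambda>(p,k). p ^ k) ` ({1..r} \<times> {0..L})" using pk p2 by (auto intro!: image_eqI[of _ _ "(p,k)"])
  qed
  hence "card Q \<le> card ((\<lambda>(p,k). p ^ k) ` ({1..r} \<times> {0..L}))" by (intro card_mono) auto
  also have "\<dots> \<le> card ({1..r} \<times> {0..L})" by (rule card_image_le) auto
  also have "\<dots> = r * (L + 1)" by (simp add: card_cartesian_product)
  finally have "real (card Q) \<le> real (r * (L + 1))" by (rule of_nat_mono)
  also have "\<dots> = real r * (real L + 1)" by (simp add: algebra_simps)
  also have "\<dots> \<le> sqrt N * (log 2 N + 1)"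
    using assms by (intro mult_mono) (auto simp: r_def L_def)
  finally have card: "real (card Q) \<le> sqrt N * (log 2 N + 1)" .
  have "(\<Sum>n\<in>{n\<in>{1..N}. \<not> prime n}. mangoldt n :: real) = (\<Sum>n\<in>Q. mangoldt n)"
    by (rule sum.mono_neutral_right) (auto simp: Q_def mangoldt_def)
  also have "\<dots> \<le> (\<Sum>n\<in>Q. ln N)"
  proof (rule sum_mono)
    fix n assume n: "n \<in> Q"
    hence "mangoldt n \<le> ln (real n)" by (intro mangoldt_le) (auto simp: Q_def)
    also have "\<dots> \<le> ln (real N)" using n by (auto simp: Q_def)
    finally show "mangoldt n \<le> ln (real N)" .
  qed
  also have "\<dots> = real (card Q) * ln N" by simp
  also have "\<dots> \<le> sqrt N * (log 2 N + 1) * ln N" using card assms by (intro mult_right_mono) auto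
  finally show ?thesis .
qed

lemma split_prime_sum:
  fixes \<phi> :: "nat \<Rightarrow> 'a :: real_normed_field"
  shows "(\<Sum>n=1..N. mangoldt n * \<phi> n) = (\<Sum>p | prime p \<and> p \<le> N. of_real (ln (real p)) * \<phi> p)
     + (\<Sum>n\<in>{n\<in>{1..N}. \<not> prime n}. mangoldt n * \<phi> n)"
proof -
  have eq: "{1..N} = {p. prime p \<and> p \<le> N} \<union> {n\<in>{1..N}. \<not> prime n}"
    by (auto dest: prime_gt_0_nat simp: Suc_le_eq)
  have "(\<Sum>n=1..N. mangoldt n * \<phi> n) = (\<Sum>n\<in>{p. prime p \<and> p \<le> N} \<union> {n\<in>{1..N}. \<not> prime n}. mangoldt n * \<phi> n)"
    by (rule sum.cong[OF eq refl])
  also have "\<dots> = (\<Sum>p | prime p \<and> p \<le> N. mangoldt p * \<phi> p) + (\<Sum>n\<in>{n\<in>{1..N}. \<not> prime n}. mangoldt n * \<phi> n)"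
    by (rule sum.union_disjoint) auto
  also have "(\<Sum>p | prime p \<and> p \<le> N. mangoldt p * \<phi> p) = (\<Sum>p | prime p \<and> p \<le> N. of_real (ln (real p)) * \<phi> p)"
    by (rule sum.cong) auto
  finally show ?thesis .
qed

context pseudo_polynomial
begin

text \<open>The saving is stated relative to the total weight of the primes, the form in which the
  mean value arguments use it. This requires the total weight to be at least a constant multiple of
  N.\<close>

lemma prime_exp_sum_bound:
  "\<exists>\<sigma> X0. 0 < \<sigma> \<and> \<sigma> \<le> 1/8 \<and> (\<forall>N::nat. X0 \<le> real N \<longrightarrow> 0 < (\<Sum>p | prime p \<and> p \<le> N. ln (real p)) \<and>
     (\<forall>\<tau>. N powr (-1/8) \<le> \<bar>\<tau>\<bar> \<longrightarrow> \<bar>\<tau>\<bar> \<le> N powr (1/8) \<longrightarrow>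
     norm (\<Sum>p | prime p \<and> p \<le> N. of_real (ln (real p)) * uexp (\<tau> * f (real p)))
        \<le> N powr (-\<sigma>) * (\<Sum>p | prime p \<and> p \<le> N. ln (real p))))"
proof -
  obtain \<sigma> X0 where \<sigma>: "0 < \<sigma>" "\<sigma> \<le> 1/16" and
    bnd: "\<And>(N::nat) \<tau>. X0 \<le> real N \<Longrightarrow> N powr (-1/8) \<le> \<bar>\<tau>\<bar> \<Longrightarrow> \<bar>\<tau>\<bar> \<le> N powr (1/8) \<Longrightarrow>
     norm (\<Sum>n=1..N. mangoldt n * uexp (\<tau> * f (real n))) \<le> N powr (1 - \<sigma>)"
    using mangoldt_exp_sum_bound by blast
  have "\<forall>\<^sub>F x::real in at_top. sqrt x * (log 2 x + 1) * ln x \<le> x powr (3/4)" by real_asymp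
  moreover have "\<forall>\<^sub>F x::real in at_top. x / 4 \<le> ((x - 1) / 2) * (4/3) - ln x" by real_asymp
  moreover have "\<forall>\<^sub>F x::real in at_top. x powr (3/4) \<le> x / 8" by real_asymp
  moreover have "\<forall>\<^sub>F x::real in at_top. 16 \<le> x powr (\<sigma>/2)" using \<sigma> by real_asymp
  moreover have "\<forall>\<^sub>F x::real in at_top. max X0 2 \<le> x" by (rule eventually_ge_at_top)
  ultimately have "\<forall>\<^sub>F x::real in at_top. sqrt x * (log 2 x + 1) * ln x \<le> x powr (3/4) \<and> x / 4 \<le> ((x - 1) / 2) * (4/3) - ln x \<and>
     x powr (3/4) \<le> x / 8 \<and> 16 \<le> x powr (\<sigma>/2) \<and> max X0 2 \<le> x" (is "eventually ?P _")
    by eventually_elim auto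
  then obtain X1 where X1: "\<And>x::real. X1 \<le> x \<Longrightarrow> ?P x"
    by (auto simp: eventually_at_top_linorder)
  show ?thesis
  proof (rule exI[of _ "\<sigma>/2"], rule exI[of _ X1], intro conjI allI impI)
    show "0 < \<sigma>/2" "\<sigma>/2 \<le> 1/8" using \<sigma> by auto
    fix N :: nat
    assume "X1 \<le> real N"
    note N = X1[OF this]
    define W where "W = (\<Sum>p | prime p \<and> p \<le> N. ln (real p))"
    have N2: "2 \<le> N" using N by simp
    have np: "(\<Sum>n\<in>{n\<in>{1..N}. \<not> prime n}. mangoldt n) \<le> N powr (3/4)"
      using mangoldt_nonprime_sum_le[of N] N N2 by linarith
    have W8: "real N / 8 \<le> W"
    proof -
      define n where "n = N div 2"
      have n: "0 < n" "2 * n \<le> N" "N \<le> 2 * n + 1" using N2 by (auto simp: n_def)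
      have "real N \<le> real (2 * n + 1)" using n by (intro of_nat_mono)
      hence n': "(real N - 1) / 2 \<le> real n" by simp
      have "ln (4::real) = ln (2 ^ 2)" by simp
      also have "\<dots> = 2 * ln 2" by (subst ln_realpow) auto
      finally have ln4: "4/3 \<le> ln (4::real)" using ln2_ge_two_thirds by simp
      have "real N / 4 \<le> ((real N - 1) / 2) * (4/3) - ln N" using N by simp
      also have "\<dots> \<le> real n * ln 4 - ln (2 * real n)"
      proof (rule diff_mono)
        show "(real N - 1) / 2 * (4/3) \<le> real n * ln 4" using n' ln4 N2 by (intro mult_mono) auto
        have "real (2 * n) \<le> real N" using n by (intro of_nat_mono)
        thus "ln (2 * real n) \<le> ln (real N)" using n by (subst ln_le_cancel_iff) auto
      qed
      also have "\<dots> \<le> (\<Sum>b=1..2*n. mangoldt b)" by (rule mangoldt_sum_lower) (use n in auto)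
      also have "\<dots> \<le> (\<Sum>b=1..N. mangoldt b)" using n by (intro sum_mono2) (auto simp: mangoldt_nonneg)
      also have "\<dots> = W + (\<Sum>n\<in>{n\<in>{1..N}. \<not> prime n}. mangoldt n)"
        using split_prime_sum[of "\<lambda>_. 1::real" N] by (simp add: W_def)
      also have "\<dots> \<le> W + real N / 8" using np N by simp
      finally show ?thesis by simp
    qed
    thus "0 < (\<Sum>p | prime p \<and> p \<le> N. ln (real p))" using N2 by (simp add: W_def)
    fix \<tau> assume \<tau>: "N powr (-1/8) \<le> \<bar>\<tau>\<bar>" "\<bar>\<tau>\<bar> \<le> N powr (1/8)"
    define Z where "Z = (\<Sum>n\<in>{n\<in>{1..N}. \<not> prime n}. mangoldt n * uexp (\<tau> * f (real n)))"
    have "norm Z \<le> (\<Sum>n\<in>{n\<in>{1..N}. \<not> prime n}. mangoldt n)"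
      unfolding Z_def by (rule sum_norm_le) (simp add: norm_mult)
    also have "\<dots> \<le> N powr (3/4)" by (rule np)
    also have "\<dots> \<le> N powr (1 - \<sigma>)" using \<sigma> N2 by (intro powr_mono) auto
    finally have Z: "norm Z \<le> N powr (1 - \<sigma>)" .
    have "(\<Sum>p | prime p \<and> p \<le> N. of_real (ln (real p)) * uexp (\<tau> * f (real p))) = (\<Sum>n=1..N. mangoldt n * uexp (\<tau> * f (real n))) - Z"
      unfolding split_prime_sum Z_def by simp
    also have "norm \<dots> \<le> N powr (1 - \<sigma>) + N powr (1 - \<sigma>)"
      using N \<tau> Z by (intro order_trans[OF norm_triangle_ineq4] add_mono bnd) auto
    also have "N powr (1 - \<sigma>) = real N * N powr (-\<sigma>)"
      using powr_mult_base[of "real N" "-\<sigma>"] by simp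
    \<comment> \<open>Two errors of size N^(1-\<sigma>), measured against a weight of at least N/8,
      give the factor 16, which half of the saving absorbs.\<close>
    also have "real N * N powr (-\<sigma>) + real N * N powr (-\<sigma>) = 16 * (N powr (-\<sigma>) * (real N / 8))" by simp
    also have "\<dots> \<le> N powr (\<sigma>/2) * (N powr (-\<sigma>) * W)" using N W8 by (intro mult_mono) auto
    also have "\<dots> = N powr (\<sigma>/2 + -\<sigma>) * W" by (simp only: powr_add mult.assoc)
    also have "\<dots> = N powr (-(\<sigma>/2)) * W" by simp
    finally show "norm (\<Sum>p | prime p \<and> p \<le> N. of_real (ln (real p)) * uexp (\<tau> * f (real p))) \<le> N powr (-(\<sigma>/2)) * (\<Sum>p | prime p \<and> p \<le> N. ln (real p))"
      by (simp add: W_def)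
  qed
qed

end

section \<open>Fejer kernels\<close>

text \<open>K times the classical Fejer kernel: its constant Fourier coefficient is K and its
  frequencies are the integers k with |k| < K.\<close>

definition fejer :: "nat \<Rightarrow> real \<Rightarrow> real" where
  "fejer K y = (norm (\<Sum>j<K. uexp (real j * y)))\<^sup>2"

lemma fejer_nonneg: "0 \<le> fejer K y"
  by (simp add: fejer_def)

lemma dist_nint_le: "dist_nint x \<le> \<bar>x - of_int m\<bar>"
  unfolding dist_nint_def by (rule round_diff_minimal)

lemma dist_nint_add_int: "dist_nint (x + of_int m) = dist_nint x"
proof -
  have *: "dist_nint (x + of_int m) \<le> dist_nint x" for x m
    using dist_nint_le[of "x + of_int m" "round x + m"] by (simp add: dist_nint_def)
  show ?thesis using *[of x m] *[of "x + of_int m" "-m"] by simp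
qed

lemma fejer_le:
  assumes "0 < \<delta>" "\<delta> \<le> dist_nint y"
  shows "fejer K y \<le> 1 / \<delta>\<^sup>2"
proof -
  define c where "c = y - of_int (round y)"
  have c: "\<delta> \<le> \<bar>c\<bar>" using assms by (simp add: c_def dist_nint_def)
  have half: "\<bar>c\<bar> \<le> 1/2" using of_int_round_abs_le[of y] by (simp add: c_def abs_minus_commute)
  have "uexp (real j * y) = uexp (0 + real j * c)" for j
  proof -
    have "real j * y = real j * c + of_int (int j * round y)" by (simp add: c_def algebra_simps)
    thus ?thesis by (simp only: uexp_add uexp_of_int) simp
  qed
  hence "norm (\<Sum>j<K. uexp (real j * y)) \<le> 1 / \<bar>c\<bar>"
    using norm_sum_uexp_linear_le[of c 0 K] c half assms by auto
  also have "\<dots> \<le> 1 / \<delta>" using c assms by (intro divide_left_mono) auto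
  finally have "fejer K y \<le> (1 / \<delta>)\<^sup>2" unfolding fejer_def by (intro power_mono) auto
  thus ?thesis by (simp add: power_divide)
qed

text \<open>The diagonal contributes card I * W, every other pair at most \<omega> * W. The index
  set is arbitrary so that one- and two-dimensional kernels are both covered.\<close>

lemma mean_square_exp_sum:
  fixes w :: "'p \<Rightarrow> real" and u :: "'i \<Rightarrow> 'p \<Rightarrow> real"
  assumes I: "finite I" and P: "finite P" and W: "W = (\<Sum>p\<in>P. w p)"
    and off: "\<And>i i'. i \<in> I \<Longrightarrow> i' \<in> I \<Longrightarrow> i \<noteq> i' \<Longrightarrow> norm (\<Sum>p\<in>P. of_real (w p) * uexp (u i p - u i' p)) \<le> \<omega> * W"
    and "0 \<le> \<omega> * W"
  shows "\<bar>(\<Sum>p\<in>P. w p * (norm (\<Sum>i\<in>I. uexp (u i p)))\<^sup>2) - real (card I) * W\<bar> \<le> (real (card I))\<^sup>2 * (\<omega> * W)"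
proof -
  have "complex_of_real (\<Sum>p\<in>P. w p * (norm (\<Sum>i\<in>I. uexp (u i p)))\<^sup>2) = (\<Sum>p\<in>P. \<Sum>i\<in>I. \<Sum>i'\<in>I. of_real (w p) * uexp (u i p - u i' p))"
    unfolding of_real_sum of_real_mult complex_norm_square cnj_sum sum_product uexp_mult_cnj
    unfolding sum_distrib_left ..
  also have "\<dots> = (\<Sum>i\<in>I. \<Sum>i'\<in>I. \<Sum>p\<in>P. of_real (w p) * uexp (u i p - u i' p))"
    by (subst sum.swap, rule sum.cong[OF refl], rule sum.swap)
  finally have eq: "complex_of_real (\<Sum>p\<in>P. w p * (norm (\<Sum>i\<in>I. uexp (u i p)))\<^sup>2) = \<dots>" .
  have "(\<Sum>i\<in>I. \<Sum>i'\<in>I. if i = i' then complex_of_real W else 0) = of_real (real (card I) * W)"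
    using I by simp
  hence "complex_of_real ((\<Sum>p\<in>P. w p * (norm (\<Sum>i\<in>I. uexp (u i p)))\<^sup>2) - real (card I) * W)
     = (\<Sum>i\<in>I. \<Sum>i'\<in>I. (\<Sum>p\<in>P. of_real (w p) * uexp (u i p - u i' p)) - (if i = i' then complex_of_real W else 0))"
    unfolding of_real_diff eq sum_subtractf by simp
  also have "norm \<dots> \<le> (\<Sum>i\<in>I. \<Sum>i'\<in>I. \<omega> * W)"
  proof (rule sum_norm_le, rule sum_norm_le)
    fix i i' assume "i \<in> I" "i' \<in> I"
    thus "norm ((\<Sum>p\<in>P. of_real (w p) * uexp (u i p - u i' p)) - (if i = i' then complex_of_real W else 0)) \<le> \<omega> * W"
      using off[of i i'] assms(5) by (cases "i = i'") (auto simp: W)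
  qed
  also have "\<dots> = (real (card I))\<^sup>2 * (\<omega> * W)" by (simp add: power2_eq_square)
  finally show ?thesis by (simp only: norm_of_real)
qed

lemma fejer_mean:
  fixes w y :: "'p \<Rightarrow> real"
  assumes P: "finite P" and W: "W = (\<Sum>p\<in>P. w p)" "0 \<le> \<omega> * W"
    and off: "\<And>k::int. k \<noteq> 0 \<Longrightarrow> \<bar>k\<bar> < int K \<Longrightarrow> norm (\<Sum>p\<in>P. of_real (w p) * uexp (of_int k * y p)) \<le> \<omega> * W"
  shows "\<bar>(\<Sum>p\<in>P. w p * fejer K (y p)) - real K * W\<bar> \<le> (real K)\<^sup>2 * (\<omega> * W)"
proof -
  have "\<bar>(\<Sum>p\<in>P. w p * (norm (\<Sum>i<K. uexp (real i * y p)))\<^sup>2) - real (card {..<K}) * W\<bar> \<le> (real (card {..<K}))\<^sup>2 * (\<omega> * W)"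
  proof (rule mean_square_exp_sum)
    fix i i' assume "i \<in> {..<K}" "i' \<in> {..<K}" "i \<noteq> i'"
    hence "norm (\<Sum>p\<in>P. of_real (w p) * uexp (of_int (int i - int i') * y p)) \<le> \<omega> * W" by (intro off) auto
    thus "norm (\<Sum>p\<in>P. of_real (w p) * uexp (real i * y p - real i' * y p)) \<le> \<omega> * W" by (simp add: algebra_simps)
  qed (use P W in auto)
  thus ?thesis by (simp add: fejer_def)
qed

text \<open>If all points were \<delta>-far from the integers, the weighted kernel sum would be at
  most W / \<delta>^2 <= K * W / 2. The exponential sums force it to be at least 3/4 * K *
  W.\<close>

lemma fejer_hit:
  fixes w y :: "'p \<Rightarrow> real"
  assumes P: "finite P" and W: "W = (\<Sum>p\<in>P. w p)" "0 < W" "\<And>p. p \<in> P \<Longrightarrow> 0 \<le> w p"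
    and off: "\<And>k::int. k \<noteq> 0 \<Longrightarrow> \<bar>k\<bar> < int K \<Longrightarrow> norm (\<Sum>p\<in>P. of_real (w p) * uexp (of_int k * y p)) \<le> \<omega> * W"
    and \<delta>: "0 < \<delta>" "2 / \<delta>\<^sup>2 \<le> real K" and \<omega>: "0 \<le> \<omega>" "real K * \<omega> \<le> 1/4"
  shows "\<exists>p\<in>P. dist_nint (y p) < \<delta>"
proof (rule ccontr)
  assume "\<not> (\<exists>p\<in>P. dist_nint (y p) < \<delta>)"
  hence far: "\<delta> \<le> dist_nint (y p)" if "p \<in> P" for p using that by force
  have K0: "0 < real K" using \<delta> by (smt (verit) divide_pos_pos zero_less_power)
  have "real K * W - (real K)\<^sup>2 * (\<omega> * W) \<le> (\<Sum>p\<in>P. w p * fejer K (y p))"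
  proof -
    have "\<bar>(\<Sum>p\<in>P. w p * fejer K (y p)) - real K * W\<bar> \<le> (real K)\<^sup>2 * (\<omega> * W)"
      using \<omega> W(2) by (intro fejer_mean P W(1) off mult_nonneg_nonneg) auto
    thus ?thesis by linarith
  qed
  also have "\<dots> \<le> (\<Sum>p\<in>P. w p * (1 / \<delta>\<^sup>2))"
    using W \<delta> far by (intro sum_mono mult_left_mono fejer_le) auto
  also have "\<dots> = W * (1 / \<delta>\<^sup>2)" unfolding W(1) by (rule sum_distrib_right[symmetric])
  also have "\<dots> \<le> W * (real K / 2)" using W \<delta> by (intro mult_left_mono) auto
  finally have "real K * W - (real K)\<^sup>2 * (\<omega> * W) \<le> W * (real K / 2)" .
  hence "(real K * W) * (1 - real K * \<omega>) \<le> (real K * W) * (1/2)" by (simp add: power2_eq_square algebra_simps)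
  hence "1 - real K * \<omega> \<le> 1/2" using K0 W by (subst (asm) mult_le_cancel_left_pos) auto
  thus False using \<omega> by simp
qed

text \<open>A point outside the box is far from the integers in one coordinate; there that Fejer kernel is
  small, and the mean of the other one is controlled by \<open>fejer_mean\<close>.\<close>

lemma fejer_hit2:
  fixes w y z :: "'p \<Rightarrow> real"
  assumes P: "finite P" and W: "W = (\<Sum>p\<in>P. w p)" "0 < W" "\<And>p. p \<in> P \<Longrightarrow> 0 \<le> w p"
    and off: "\<And>k l::int. k \<noteq> 0 \<or> l \<noteq> 0 \<Longrightarrow> \<bar>k\<bar> < int K \<Longrightarrow> \<bar>l\<bar> < int K \<Longrightarrow>
       norm (\<Sum>p\<in>P. of_real (w p) * uexp (of_int k * y p + of_int l * z p)) \<le> \<omega> * W"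
    and \<delta>: "0 < \<delta>" "4 / \<delta>\<^sup>2 \<le> real K" and \<omega>: "0 \<le> \<omega>" "(real K)\<^sup>2 * \<omega> \<le> 1/4"
  shows "\<exists>p\<in>P. dist_nint (y p) < \<delta> \<and> dist_nint (z p) < \<delta>"
proof (rule ccontr)
  assume "\<not> (\<exists>p\<in>P. dist_nint (y p) < \<delta> \<and> dist_nint (z p) < \<delta>)"
  hence far: "\<delta> \<le> dist_nint (y p) \<or> \<delta> \<le> dist_nint (z p)" if "p \<in> P" for p using that by force
  have K0: "0 < real K" using \<delta> by (smt (verit) divide_pos_pos zero_less_power)
  hence K1: "1 \<le> real K" by simp
  have \<omega>W: "0 \<le> \<omega> * W" using \<omega> W by simp
  define I where "I = {..<K} \<times> {..<K}"
  have cI: "real (card I) = (real K)\<^sup>2" by (simp add: I_def card_cartesian_product power2_eq_square)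
  have prod: "(norm (\<Sum>i\<in>I. uexp (real (fst i) * y p + real (snd i) * z p)))\<^sup>2 = fejer K (y p) * fejer K (z p)" for p
  proof -
    have "(\<Sum>i\<in>I. uexp (real (fst i) * y p + real (snd i) * z p)) = (\<Sum>j<K. uexp (real j * y p)) * (\<Sum>j<K. uexp (real j * z p))"
      unfolding sum_product sum.cartesian_product I_def by (rule sum.cong) (auto simp: uexp_add)
    thus ?thesis by (simp add: fejer_def norm_mult power_mult_distrib)
  qed
  have "\<bar>(\<Sum>p\<in>P. w p * (norm (\<Sum>i\<in>I. uexp (real (fst i) * y p + real (snd i) * z p)))\<^sup>2) - real (card I) * W\<bar> \<le> (real (card I))\<^sup>2 * (\<omega> * W)"
  proof (rule mean_square_exp_sum)
    fix i i' assume i: "i \<in> I" "i' \<in> I" "i \<noteq> i'"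
    hence "norm (\<Sum>p\<in>P. of_real (w p) * uexp (of_int (int (fst i) - int (fst i')) * y p + of_int (int (snd i) - int (snd i')) * z p)) \<le> \<omega> * W"
      by (intro off) (auto simp: I_def prod_eq_iff)
    thus "norm (\<Sum>p\<in>P. of_real (w p) * uexp (real (fst i) * y p + real (snd i) * z p - (real (fst i') * y p + real (snd i') * z p))) \<le> \<omega> * W"
      by (simp add: algebra_simps)
  qed (use P W \<omega>W in \<open>auto simp: I_def\<close>)
  hence low: "(real K)\<^sup>2 * W - ((real K)\<^sup>2)\<^sup>2 * (\<omega> * W) \<le> (\<Sum>p\<in>P. w p * (fejer K (y p) * fejer K (z p)))"
    unfolding prod cI by linarith
  have y: "(\<Sum>p\<in>P. w p * fejer K (y p)) \<le> real K * W + (real K)\<^sup>2 * (\<omega> * W)"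
  proof -
    have "\<bar>(\<Sum>p\<in>P. w p * fejer K (y p)) - real K * W\<bar> \<le> (real K)\<^sup>2 * (\<omega> * W)"
      using off[of _ 0] K0 by (intro fejer_mean P W \<omega>W) auto
    thus ?thesis by linarith
  qed
  have z: "(\<Sum>p\<in>P. w p * fejer K (z p)) \<le> real K * W + (real K)\<^sup>2 * (\<omega> * W)"
  proof -
    have "\<bar>(\<Sum>p\<in>P. w p * fejer K (z p)) - real K * W\<bar> \<le> (real K)\<^sup>2 * (\<omega> * W)"
      using off[of 0] K0 by (intro fejer_mean P W \<omega>W) auto
    thus ?thesis by linarith
  qed
  have "(\<Sum>p\<in>P. w p * (fejer K (y p) * fejer K (z p))) \<le> (\<Sum>p\<in>P. (w p * fejer K (y p) + w p * fejer K (z p)) * (1 / \<delta>\<^sup>2))"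
  proof (rule sum_mono)
    fix p assume p: "p \<in> P"
    have "fejer K (y p) * fejer K (z p) \<le> (fejer K (y p) + fejer K (z p)) * (1 / \<delta>\<^sup>2)"
      using far[OF p]
    proof
      assume "\<delta> \<le> dist_nint (y p)"
      hence "fejer K (y p) * fejer K (z p) \<le> (1 / \<delta>\<^sup>2) * fejer K (z p)" using \<delta> by (intro mult_right_mono fejer_le fejer_nonneg)
      also have "\<dots> \<le> (fejer K (y p) + fejer K (z p)) * (1 / \<delta>\<^sup>2)" using fejer_nonneg[of K "y p"] by (simp add: algebra_simps)
      finally show ?thesis .
    next
      assume "\<delta> \<le> dist_nint (z p)"
      hence "fejer K (y p) * fejer K (z p) \<le> fejer K (y p) * (1 / \<delta>\<^sup>2)" using \<delta> by (intro mult_left_mono fejer_le fejer_nonneg)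
      also have "\<dots> \<le> (fejer K (y p) + fejer K (z p)) * (1 / \<delta>\<^sup>2)" using fejer_nonneg[of K "z p"] by (simp add: algebra_simps)
      finally show ?thesis .
    qed
    hence "w p * (fejer K (y p) * fejer K (z p)) \<le> w p * ((fejer K (y p) + fejer K (z p)) * (1 / \<delta>\<^sup>2))"
      using W p by (intro mult_left_mono) auto
    thus "w p * (fejer K (y p) * fejer K (z p)) \<le> (w p * fejer K (y p) + w p * fejer K (z p)) * (1 / \<delta>\<^sup>2)"
      by (simp add: distrib_left)
  qed
  also have "\<dots> = ((\<Sum>p\<in>P. w p * fejer K (y p)) + (\<Sum>p\<in>P. w p * fejer K (z p))) * (1 / \<delta>\<^sup>2)"
    by (simp only: sum.distrib[symmetric] sum_distrib_right)
  also have "\<dots> \<le> (2 * (real K * W + (real K)\<^sup>2 * (\<omega> * W))) * (real K / 4)"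
    using y z \<delta> W \<omega>W by (intro mult_mono) auto
  \<comment> \<open>The two one-dimensional sums are each about K * W, and 1 / \<delta>^2 <= K/4, so
    the right side is about K^2 * W / 2. The left side is about K^2 * W; the terms in \<omega> are
    too small to close the gap.\<close>
  finally have "(real K)\<^sup>2 * W - ((real K)\<^sup>2)\<^sup>2 * (\<omega> * W) \<le> (2 * (real K * W + (real K)\<^sup>2 * (\<omega> * W))) * (real K / 4)"
    using low by linarith
  hence "((real K)\<^sup>2 * W) * (1 - (real K)\<^sup>2 * \<omega>) \<le> ((real K)\<^sup>2 * W) * (1/2 + real K * \<omega> / 2)"
    by (simp add: power2_eq_square algebra_simps)
  hence "1 - (real K)\<^sup>2 * \<omega> \<le> 1/2 + real K * \<omega> / 2" using K0 W by (subst (asm) mult_le_cancel_left_pos) auto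
  moreover have "real K * \<omega> \<le> (real K)\<^sup>2 * \<omega>" using K1 \<omega> by (intro mult_right_mono) (auto simp: power2_eq_square)
  ultimately show False using \<omega> by linarith
qed

section \<open>Diophantine approximation\<close>

context pseudo_polynomial
begin

definition prime_weight :: "nat \<Rightarrow> real" where
  "prime_weight N = (\<Sum>p | prime p \<and> p \<le> N. ln (real p))"

text \<open>\<lfloor>f(p)\<rfloor> is a multiple of q exactly when f(p)/q exceeds an integer by less
  than 1/q. Shifting by \<delta> = 1/(2q) centres this window, leaving only a phase factor of
  modulus 1, and K = 8q^2 is exactly 2/\<delta>^2. The frequencies k/q lie between 1/q and 8q^2 in
  absolute value.\<close>

lemma hit_multiple:
  fixes M :: nat and q :: int
  assumes W: "0 < prime_weight M"
    and exp: "\<And>\<tau>. M powr (-1/8) \<le> \<bar>\<tau>\<bar> \<Longrightarrow> \<bar>\<tau>\<bar> \<le> M powr (1/8) \<Longrightarrow>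
      norm (\<Sum>p | prime p \<and> p \<le> M. of_real (ln (real p)) * uexp (\<tau> * f (real p))) \<le> \<omega> * prime_weight M"
    and q: "0 < q" "M powr (-1/8) \<le> 1 / real_of_int q" "8 * (real_of_int q)\<^sup>2 \<le> M powr (1/8)"
      "0 \<le> \<omega>" "8 * (real_of_int q)\<^sup>2 * \<omega> \<le> 1/4"
  shows "\<exists>p m. prime p \<and> p \<le> M \<and> \<lfloor>f (real p)\<rfloor> = q * m"
proof -
  define K where "K = nat (8 * q^2)"
  have K: "real K = 8 * (real_of_int q)\<^sup>2" "int K = 8 * q^2" by (auto simp: K_def)
  define \<delta> where "\<delta> = 1 / (2 * real_of_int q)"
  define y where "y = (\<lambda>p::nat. f (real p) / of_int q - \<delta>)"
  have "\<exists>p\<in>{p. prime p \<and> p \<le> M}. dist_nint (y p) < \<delta>"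
  proof (rule fejer_hit)
    show "prime_weight M = (\<Sum>p | prime p \<and> p \<le> M. ln (real p))" by (rule prime_weight_def)
    show "0 < \<delta>" using q by (simp add: \<delta>_def)
    show "2 / \<delta>\<^sup>2 \<le> real K" by (simp add: \<delta>_def K power_divide power_mult_distrib)
    show "real K * \<omega> \<le> 1/4" using q by (simp add: K)
    fix k :: int assume k: "k \<noteq> 0" "\<bar>k\<bar> < int K"
    define \<tau> where "\<tau> = real_of_int k / real_of_int q"
    have "(\<Sum>p | prime p \<and> p \<le> M. of_real (ln (real p)) * uexp (of_int k * y p)) =
      uexp (- (of_int k * \<delta>)) * (\<Sum>p | prime p \<and> p \<le> M. of_real (ln (real p)) * uexp (\<tau> * f (real p)))"
      unfolding sum_distrib_left
    proof (rule sum.cong[OF refl])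
      fix p :: nat
      have "of_int k * y p = - (of_int k * \<delta>) + \<tau> * f (real p)" by (simp add: y_def \<tau>_def algebra_simps)
      thus "of_real (ln (real p)) * uexp (of_int k * y p) = uexp (- (of_int k * \<delta>)) * (of_real (ln (real p)) * uexp (\<tau> * f (real p)))"
        by (simp only: uexp_add mult_ac)
    qed
    hence "norm (\<Sum>p | prime p \<and> p \<le> M. of_real (ln (real p)) * uexp (of_int k * y p)) =
      norm (\<Sum>p | prime p \<and> p \<le> M. of_real (ln (real p)) * uexp (\<tau> * f (real p)))"
      by (simp only: norm_mult norm_uexp mult_1)
    also have "\<dots> \<le> \<omega> * prime_weight M"
    proof (rule exp)
      have k1: "1 \<le> \<bar>real_of_int k\<bar>" using k by linarith
      have "1 / real_of_int q \<le> \<bar>\<tau>\<bar>" using q k1 by (simp add: \<tau>_def divide_right_mono)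
      thus "M powr (-1/8) \<le> \<bar>\<tau>\<bar>" using q by linarith
      have "\<bar>real_of_int k\<bar> \<le> real_of_int (int K)" using k by linarith
      moreover have "\<bar>\<tau>\<bar> \<le> \<bar>real_of_int k\<bar>"
        using q by (simp add: \<tau>_def divide_le_eq mult_le_cancel_left1)
      ultimately show "\<bar>\<tau>\<bar> \<le> M powr (1/8)" using q K by simp
    qed
    finally show "norm (\<Sum>p | prime p \<and> p \<le> M. of_real (ln (real p)) * uexp (of_int k * y p)) \<le> \<omega> * prime_weight M" .
  qed (use W q in \<open>auto dest: prime_gt_0_nat\<close>)
  then obtain p where p: "prime p" "p \<le> M" "dist_nint (y p) < \<delta>" by auto
  define m where "m = round (y p)"
  have "\<bar>f (real p) / of_int q - \<delta> - of_int m\<bar> < \<delta>" using p(3) by (simp add: dist_nint_def m_def y_def)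
  hence "of_int m < f (real p) / of_int q" "f (real p) / of_int q < of_int m + 2 * \<delta>" by linarith+
  hence "of_int (q * m) < f (real p)" "f (real p) < of_int (q * m) + 1"
    using q by (auto simp: \<delta>_def field_simps)
  hence "\<lfloor>f (real p)\<rfloor> = q * m" by linarith
  thus ?thesis using p by blast
qed

text \<open>The shift of f(p) by \<delta> places f(p) just above an integer m, so that m is the
  floor and f(p) - m < 2\<delta>. As 0 <= \<xi> <= 1, passing from \<xi> f(p) to \<xi> m costs at
  most 2\<delta>.\<close>

lemma hit_box:
  fixes N :: nat and \<xi> \<delta> \<omega> :: real and K :: nat
  assumes W: "0 < prime_weight N"
    and exp: "\<And>\<tau>. N powr (-1/8) \<le> \<bar>\<tau>\<bar> \<Longrightarrow> \<bar>\<tau>\<bar> \<le> N powr (1/8) \<Longrightarrow>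
      norm (\<Sum>p | prime p \<and> p \<le> N. of_real (ln (real p)) * uexp (\<tau> * f (real p))) \<le> \<omega> * prime_weight N"
    and freq: "\<And>k l::int. k \<noteq> 0 \<or> l \<noteq> 0 \<Longrightarrow> \<bar>k\<bar> < int K \<Longrightarrow> \<bar>l\<bar> < int K \<Longrightarrow>
      N powr (-1/8) \<le> \<bar>of_int k * \<xi> + of_int l\<bar> \<and> \<bar>of_int k * \<xi> + of_int l\<bar> \<le> N powr (1/8)"
    and \<delta>: "0 < \<delta>" "\<delta> \<le> 1/2" "4 / \<delta>\<^sup>2 \<le> real K" and \<omega>: "0 \<le> \<omega>" "(real K)\<^sup>2 * \<omega> \<le> 1/4" and \<xi>: "0 \<le> \<xi>" "\<xi> \<le> 1"
  shows "\<exists>p. prime p \<and> p \<le> N \<and> dist_nint (\<xi> * of_int \<lfloor>f (real p)\<rfloor>) \<le> 3 * \<delta>"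
proof -
  define y where "y = (\<lambda>p::nat. \<xi> * f (real p))"
  define z where "z = (\<lambda>p::nat. f (real p) - \<delta>)"
  have "\<exists>p\<in>{p. prime p \<and> p \<le> N}. dist_nint (y p) < \<delta> \<and> dist_nint (z p) < \<delta>"
  proof (rule fejer_hit2)
    show "prime_weight N = (\<Sum>p | prime p \<and> p \<le> N. ln (real p))" by (rule prime_weight_def)
    fix k l :: int assume kl: "k \<noteq> 0 \<or> l \<noteq> 0" "\<bar>k\<bar> < int K" "\<bar>l\<bar> < int K"
    define \<tau> where "\<tau> = of_int k * \<xi> + of_int l"
    have "(\<Sum>p | prime p \<and> p \<le> N. of_real (ln (real p)) * uexp (of_int k * y p + of_int l * z p)) =
      uexp (- (of_int l * \<delta>)) * (\<Sum>p | prime p \<and> p \<le> N. of_real (ln (real p)) * uexp (\<tau> * f (real p)))"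
      unfolding sum_distrib_left
    proof (rule sum.cong[OF refl])
      fix p :: nat
      have "of_int k * y p + of_int l * z p = - (of_int l * \<delta>) + \<tau> * f (real p)" by (simp add: y_def z_def \<tau>_def algebra_simps)
      thus "of_real (ln (real p)) * uexp (of_int k * y p + of_int l * z p) = uexp (- (of_int l * \<delta>)) * (of_real (ln (real p)) * uexp (\<tau> * f (real p)))"
        by (simp only: uexp_add mult_ac)
    qed
    hence "norm (\<Sum>p | prime p \<and> p \<le> N. of_real (ln (real p)) * uexp (of_int k * y p + of_int l * z p)) =
      norm (\<Sum>p | prime p \<and> p \<le> N. of_real (ln (real p)) * uexp (\<tau> * f (real p)))"
      by (simp only: norm_mult norm_uexp mult_1)
    also have "\<dots> \<le> \<omega> * prime_weight N" using freq[OF kl] by (intro exp) (auto simp: \<tau>_def)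
    finally show "norm (\<Sum>p | prime p \<and> p \<le> N. of_real (ln (real p)) * uexp (of_int k * y p + of_int l * z p)) \<le> \<omega> * prime_weight N" .
  qed (use W \<delta> \<omega> in \<open>auto dest: prime_gt_0_nat\<close>)
  then obtain p where p: "prime p" "p \<le> N" "dist_nint (y p) < \<delta>" "dist_nint (z p) < \<delta>" by auto
  define m where "m = round (z p)"
  have "\<bar>f (real p) - \<delta> - of_int m\<bar> < \<delta>" using p(4) by (simp add: dist_nint_def m_def z_def)
  hence m: "of_int m < f (real p)" "f (real p) < of_int m + 2 * \<delta>" by linarith+
  hence fl: "\<lfloor>f (real p)\<rfloor> = m" using \<delta> by linarith
  have "dist_nint (\<xi> * of_int m) \<le> \<bar>\<xi> * of_int m - of_int (round (y p))\<bar>" by (rule dist_nint_le)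
  also have "\<dots> \<le> \<bar>y p - of_int (round (y p))\<bar> + \<bar>\<xi> * (f (real p) - of_int m)\<bar>"
    by (simp add: y_def algebra_simps)
  also have "\<dots> \<le> \<delta> + 1 * (2 * \<delta>)"
    unfolding abs_mult using p(3) m \<xi> by (intro add_mono mult_mono) (auto simp: dist_nint_def)
  finally show ?thesis using p fl by auto
qed

lemma f_le:
  assumes "1 \<le> x" "\<And>j. j \<in> {1..d} \<Longrightarrow> \<theta> j \<le> \<Theta>"
  shows "f x \<le> (\<Sum>j=1..d. \<alpha> j) * x powr \<Theta>"
  unfolding pp_eval_def sum_distrib_right
  using assms \<alpha>_pos by (intro sum_mono mult_left_mono powr_mono) (auto intro: less_imp_le)

lemma f_nonneg: "0 \<le> f x"
  unfolding pp_eval_def using \<alpha>_pos by (intro sum_nonneg mult_nonneg_nonneg) (auto intro: less_imp_le)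

text \<open>q(k\<xi> + l) differs from the integer ka + lq by k(q\<xi> - a), which is at most 1/2.
  That integer is nonzero: otherwise q would divide k by coprimality, which |k| < q excludes unless
  k = l = 0.\<close>

lemma frequency_separation:
  fixes \<xi> \<epsilon> :: real and a q k l :: int
  assumes "coprime a q" "0 < q" "\<bar>of_int q * \<xi> - of_int a\<bar> < \<epsilon>"
    and kl: "k \<noteq> 0 \<or> l \<noteq> 0" "\<bar>k\<bar> < q" and small: "\<bar>of_int k\<bar> * \<epsilon> \<le> 1/2"
  shows "1 / (2 * of_int q) \<le> \<bar>of_int k * \<xi> + of_int l\<bar>"
proof -
  have ne: "k * a + l * q \<noteq> 0"
  proof
    assume "k * a + l * q = 0"
    hence "k * a = q * (- l)" by (simp add: algebra_simps)
    hence "q dvd k * a" by (metis dvd_triv_left)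
    hence "q dvd k" using assms(1) by (simp add: coprime_commute coprime_dvd_mult_left_iff)
    hence "k = 0" using kl(2) assms(2) by (metis dvd_imp_le_int abs_of_pos not_less)
    thus False using \<open>k * a + l * q = 0\<close> kl(1) assms(2) by simp
  qed
  hence "1 \<le> \<bar>k * a + l * q\<bar>" by linarith
  hence "1 \<le> \<bar>real_of_int (k * a + l * q)\<bar>" by (metis of_int_1_le_iff of_int_abs)
  moreover have "real_of_int (k * a + l * q) = of_int q * (of_int k * \<xi> + of_int l) - of_int k * (of_int q * \<xi> - of_int a)"
    by (simp add: algebra_simps)
  moreover have "\<bar>of_int k * (of_int q * \<xi> - of_int a)\<bar> \<le> \<bar>of_int k\<bar> * \<epsilon>"
    unfolding abs_mult using assms(3) by (intro mult_left_mono) auto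
  ultimately have "1/2 \<le> \<bar>of_int q * (of_int k * \<xi> + of_int l)\<bar>" using small by linarith
  hence "1/2 \<le> of_int q * \<bar>of_int k * \<xi> + of_int l\<bar>" using assms(2) by (simp add: abs_mult)
  thus ?thesis using assms(2) by (simp add: field_simps)
qed

lemma prime_approximation:
  "\<exists>\<eta>>0. \<exists>C>0. \<exists>X0. \<forall>N::nat. X0 \<le> real N \<longrightarrow> (\<forall>\<xi>. 0 \<le> \<xi> \<longrightarrow> \<xi> \<le> 1 \<longrightarrow>
     (\<exists>p. prime p \<and> p \<le> N \<and> dist_nint (\<xi> * of_int \<lfloor>f (real p)\<rfloor>) \<le> C * N powr (-\<eta>)))"
proof -
  obtain \<sigma> X0 where \<sigma>: "0 < \<sigma>" "\<sigma> \<le> 1/8" and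
    W: "\<And>N::nat. X0 \<le> real N \<Longrightarrow> 0 < prime_weight N" and
    exp: "\<And>(N::nat) \<tau>. X0 \<le> real N \<Longrightarrow> N powr (-1/8) \<le> \<bar>\<tau>\<bar> \<Longrightarrow> \<bar>\<tau>\<bar> \<le> N powr (1/8) \<Longrightarrow>
     norm (\<Sum>p | prime p \<and> p \<le> N. of_real (ln (real p)) * uexp (\<tau> * f (real p))) \<le> N powr (-\<sigma>) * prime_weight N"
    using prime_exp_sum_bound unfolding prime_weight_def by blast
  define \<Theta> where "\<Theta> = (\<Sum>j=1..d. \<theta> j)"
  have \<Theta>: "\<theta> j \<le> \<Theta>" if "j \<in> {1..d}" for j
    unfolding \<Theta>_def using \<theta>_ge_1 that by (intro member_le_sum) (auto intro: order_trans[of 0 1])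
  have \<Theta>1: "1 \<le> \<Theta>" using \<Theta>[of top_index] \<theta>_ge_1[of top_index] top_index by simp
  define A where "A = (\<Sum>j=1..d. \<alpha> j)"
  have A: "A \<ge> 0" unfolding A_def using \<alpha>_pos by (intro sum_nonneg) (auto intro: less_imp_le)
  \<comment> \<open>The primes for small q are sought up to N^c, so that f(p) is at most A *
    N^(1/20), half of the exponent 1/10 won by Dirichlet's theorem.\<close>
  define c where "c = 1 / (20 * \<Theta>)"
  have c: "0 < c" "c \<le> 1/20" "c * \<Theta> = 1/20" using \<Theta>1 by (auto simp: c_def field_simps)
  \<comment> \<open>For M of order N^c one has M^(-\<sigma>) <= N^(-8\<eta>), while q^2 is at most
    of order N^(4\<eta>). The surplus N^(-4\<eta>) absorbs the constants.\<close>
  define \<eta> where "\<eta> = \<sigma> * c / 16"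
  have \<eta>: "0 < \<eta>" "16 * \<eta> = \<sigma> * c" using \<sigma> c by (auto simp: \<eta>_def)
  have "\<sigma> * c \<le> 1/8 * c" using \<sigma> c by (intro mult_right_mono) auto
  hence \<eta>c: "128 * \<eta> \<le> c" using \<eta> by simp
  have "\<sigma> * c \<le> \<sigma> * (1/20)" using \<sigma> c by (intro mult_left_mono) auto
  hence \<eta>\<sigma>: "320 * \<eta> \<le> \<sigma>" using \<eta> by simp
  have e1: "\<forall>\<^sub>F x::real in at_top. x powr (c/2) \<le> x powr c - 1" using c by real_asymp
  have e2: "\<forall>\<^sub>F x::real in at_top. X0 \<le> x powr (c/2)" using c by real_asymp
  have "0 < c/16 - 4 * \<eta>" using \<eta>c c by simp
  hence e3: "\<forall>\<^sub>F x::real in at_top. 200 \<le> x powr (c/16 - 4 * \<eta>)" by real_asymp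
  have "0 < c/16 - 2 * \<eta>" using \<eta>c c \<eta> by simp
  hence e4: "\<forall>\<^sub>F x::real in at_top. 5 \<le> x powr (c/16 - 2 * \<eta>)" by real_asymp
  have e5: "\<forall>\<^sub>F x::real in at_top. 800 \<le> x powr (4 * \<eta>)" using \<eta> by real_asymp
  have "0 < 1/8 - 2 * \<eta>" using \<eta>c c by simp
  hence e6: "\<forall>\<^sub>F x::real in at_top. 10 \<le> x powr (1/8 - 2 * \<eta>)" by real_asymp
  have "0 < 1/10 - 2 * \<eta>" using \<eta>c c by simp
  hence e7: "\<forall>\<^sub>F x::real in at_top. 10 \<le> x powr (1/10 - 2 * \<eta>)" by real_asymp
  have e8: "\<forall>\<^sub>F x::real in at_top. 4 * x powr (1/10) \<le> x powr (1/8)" by real_asymp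
  have e9: "\<forall>\<^sub>F x::real in at_top. x powr (-\<eta>) \<le> 1/2" using \<eta> by real_asymp
  have e10: "\<forall>\<^sub>F x::real in at_top. max X0 1 \<le> x" by (rule eventually_ge_at_top)
  have "\<forall>\<^sub>F x::real in at_top. x powr (c/2) \<le> x powr c - 1 \<and> X0 \<le> x powr (c/2) \<and> 200 \<le> x powr (c/16 - 4 * \<eta>) \<and> 5 \<le> x powr (c/16 - 2 * \<eta>)
     \<and> 800 \<le> x powr (4 * \<eta>) \<and> 10 \<le> x powr (1/8 - 2 * \<eta>) \<and> 10 \<le> x powr (1/10 - 2 * \<eta>) \<and> 4 * x powr (1/10) \<le> x powr (1/8) \<and> x powr (-\<eta>) \<le> 1/2 \<and> max X0 1 \<le> x" (is "eventually ?P _")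
    using e1 e2 e3 e4 e5 e6 e7 e8 e9 e10 by eventually_elim blast
  then obtain X1 where X1: "\<And>x::real. X1 \<le> x \<Longrightarrow> ?P x"
    unfolding eventually_at_top_linorder by blast
  show ?thesis
  proof (rule exI[of _ \<eta>], intro conjI \<eta>, rule exI[of _ "A + 3"], intro conjI, use A in simp, rule exI[of _ X1], intro allI impI)
    fix N :: nat and \<xi> :: real
    assume "X1 \<le> real N" and \<xi>: "0 \<le> \<xi>" "\<xi> \<le> 1"
    note N = X1[OF \<open>X1 \<le> real N\<close>]
    have N1: "1 \<le> real N" "0 < real N" "X0 \<le> real N" using N by auto
    have split: "N powr a * N powr b = N powr (a + b)" for a b by (rule powr_add[symmetric])
    have scale: "C * N powr a \<le> N powr b" if "C \<le> N powr (b - a)" for C a b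
    proof -
      have "C * N powr a \<le> N powr (b - a) * N powr a" using that by (intro mult_right_mono) auto
      thus ?thesis by (simp add: split)
    qed
    \<comment> \<open>This is the kernel length 4/\<delta>^2 that \<open>hit_box\<close> asks for at
      \<delta> = N^(-\<eta>).\<close>
    define K where "K = nat \<lceil>4 * N powr (2 * \<eta>)\<rceil>"
    have Klow: "4 * N powr (2 * \<eta>) \<le> real K" unfolding K_def by linarith
    have "1 \<le> N powr (2 * \<eta>)" using N1 \<eta> by (intro ge_one_powr_ge_zero) auto
    hence Kup: "real K \<le> 5 * N powr (2 * \<eta>)" unfolding K_def by linarith
    have N2\<eta>: "(N powr (2 * \<eta>))\<^sup>2 = N powr (4 * \<eta>)" using N1 by (simp add: powr_power)
    define Q where "Q = nat \<lceil>N powr (1/10)\<rceil>"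
    have "1 \<le> N powr (1/10)" using N1 by (intro ge_one_powr_ge_zero) auto
    hence Q: "N powr (1/10) \<le> real Q" "real Q \<le> 2 * N powr (1/10)" "0 < Q" unfolding Q_def by linarith+
    obtain a q :: int where q: "coprime a q" "0 < q" "q \<le> int Q" "\<bar>of_int q * \<xi> - of_int a\<bar> < 1 / real Q"
      using Dirichlet_approx_coprime[OF Q(3), of \<xi>] by metis
    have "1 / real Q \<le> 1 / N powr (1/10)" using Q N1 by (intro divide_left_mono) auto
    also have "\<dots> = N powr (-1/10)" using N1 by (simp add: powr_minus_divide)
    finally have qa: "\<bar>of_int q * \<xi> - of_int a\<bar> < N powr (-1/10)" using q by linarith
    show "\<exists>p. prime p \<and> p \<le> N \<and> dist_nint (\<xi> * of_int \<lfloor>f (real p)\<rfloor>) \<le> (A + 3) * N powr (-\<eta>)"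
    \<comment> \<open>For q >= K every frequency index |k| < K is below q, as
      \<open>frequency_separation\<close> requires. Otherwise q is below 5 * N^(2\<eta>), small
      enough for \<open>hit_multiple\<close> already at a small power of N.\<close>
    proof (cases "int K \<le> q")
      case True
      have "\<exists>p. prime p \<and> p \<le> N \<and> dist_nint (\<xi> * of_int \<lfloor>f (real p)\<rfloor>) \<le> 3 * N powr (-\<eta>)"
      proof (rule hit_box[OF W exp])
        show "N powr (-\<eta>) \<le> 1/2" "0 < N powr (-\<eta>)" using N N1 by auto
        have "(N powr (-\<eta>))\<^sup>2 = N powr (- (2 * \<eta>))" by (simp add: power2_eq_square split)
        also have "\<dots> = 1 / N powr (2 * \<eta>)" by (rule powr_minus_divide)
        finally have "(N powr (-\<eta>))\<^sup>2 = 1 / N powr (2 * \<eta>)" .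
        thus "4 / (N powr (-\<eta>))\<^sup>2 \<le> real K" using Klow by simp
        have "(real K)\<^sup>2 * N powr (-\<sigma>) \<le> (5 * N powr (2 * \<eta>))\<^sup>2 * N powr (-\<sigma>)"
          using Kup by (intro mult_right_mono power_mono) auto
        also have "\<dots> = 25 * N powr (4 * \<eta> - \<sigma>)" by (simp add: power_mult_distrib N2\<eta> split)
        also have "\<dots> \<le> 25 * N powr (- (4 * \<eta>))" using \<eta>\<sigma> \<eta> N1 by (intro mult_left_mono powr_mono) auto
        also have "\<dots> = 25 / N powr (4 * \<eta>)" by (simp add: powr_minus_divide)
        also have "\<dots> \<le> 25 / 800" using N N1 by (intro divide_left_mono) auto
        finally show "(real K)\<^sup>2 * N powr (-\<sigma>) \<le> 1/4" by simp
        fix k l :: int assume kl: "k \<noteq> 0 \<or> l \<noteq> 0" "\<bar>k\<bar> < int K" "\<bar>l\<bar> < int K"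
        have k5: "\<bar>of_int k\<bar> \<le> 5 * N powr (2 * \<eta>)" "\<bar>of_int l\<bar> \<le> 5 * N powr (2 * \<eta>)" using kl Kup by linarith+
        have "\<bar>of_int k\<bar> * N powr (-1/10) \<le> 5 * N powr (2 * \<eta>) * N powr (-1/10)"
          using k5 by (intro mult_right_mono) auto
        also have "\<dots> = 1/2 * (10 * N powr (2 * \<eta> - 1/10))" by (simp add: split)
        also have "10 * N powr (2 * \<eta> - 1/10) \<le> N powr 0" using N by (intro scale) auto
        finally have "\<bar>of_int k\<bar> * N powr (-1/10) \<le> 1/2" using N1 by simp
        hence "1 / (2 * of_int q) \<le> \<bar>of_int k * \<xi> + of_int l\<bar>"
          using kl True by (intro frequency_separation[OF q(1,2) qa]) auto
        moreover have "N powr (-1/8) \<le> 1 / (2 * of_int q)"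
        proof -
          have "real_of_int q \<le> real Q" using q by linarith
          hence "2 * real_of_int q \<le> 4 * N powr (1/10)" using Q by linarith
          also have "\<dots> \<le> N powr (1/8)" using N by simp
          finally have "1 / N powr (1/8) \<le> 1 / (2 * of_int q)" using q N1 by (intro divide_left_mono) auto
          thus ?thesis by (simp add: powr_minus_divide)
        qed
        moreover have "\<bar>of_int k * \<xi> + of_int l\<bar> \<le> N powr (1/8)"
        proof -
          have "\<bar>of_int k * \<xi>\<bar> \<le> \<bar>of_int k\<bar> * 1" unfolding abs_mult using \<xi> by (intro mult_left_mono) auto
          hence "\<bar>of_int k * \<xi> + of_int l\<bar> \<le> 10 * N powr (2 * \<eta>)" using k5 by linarith
          also have "\<dots> \<le> N powr (1/8)" using N by (intro scale) auto
          finally show ?thesis .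
        qed
        ultimately show "N powr (-1/8) \<le> \<bar>of_int k * \<xi> + of_int l\<bar> \<and> \<bar>of_int k * \<xi> + of_int l\<bar> \<le> N powr (1/8)"
          by linarith
      qed (use N1 \<xi> in auto)
      moreover have "3 * N powr (-\<eta>) \<le> (A + 3) * N powr (-\<eta>)" using A by (intro mult_right_mono) auto
      ultimately show ?thesis by (meson order_trans)
    next
      case False
      define M where "M = nat \<lfloor>N powr c\<rfloor>"
      have Mup: "real M \<le> N powr c" unfolding M_def by simp
      have "N powr c - 1 \<le> real M" unfolding M_def by linarith
      hence Mlow: "N powr (c/2) \<le> real M" using N by linarith
      have M0: "X0 \<le> real M" using Mlow N by linarith
      have M1: "0 < real M" using N1 by (intro less_le_trans[OF _ Mlow]) simp
      have MN: "M \<le> N"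
      proof -
        have "N powr c \<le> N powr 1" using N1 c by (intro powr_mono) auto
        thus ?thesis using Mup N1 by simp
      qed
      have M8: "N powr (c/16) \<le> M powr (1/8)"
      proof -
        have "N powr (c/16) = (N powr (c/2)) powr (1/8)" by (simp add: powr_powr)
        also have "\<dots> \<le> M powr (1/8)" using Mlow by (intro powr_mono2) auto
        finally show ?thesis .
      qed
      have qK: "real_of_int q \<le> 5 * N powr (2 * \<eta>)" using False Kup by linarith
      have q2: "8 * (real_of_int q)\<^sup>2 \<le> 200 * N powr (4 * \<eta>)"
      proof -
        have "(real_of_int q)\<^sup>2 \<le> (5 * N powr (2 * \<eta>))\<^sup>2" using qK q by (intro power_mono) auto
        thus ?thesis by (simp add: power_mult_distrib N2\<eta>)
      qed
      have "\<exists>p m. prime p \<and> p \<le> M \<and> \<lfloor>f (real p)\<rfloor> = q * m"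
      proof (rule hit_multiple[OF W exp])
        have "real_of_int q \<le> N powr (c/16)" using qK scale[of 5 "c/16" "2 * \<eta>"] N by linarith
        hence "real_of_int q \<le> M powr (1/8)" using M8 by linarith
        hence "1 / M powr (1/8) \<le> 1 / real_of_int q" using q M1 by (intro divide_left_mono) auto
        thus "M powr (-1/8) \<le> 1 / real_of_int q" by (simp add: powr_minus_divide)
        show "8 * (real_of_int q)\<^sup>2 \<le> M powr (1/8)" using q2 scale[of 200 "c/16" "4 * \<eta>"] N M8 by linarith
        have "M powr (-\<sigma>) \<le> (N powr (c/2)) powr (-\<sigma>)" using Mlow \<sigma> N1 by (intro powr_mono2') auto
        also have "\<dots> = N powr (- (8 * \<eta>))" by (simp add: powr_powr \<eta>_def mult.commute)
        finally have "8 * (real_of_int q)\<^sup>2 * M powr (-\<sigma>) \<le> 200 * N powr (4 * \<eta>) * N powr (- (8 * \<eta>))"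
          by (rule mult_mono[OF q2]) auto
        also have "\<dots> = 200 * N powr (- (4 * \<eta>))" by (simp add: split)
        also have "\<dots> = 200 / N powr (4 * \<eta>)" by (simp add: powr_minus_divide)
        also have "\<dots> \<le> 200 / 800" using N N1 by (intro divide_left_mono) auto
        finally show "8 * (real_of_int q)\<^sup>2 * M powr (-\<sigma>) \<le> 1/4" by simp
      qed (use M0 q in auto)
      then obtain p m where p: "prime p" "p \<le> M" "\<lfloor>f (real p)\<rfloor> = q * m" by blast
      have p1: "1 \<le> real p" using p prime_gt_0_nat[of p] by simp
      have "0 \<le> q * m" using f_nonneg[of "real p"] p(3) by (metis zero_le_floor)
      hence m0: "0 \<le> m" using q by (simp add: zero_le_mult_iff)
      have "\<bar>real_of_int m\<bar> \<le> of_int (q * m)"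
        using m0 q by (simp add: mult_le_cancel_right1)
      also have "\<dots> \<le> f (real p)" using p(3) by linarith
      also have "\<dots> \<le> A * real p powr \<Theta>" unfolding A_def by (rule f_le[OF p1 \<Theta>])
      also have "\<dots> \<le> A * (N powr c) powr \<Theta>"
        using A p Mup \<Theta>1 by (intro mult_left_mono powr_mono2) auto
      also have "(N powr c) powr \<Theta> = N powr (1/20)" unfolding powr_powr c(3) ..
      finally have mb: "\<bar>real_of_int m\<bar> \<le> A * N powr (1/20)" .
      \<comment> \<open>With \<lfloor>f(p)\<rfloor> = q * m, the integer a * m is close: the error
        |q\<xi> - a| |m| is at most N^(-1/10) times A * N^(1/20).\<close>
      have "dist_nint (\<xi> * of_int \<lfloor>f (real p)\<rfloor>) \<le> \<bar>\<xi> * of_int \<lfloor>f (real p)\<rfloor> - of_int (a * m)\<bar>" by (rule dist_nint_le)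
      also have "\<dots> = \<bar>of_int q * \<xi> - of_int a\<bar> * \<bar>of_int m\<bar>"
        unfolding p(3) abs_mult[symmetric] by (simp add: algebra_simps)
      also have "\<dots> \<le> N powr (-1/10) * (A * N powr (1/20))" using qa mb by (intro mult_mono) auto
      also have "\<dots> = A * N powr (-1/20)" by (simp add: mult.left_commute split)
      also have "\<dots> \<le> (A + 3) * N powr (-\<eta>)" using A \<eta>c c N1 by (intro mult_mono powr_mono) auto
      finally show ?thesis using p MN by (intro exI[of _ p]) auto
    qed
  qed
qed

end

theorem theorem2p9:
  fixes d :: nat and \<alpha> \<theta> :: "nat \<Rightarrow> real"
  assumes "pseudo_poly d \<alpha> \<theta>"
  shows "\<exists>\<eta>::real. \<eta> > 0 \<and> (\<exists>C::real. C > 0 \<and>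
           (\<forall>\<xi>::real. \<forall>\<^sub>F N in sequentially.
              Min {dist_nint (\<xi> * of_int \<lfloor>pp_eval d \<alpha> \<theta> (real p)\<rfloor>) | p::nat. prime p \<and> 1 \<le> p \<and> p \<le> N}
                \<le> C * real N powr (-\<eta>)))"
proof -
  interpret pseudo_polynomial d \<alpha> \<theta> by standard (rule assms)
  obtain \<eta> C X0 where \<eta>: "\<eta> > 0" and C: "C > 0" and
    approx: "\<And>(N::nat) \<xi>. X0 \<le> real N \<Longrightarrow> 0 \<le> \<xi> \<Longrightarrow> \<xi> \<le> 1 \<Longrightarrow>
     \<exists>p. prime p \<and> p \<le> N \<and> dist_nint (\<xi> * of_int \<lfloor>f (real p)\<rfloor>) \<le> C * N powr (-\<eta>)"
    using prime_approximation by blast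
  have "\<forall>\<^sub>F N in sequentially. Min {dist_nint (\<xi> * of_int \<lfloor>f (real p)\<rfloor>) | p::nat. prime p \<and> 1 \<le> p \<and> p \<le> N}
                \<le> C * real N powr (-\<eta>)" for \<xi>
  proof -
    have "\<forall>\<^sub>F N in sequentially. X0 \<le> real N"
      using filterlim_real_sequentially by (simp add: filterlim_at_top)
    thus ?thesis
    proof eventually_elim
      case (elim N)
      define S where "S = {dist_nint (\<xi> * of_int \<lfloor>f (real p)\<rfloor>) | p::nat. prime p \<and> 1 \<le> p \<and> p \<le> N}"
      have "finite S"
      proof (rule finite_subset)
        show "S \<subseteq> (\<lambda>p. dist_nint (\<xi> * of_int \<lfloor>f (real p)\<rfloor>)) ` {..N}" by (auto simp: S_def)
      qed auto
      \<comment> \<open>Passing to the fractional part of \<xi> brings it into the range [0, 1] and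
        changes \<xi> \<lfloor>f(p)\<rfloor> by an integer only.\<close>
      obtain p where p: "prime p" "p \<le> N" "dist_nint (frac \<xi> * of_int \<lfloor>f (real p)\<rfloor>) \<le> C * N powr (-\<eta>)"
        using approx[OF elim, of "frac \<xi>"] frac_lt_1[of \<xi>] by (auto simp: less_imp_le)
      have "\<xi> * of_int \<lfloor>f (real p)\<rfloor> = frac \<xi> * of_int \<lfloor>f (real p)\<rfloor> + of_int (\<lfloor>\<xi>\<rfloor> * \<lfloor>f (real p)\<rfloor>)"
        by (simp add: frac_def algebra_simps)
      hence "dist_nint (\<xi> * of_int \<lfloor>f (real p)\<rfloor>) \<le> C * N powr (-\<eta>)"
        using p(3) by (simp only: dist_nint_add_int)
      moreover have "dist_nint (\<xi> * of_int \<lfloor>f (real p)\<rfloor>) \<in> S"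
        using p prime_gt_0_nat[of p] by (auto simp: S_def Suc_le_eq)
      hence "Min S \<le> dist_nint (\<xi> * of_int \<lfloor>f (real p)\<rfloor>)" using \<open>finite S\<close> by (intro Min_le)
      ultimately show ?case by (simp add: S_def)
    qed
  qed
  thus ?thesis using \<eta> C by blast
qed

end
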